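(* Let $\mathbf{A}=\otimes_{i\in I}A_i$, where $I$ is an infinite set and each algebra $A_i$ is a matrix algebra over a field $\mathbb{F}$ of dimension $>1$. Then $$\dim_{\mathbb{F}}\mathrm{Der}(\mathbf{A})=\dim_{\mathbb{F}}\mathrm{Outder}(\mathbf{A})=|\mathbb{F}|^{|I|}.$$
   Context: A matrix algebra is an algebra isomorphic to $M_n(\mathbb{F})$ for some $n\ge1$. The infinite tensor product $\otimes_{i\in I}A_i$ is the direct limit of the finite tensor products $A_{i_1}\otimes\cdots\otimes A_{i_r}$ over finite subsets $\{i_1,\dots,i_r\}\subset I$ (filling in units in the other positions). $\mathrm{Der}(\mathbf{A})$ is the Lie algebra of all $\mathbb{F}$-linear derivations of $\mathbf{A}$, $\mathrm{Inder}(\mathbf{A})$ is its ideal of inner derivations $x\mapsto[a,x]=ax-xa$, $a\in\mathbf{A}$, and $\mathrm{Outder}(\mathbf{A})=\mathrm{Der}(\mathbf{A})/\mathrm{Inder}(\mathbf{A})$. $|X|$ denotes the cardinality of a set $X$, and $|X|^{|Y|}$ is the cardinality of the set of all maps $Y\to X$. Dimensions are cardinal numbers. *)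

theory Defs
  imports "Jordan_Normal_Form.VS_Connect" "HOL-Algebra.Product_Groups" "HOL-Algebra.QuotRing"
begin

unbundle cardinal_syntax

text \<open>Algebras over a field \<open>'k\<close> are associative and unital, not necessarily commutative. They are
  represented by the record type \<open>('k, 'a) module\<close>, whose fields comprise those of a ring.
  (The locale \<open>algebra\<close> of \<open>HOL-Algebra\<close> covers commutative algebras only.)\<close>

locale unital_algebra =
  vectorspace class_ring A + alg: ring A
  for A :: "('k::field, 'a) module" (structure) +
  assumes smult_mult_left: "\<lbrakk>x \<in> carrier A; y \<in> carrier A\<rbrakk> \<Longrightarrow> (c \<odot> x) \<otimes> y = c \<odot> (x \<otimes> y)"
    and smult_mult_right: "\<lbrakk>x \<in> carrier A; y \<in> carrier A\<rbrakk> \<Longrightarrow> x \<otimes> (c \<odot> y) = c \<odot> (x \<otimes> y)"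

definition alg_iso :: "('k::field, 'a) module \<Rightarrow> ('k, 'b) module \<Rightarrow> ('a \<Rightarrow> 'b) set" where
  "alg_iso A B = {h \<in> Ring.ring_hom A B \<inter> LinearCombinations.module_hom class_ring A B.
     bij_betw h (carrier A) (carrier B)}"

text \<open>\<^term>\<open>module_mat TYPE('k::field) n n\<close> carries the matrix product and the identity matrix,
  so it is the algebra of \<open>n \<times> n\<close> matrices.\<close>

definition matrix_algebra :: "('k::field, 'a) module \<Rightarrow> bool" where
  "matrix_algebra A \<longleftrightarrow>
     unital_algebra A \<and> (\<exists>n\<ge>1. alg_iso A (module_mat TYPE('k) n n) \<noteq> {})"

text \<open>Dimensions are cardinal numbers. Every vector space has a basis and all its bases are equipotent,
  so the choice of the basis is immaterial.\<close>

definition vdim :: "('k::field, 'v) module \<Rightarrow> 'v rel" where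
  "vdim V = |SOME B. vectorspace.basis class_ring V B|"

text \<open>The quotient of \<open>M\<close> by \<open>N\<close> extends \<^const>\<open>FactRing\<close> by the scalar multiplication. The union
  over \<open>x\<close> is the single coset \<open>N + c x\<close>; this also gives the right result for \<open>c = 0\<close>.\<close>

definition quotient_module :: "('k::field, 'a) module \<Rightarrow> 'a set \<Rightarrow> ('k, 'a set) module" where
  "quotient_module M N =
     \<lparr>carrier = a_rcosets\<^bsub>M\<^esub> N, mult = rcoset_mult M N, one = N +>\<^bsub>M\<^esub> \<one>\<^bsub>M\<^esub>, zero = N,
      add = set_add M, smult = (\<lambda>c X. \<Union>x\<in>X. N +>\<^bsub>M\<^esub> (c \<odot>\<^bsub>M\<^esub> x))\<rparr>"

text \<open>The field \<open>mult\<close> of the record of derivations is the Lie bracket; there is no unit element.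
  Derivations are extensional functions, so that equality is equality on \<open>A\<close>.\<close>

definition Der :: "('k::field, 'a) module \<Rightarrow> ('k, 'a \<Rightarrow> 'a) module" where
  "Der A =
     \<lparr>carrier = {d \<in> extensional (carrier A) \<inter> LinearCombinations.module_hom class_ring A A.
        \<forall>x\<in>carrier A. \<forall>y\<in>carrier A. d (x \<otimes>\<^bsub>A\<^esub> y) = (d x \<otimes>\<^bsub>A\<^esub> y) \<oplus>\<^bsub>A\<^esub> (x \<otimes>\<^bsub>A\<^esub> d y)},
      mult = (\<lambda>d e. \<lambda>x\<in>carrier A. d (e x) \<ominus>\<^bsub>A\<^esub> e (d x)),
      one = undefined,
      zero = (\<lambda>x\<in>carrier A. \<zero>\<^bsub>A\<^esub>),
      add = (\<lambda>d e. \<lambda>x\<in>carrier A. d x \<oplus>\<^bsub>A\<^esub> e x),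
      smult = (\<lambda>c d. \<lambda>x\<in>carrier A. c \<odot>\<^bsub>A\<^esub> d x)\<rparr>"

definition Inder :: "('k::field, 'a) module \<Rightarrow> ('a \<Rightarrow> 'a) set" where
  "Inder A = (\<lambda>a. \<lambda>x\<in>carrier A. (a \<otimes>\<^bsub>A\<^esub> x) \<ominus>\<^bsub>A\<^esub> (x \<otimes>\<^bsub>A\<^esub> a)) ` carrier A"

definition Outder :: "('k::field, 'a) module \<Rightarrow> ('k, ('a \<Rightarrow> 'a) set) module" where
  "Outder A = quotient_module (Der A) (Inder A)"

text \<open>The free vector space on a monoid \<open>G\<close>, with the multiplication extended bilinearly from \<open>G\<close>.\<close>

definition monoid_algebra :: "('x, 'm) monoid_scheme \<Rightarrow> ('k::field, 'x \<Rightarrow> 'k) module" where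
  "monoid_algebra G =
     \<lparr>carrier = {u. finite {x. u x \<noteq> 0} \<and> {x. u x \<noteq> 0} \<subseteq> carrier G},
      mult = (\<lambda>u v z. \<Sum>(x, y)\<in>{(x, y). u x \<noteq> 0 \<and> v y \<noteq> 0 \<and> x \<otimes>\<^bsub>G\<^esub> y = z}. u x * v y),
      one = (\<lambda>z. of_bool (z = \<one>\<^bsub>G\<^esub>)),
      zero = (\<lambda>z. 0),
      add = (\<lambda>u v z. u z + v z),
      smult = (\<lambda>c u z. c * u z)\<rparr>"

text \<open>Here \<^const>\<open>product_group\<close> is used for the multiplicative monoids of the algebras \<open>A i\<close>: its
  elements are the families \<open>x\<close> with \<open>x i \<in> A i\<close> for \<open>i \<in> S\<close>, multiplied componentwise. The
  basis vector \<open>\<lambda>z. of_bool (z = x)\<close> of the free space stands for the pure tensor of the \<open>x i\<close>.\<close>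

abbreviation free_tensors ::
  "('i \<Rightarrow> ('k::field, 'b) module) \<Rightarrow> 'i set \<Rightarrow> ('k, ('i \<Rightarrow> 'b) \<Rightarrow> 'k) module" where
  "free_tensors A S \<equiv> monoid_algebra (product_group S A)"

definition multilinear_relations ::
  "('i \<Rightarrow> ('k::field, 'b) module) \<Rightarrow> 'i set \<Rightarrow> (('i \<Rightarrow> 'b) \<Rightarrow> 'k) set" where
  "multilinear_relations A S =
     {(\<lambda>z. of_bool (z = x(i := a \<oplus>\<^bsub>A i\<^esub> b)) - of_bool (z = x(i := a)) - of_bool (z = x(i := b)))
        | x i a b. x \<in> (\<Pi>\<^sub>E i\<in>S. carrier (A i)) \<and> i \<in> S \<and> a \<in> carrier (A i) \<and> b \<in> carrier (A i)}
   \<union> {(\<lambda>z. of_bool (z = x(i := c \<odot>\<^bsub>A i\<^esub> a)) - c * of_bool (z = x(i := a)))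
        | x i a c. x \<in> (\<Pi>\<^sub>E i\<in>S. carrier (A i)) \<and> i \<in> S \<and> a \<in> carrier (A i)}"

definition tensor_kernel ::
  "('i \<Rightarrow> ('k::field, 'b) module) \<Rightarrow> 'i set \<Rightarrow> (('i \<Rightarrow> 'b) \<Rightarrow> 'k) set" where
  "tensor_kernel A S =
     LinearCombinations.module.span class_ring (free_tensors A S) (multilinear_relations A S)"

definition finite_tensor ::
  "('i \<Rightarrow> ('k::field, 'b) module) \<Rightarrow> 'i set \<Rightarrow> ('k, (('i \<Rightarrow> 'b) \<Rightarrow> 'k) set) module" where
  "finite_tensor A S = quotient_module (free_tensors A S) (tensor_kernel A S)"

text \<open>For \<open>S \<subseteq> T\<close>, the homomorphism from the tensor product over \<open>S\<close> to the one over \<open>T\<close> that fills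
  in units in the positions outside \<open>S\<close>.\<close>

definition fill_units ::
  "('i \<Rightarrow> ('k::field, 'b) module) \<Rightarrow> 'i set \<Rightarrow> 'i set \<Rightarrow> ('i \<Rightarrow> 'b) \<Rightarrow> 'i \<Rightarrow> 'b" where
  "fill_units A S T x = (\<lambda>i\<in>T. if i \<in> S then x i else \<one>\<^bsub>A i\<^esub>)"

definition tensor_map ::
  "('i \<Rightarrow> ('k::field, 'b) module) \<Rightarrow> 'i set \<Rightarrow> 'i set \<Rightarrow>
     (('i \<Rightarrow> 'b) \<Rightarrow> 'k) set \<Rightarrow> (('i \<Rightarrow> 'b) \<Rightarrow> 'k) set" where
  "tensor_map A S T X =
     (\<Union>u\<in>X. tensor_kernel A T +>\<^bsub>free_tensors A T\<^esub>
       (\<lambda>z. \<Sum>x\<in>{x. u x \<noteq> 0 \<and> fill_units A S T x = z}. u x))"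

text \<open>The direct limit of algebras \<open>B j\<close> over a directed set \<open>P\<close> with transition maps \<open>\<phi> j l\<close> for
  \<open>j \<le> l\<close>: the disjoint union modulo the relation of becoming equal at a later stage. Every union
  below is over representatives (and upper bounds) that all yield the same class.\<close>

definition limit_rel ::
  "'j set \<Rightarrow> ('j \<Rightarrow> 'j \<Rightarrow> bool) \<Rightarrow> ('j \<Rightarrow> ('k, 'x) module) \<Rightarrow> ('j \<Rightarrow> 'j \<Rightarrow> 'x \<Rightarrow> 'x) \<Rightarrow> ('j \<times> 'x) rel"
  where
  "limit_rel P leq B \<phi> =
     {((j, x), (k, y)). j \<in> P \<and> k \<in> P \<and> x \<in> carrier (B j) \<and> y \<in> carrier (B k) \<and>
        (\<exists>l\<in>P. leq j l \<and> leq k l \<and> \<phi> j l x = \<phi> k l y)}"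

definition direct_limit ::
  "'j set \<Rightarrow> ('j \<Rightarrow> 'j \<Rightarrow> bool) \<Rightarrow> ('j \<Rightarrow> ('k, 'x) module) \<Rightarrow> ('j \<Rightarrow> 'j \<Rightarrow> 'x \<Rightarrow> 'x) \<Rightarrow>
     ('k, ('j \<times> 'x) set) module"
  where
  "direct_limit P leq B \<phi> =
     \<lparr>carrier = Sigma P (\<lambda>j. carrier (B j)) // limit_rel P leq B \<phi>,
      mult = (\<lambda>X Y. \<Union>(j, x)\<in>X. \<Union>(k, y)\<in>Y. \<Union>l\<in>{l \<in> P. leq j l \<and> leq k l}.
        limit_rel P leq B \<phi> `` {(l, \<phi> j l x \<otimes>\<^bsub>B l\<^esub> \<phi> k l y)}),
      one = (\<Union>j\<in>P. limit_rel P leq B \<phi> `` {(j, \<one>\<^bsub>B j\<^esub>)}),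
      zero = (\<Union>j\<in>P. limit_rel P leq B \<phi> `` {(j, \<zero>\<^bsub>B j\<^esub>)}),
      add = (\<lambda>X Y. \<Union>(j, x)\<in>X. \<Union>(k, y)\<in>Y. \<Union>l\<in>{l \<in> P. leq j l \<and> leq k l}.
        limit_rel P leq B \<phi> `` {(l, \<phi> j l x \<oplus>\<^bsub>B l\<^esub> \<phi> k l y)}),
      smult = (\<lambda>c X. \<Union>(j, x)\<in>X. limit_rel P leq B \<phi> `` {(j, c \<odot>\<^bsub>B j\<^esub> x)})\<rparr>"

definition infinite_tensor ::
  "('i \<Rightarrow> ('k::field, 'b) module) \<Rightarrow> 'i set \<Rightarrow>
     ('k, ('i set \<times> (('i \<Rightarrow> 'b) \<Rightarrow> 'k) set) set) module" where
  "infinite_tensor A I =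
     direct_limit {S. finite S \<and> S \<subseteq> I} (\<subseteq>) (finite_tensor A) (tensor_map A)"

end

theory Submission
  imports Defs "HOL-Algebra.Free_Abelian_Groups"
begin

text \<open>Write \<open>\<A>\<close> for the infinite tensor product. Both dimensions are squeezed between \<open>|F|\<^sup>|\<^sup>I\<^sup>|\<close>
and itself.

For the upper bound, a derivation is determined by its values on a generating set, and \<open>\<A>\<close> is
generated by the matrix units of its factors, of which there are only \<open>|I|\<close> many. Counting pure
tensors and their finite combinations gives \<open>|\<A>| \<le> |F|\<^sup>|\<^sup>I\<^sup>|\<close>, so there are at most \<open>(|F|\<^sup>|\<^sup>I\<^sup>|)\<^sup>|\<^sup>I\<^sup>| =
|F|\<^sup>|\<^sup>I\<^sup>|\<close> derivations at all (\<open>Der_le_cexp\<close>). A basis is no larger than its space, and the outer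
derivations are a quotient.

For the lower bound, choose a noncentral element \<open>e i\<close> in every factor. An element of \<open>\<A>\<close> lives
in a finite stage and hence commutes with almost all \<open>e i\<close>; therefore \<open>D c = (\<Sum>i. c i [e i, _])\<close>
is a well-defined derivation for every \<open>c : I \<rightarrow> F\<close>, although \<open>(\<Sum>i. c i e i)\<close> need not be an
element of \<open>\<A>\<close>. If \<open>D c = [a, _]\<close> is inner, then it vanishes on all factors that commute with
\<open>a\<close>, which are almost all, and this forces \<open>c\<close> to have finite support
(\<open>inner_sum_derivation_finite\<close>). So \<open>F\<^sup>I\<close> modulo the finitely supported functions embeds into the
outer derivations, and it remains to find \<open>|F|\<^sup>|\<^sup>I\<^sup>|\<close> vectors in \<open>F\<^sup>I\<close> that are linearly independent
modulo finite support. Dedekind's independence of characters provides them for finite and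
infinite fields alike: every \<open>f : I \<rightarrow> F\<close> extends to a character of the free monoid of words over
\<open>I\<close>, distinct \<open>f\<close> give distinct characters, and there are \<open>|I|\<close> words; repeating each value
infinitely often makes the independence survive finitely many changes
(\<open>ex_independent_sequences\<close>). The comparison of an independent family with an arbitrary basis is
\<open>card_indep_le_basis\<close>.

The argument needs two facts about \<open>\<A>\<close>. It is an algebra generated by copies of its factors,
where different factors commute; this is read off from the construction as a direct limit of
quotients of monoid algebras. And commutators inside a factor do not collapse: a product of
linear functionals on the factors is multilinear, so it vanishes on the relations at every stage
and detects such elements (\<open>factor_emb_nonzero\<close>).\<close>

section \<open>Bases of infinite-dimensional vector spaces\<close>

text \<open>A linear dependence involves finitely many vectors, and these all lie in one member of the
chain.\<close>

lemma (in vectorspace) lin_indpt_chain_Union: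
  assumes "\<And>X Y. X \<in> C \<Longrightarrow> Y \<in> C \<Longrightarrow> X \<subseteq> Y \<or> Y \<subseteq> X" and "C \<noteq> {}"
    and "\<And>X. X \<in> C \<Longrightarrow> lin_indpt X"
  shows "lin_indpt (\<Union>C)"
proof (rule notI)
  assume "lin_dep (\<Union>C)"
  then obtain A a v where A: "finite A" "A \<subseteq> \<Union>C" "a \<in> A \<rightarrow> carrier K"
    "lincomb a A = \<zero>\<^bsub>V\<^esub>" "v \<in> A" "a v \<noteq> \<zero>\<^bsub>K\<^esub>"
    unfolding lin_dep_def by metis
  have "\<exists>X\<in>C. A \<subseteq> X"
    using finite_subset_Union_chain[of A C UNIV] A assms(1,2)
    by (metis UNIV_I subsetI subset_chain_def)
  then obtain X where "X \<in> C" "A \<subseteq> X" by blast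
  then show False
    using lin_dep_crit[of A X a v] A assms(3) by auto
qed

text \<open>By Zorn's lemma there is a maximal independent set above \<open>L\<close>. It spans, because a vector
outside its span could be added to it.\<close>

lemma (in vectorspace) extend_to_basis:
  assumes "L \<subseteq> carrier V" "lin_indpt L"
  obtains B where "L \<subseteq> B" "basis B"
proof -
  define F where "F = {X. L \<subseteq> X \<and> X \<subseteq> carrier V \<and> lin_indpt X}"
  have LF: "L \<in> F"
    using assms by (simp add: F_def)
  have "\<exists>U\<in>F. \<forall>X\<in>C. X \<subseteq> U" if C: "subset.chain F C" for C
  proof (cases "C = {}")
    case True
    then show ?thesis using LF by blast
  next
    case False
    have CF: "\<And>X. X \<in> C \<Longrightarrow> L \<subseteq> X \<and> X \<subseteq> carrier V \<and> lin_indpt X"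
      and total: "\<And>X Y. X \<in> C \<Longrightarrow> Y \<in> C \<Longrightarrow> X \<subseteq> Y \<or> Y \<subseteq> X"
      using C by (auto simp: subset_chain_def F_def)
    have "lin_indpt (\<Union>C)"
      by (rule lin_indpt_chain_Union) (use total False CF in auto)
    moreover have "L \<subseteq> \<Union>C" "\<Union>C \<subseteq> carrier V"
      using CF False by auto
    ultimately have "\<Union>C \<in> F"
      by (simp add: F_def)
    then show ?thesis by blast
  qed
  then obtain B where B: "B \<in> F" and max: "\<And>X. X \<in> F \<Longrightarrow> B \<subseteq> X \<Longrightarrow> X = B"
    using subset_Zorn[of F] by metis
  have BV: "B \<subseteq> carrier V" and Bi: "lin_indpt B" and LB: "L \<subseteq> B"
    using B by (auto simp: F_def)
  have "v \<in> span B" if v: "v \<in> carrier V" for v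
  proof (cases "v \<in> B")
    case True
    then show ?thesis using in_own_span[OF BV] by blast
  next
    case False
    have "B \<union> {v} \<notin> F"
      using max[of "B \<union> {v}"] False by blast
    then have "lin_dep (B \<union> {v})"
      using BV LB v by (auto simp: F_def)
    then show ?thesis
      using lin_dep_iff_in_span[OF BV Bi v False] by blast
  qed
  then have "basis B"
    unfolding basis_def using BV Bi span_is_subset2[OF BV] by blast
  then show thesis using that LB by blast
qed

text \<open>Extend \<open>L\<close> to a basis \<open>M\<close>. Every vector of \<open>B\<close> is a combination of finitely many members of
\<open>M\<close>, and the members used in this way already span, so by independence they exhaust \<open>M\<close>. Thus \<open>M\<close>
is a union of \<open>|B|\<close> finite sets.\<close>

lemma (in vectorspace) card_indep_le_basis:
  assumes L: "L \<subseteq> carrier V" "lin_indpt L" "infinite L" and B: "basis B"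
  shows "|L| \<le>o |B|"
proof -
  obtain M where LM: "L \<subseteq> M" and M: "basis M"
    using extend_to_basis L by blast
  have MV: "M \<subseteq> carrier V" and Mi: "lin_indpt M" and Ms: "span M = carrier V"
    and BV: "B \<subseteq> carrier V" and Bs: "span B = carrier V"
    using M B by (auto simp: basis_def)
  have "\<exists>F. finite F \<and> F \<subseteq> M \<and> b \<in> span F" if "b \<in> B" for b
  proof -
    have "b \<in> span M" using that BV Ms by blast
    then obtain a F where F: "b = lincomb a F" "finite F" "F \<subseteq> M" "a \<in> F \<rightarrow> carrier K"
      unfolding span_def by blast
    then have "b \<in> span F" unfolding span_def by blast
    then show ?thesis using F by blast
  qed
  then obtain F where F: "\<And>b. b \<in> B \<Longrightarrow> finite (F b)" "\<And>b. b \<in> B \<Longrightarrow> F b \<subseteq> M"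
    "\<And>b. b \<in> B \<Longrightarrow> b \<in> span (F b)"
    by metis
  define U where "U = (\<Union>b\<in>B. F b)"
  have UM: "U \<subseteq> M" using F(2) by (auto simp: U_def)
  have UV: "U \<subseteq> carrier V" using UM MV by blast
  have "B \<subseteq> span U"
  proof
    fix b assume "b \<in> B"
    then have "span (F b) \<subseteq> span U"
      by (intro span_is_monotone) (auto simp: U_def)
    then show "b \<in> span U" using F(3) \<open>b \<in> B\<close> by blast
  qed
  then have "span B \<subseteq> span U"
    by (intro span_is_subset span_is_submodule UV)
  then have Us: "carrier V \<subseteq> span U" using Bs by simp
  have "M \<subseteq> U"
  proof
    fix m assume m: "m \<in> M"
    show "m \<in> U"
    proof (rule ccontr)
      assume "m \<notin> U"
      have "lin_indpt U" using Mi UM subset_li_is_li by blast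
      moreover have "m \<in> carrier V" "m \<in> span U" using m MV Us by auto
      ultimately have "lin_dep (U \<union> {m})"
        using lin_dep_iff_in_span[OF UV _ _ \<open>m \<notin> U\<close>] by blast
      moreover have "U \<union> {m} \<subseteq> M" using UM m by blast
      ultimately show False using supset_ld_is_ld Mi by blast
    qed
  qed
  then have UM': "U = M" using UM by blast
  have "infinite M" using LM L(3) finite_subset by blast
  then have "infinite B" using F(1) UM' by (auto simp: U_def)
  have "|U| \<le>o |B|"
    unfolding U_def using \<open>infinite B\<close> F(1)
    by (intro card_of_UNION_ordLeq_infinite)
      (auto intro: ordLess_imp_ordLeq finite_ordLess_infinite2)
  moreover have "|L| \<le>o |M|" using LM by (rule card_of_mono1)
  ultimately show ?thesis using UM' ordLeq_transitive by blast
qed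

text \<open>The choice in the definition of the dimension hits an actual basis.\<close>

lemma vdim_basis:
  fixes V :: "('k::field, 'v) module"
  assumes "vectorspace class_ring V"
  obtains B where "vectorspace.basis class_ring V B" "vdim V = |B|"
proof -
  interpret V: vectorspace class_ring V by fact
  have "V.lin_indpt {}" by (simp add: V.lin_dep_def)
  then obtain B where "V.basis B" using V.extend_to_basis[of "{}"] by blast
  then have "V.basis (SOME B. V.basis B)" by (rule someI)
  then show thesis using that by (simp add: vdim_def)
qed

section \<open>Linear maps, algebra maps and their images\<close>

text \<open>The target need not be known to be a vector space: below, the laws of the target are
deduced from the existence of such maps. Therefore the preservation of zero, which otherwise
would follow, is made a part of the definition.\<close>

definition linear_maps :: "('k::field, 'a) module \<Rightarrow> ('k, 'b) module \<Rightarrow> ('a \<Rightarrow> 'b) set" where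
  "linear_maps M N = {p \<in> LinearCombinations.module_hom class_ring M N. p \<zero>\<^bsub>M\<^esub> = \<zero>\<^bsub>N\<^esub>}"

definition algebra_maps :: "('k::field, 'a) module \<Rightarrow> ('k, 'b) module \<Rightarrow> ('a \<Rightarrow> 'b) set" where
  "algebra_maps M N = linear_maps M N \<inter> Ring.ring_hom M N"

lemma linear_mapsI:
  assumes "\<And>x. x \<in> carrier M \<Longrightarrow> p x \<in> carrier N"
    and "\<And>x y. x \<in> carrier M \<Longrightarrow> y \<in> carrier M \<Longrightarrow> p (x \<oplus>\<^bsub>M\<^esub> y) = p x \<oplus>\<^bsub>N\<^esub> p y"
    and "\<And>c x. x \<in> carrier M \<Longrightarrow> p (c \<odot>\<^bsub>M\<^esub> x) = c \<odot>\<^bsub>N\<^esub> p x"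
    and "p \<zero>\<^bsub>M\<^esub> = \<zero>\<^bsub>N\<^esub>"
  shows "p \<in> linear_maps M N"
  using assms by (simp add: linear_maps_def LinearCombinations.module_hom_def)

lemma linear_mapsD:
  assumes "p \<in> linear_maps M N"
  shows "\<And>x. x \<in> carrier M \<Longrightarrow> p x \<in> carrier N"
    and "\<And>x y. x \<in> carrier M \<Longrightarrow> y \<in> carrier M \<Longrightarrow> p (x \<oplus>\<^bsub>M\<^esub> y) = p x \<oplus>\<^bsub>N\<^esub> p y"
    and "\<And>c x. x \<in> carrier M \<Longrightarrow> p (c \<odot>\<^bsub>M\<^esub> x) = c \<odot>\<^bsub>N\<^esub> p x"
    and "p \<zero>\<^bsub>M\<^esub> = \<zero>\<^bsub>N\<^esub>"
  using assms by (auto simp: linear_maps_def LinearCombinations.module_hom_def)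

lemma algebra_mapsI:
  assumes "p \<in> linear_maps M N"
    and "\<And>x y. x \<in> carrier M \<Longrightarrow> y \<in> carrier M \<Longrightarrow> p (x \<otimes>\<^bsub>M\<^esub> y) = p x \<otimes>\<^bsub>N\<^esub> p y"
    and "p \<one>\<^bsub>M\<^esub> = \<one>\<^bsub>N\<^esub>"
  shows "p \<in> algebra_maps M N"
  using assms linear_mapsD[OF assms(1)] by (auto simp: algebra_maps_def intro!: ring_hom_memI)

lemma algebra_mapsD:
  assumes "p \<in> algebra_maps M N"
  shows "p \<in> linear_maps M N"
    and "\<And>x y. x \<in> carrier M \<Longrightarrow> y \<in> carrier M \<Longrightarrow> p (x \<otimes>\<^bsub>M\<^esub> y) = p x \<otimes>\<^bsub>N\<^esub> p y"
    and "p \<one>\<^bsub>M\<^esub> = \<one>\<^bsub>N\<^esub>"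
  using assms by (auto simp: algebra_maps_def Ring.ring_hom_def)

lemma algebra_maps_comp:
  assumes "p \<in> algebra_maps L M" "q \<in> algebra_maps M N" "unital_algebra L"
  shows "(\<lambda>x. q (p x)) \<in> algebra_maps L N"
proof -
  note p = algebra_mapsD[OF assms(1)] linear_mapsD[OF algebra_mapsD(1)[OF assms(1)]]
  note q = algebra_mapsD[OF assms(2)] linear_mapsD[OF algebra_mapsD(1)[OF assms(2)]]
  show ?thesis
    by (intro algebra_mapsI linear_mapsI) (simp_all add: p q)
qed

lemma vectorspaceI:
  fixes V :: "('k::field, 'v) module"
  assumes "\<zero>\<^bsub>V\<^esub> \<in> carrier V"
    and "\<And>v w. v \<in> carrier V \<Longrightarrow> w \<in> carrier V \<Longrightarrow> v \<oplus>\<^bsub>V\<^esub> w \<in> carrier V"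
    and "\<And>c v. v \<in> carrier V \<Longrightarrow> c \<odot>\<^bsub>V\<^esub> v \<in> carrier V"
    and "\<And>v w. v \<in> carrier V \<Longrightarrow> w \<in> carrier V \<Longrightarrow> v \<oplus>\<^bsub>V\<^esub> w = w \<oplus>\<^bsub>V\<^esub> v"
    and "\<And>u v w. u \<in> carrier V \<Longrightarrow> v \<in> carrier V \<Longrightarrow> w \<in> carrier V \<Longrightarrow>
           (u \<oplus>\<^bsub>V\<^esub> v) \<oplus>\<^bsub>V\<^esub> w = u \<oplus>\<^bsub>V\<^esub> (v \<oplus>\<^bsub>V\<^esub> w)"
    and "\<And>v. v \<in> carrier V \<Longrightarrow> v \<oplus>\<^bsub>V\<^esub> \<zero>\<^bsub>V\<^esub> = v"
    and "\<And>v. v \<in> carrier V \<Longrightarrow> 0 \<odot>\<^bsub>V\<^esub> v = \<zero>\<^bsub>V\<^esub>"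
    and "\<And>v. v \<in> carrier V \<Longrightarrow> 1 \<odot>\<^bsub>V\<^esub> v = v"
    and "\<And>a b v. v \<in> carrier V \<Longrightarrow> (a * b) \<odot>\<^bsub>V\<^esub> v = a \<odot>\<^bsub>V\<^esub> (b \<odot>\<^bsub>V\<^esub> v)"
    and "\<And>a b v. v \<in> carrier V \<Longrightarrow> (a + b) \<odot>\<^bsub>V\<^esub> v = a \<odot>\<^bsub>V\<^esub> v \<oplus>\<^bsub>V\<^esub> b \<odot>\<^bsub>V\<^esub> v"
    and "\<And>a v w. v \<in> carrier V \<Longrightarrow> w \<in> carrier V \<Longrightarrow>
           a \<odot>\<^bsub>V\<^esub> (v \<oplus>\<^bsub>V\<^esub> w) = a \<odot>\<^bsub>V\<^esub> v \<oplus>\<^bsub>V\<^esub> a \<odot>\<^bsub>V\<^esub> w"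
  shows "vectorspace class_ring V"
proof (rule vs_criteria)
  show "field (class_ring :: 'k ring)" by (rule class_field)
  have "v \<oplus>\<^bsub>V\<^esub> (-1) \<odot>\<^bsub>V\<^esub> v = \<zero>\<^bsub>V\<^esub>" if "v \<in> carrier V" for v
    using assms(10)[OF that, of 1 "-1"] assms(7,8)[OF that] by simp
  then show "\<forall>v\<in>carrier V. \<exists>w\<in>carrier V. v \<oplus>\<^bsub>V\<^esub> w = \<zero>\<^bsub>V\<^esub>"
    using assms(3) by blast
qed (use assms in auto)

lemma unital_algebraI:
  fixes A :: "('k::field, 'a) module" (structure)
  assumes "vectorspace class_ring A"
    and "\<one> \<in> carrier A"
    and "\<And>x y. x \<in> carrier A \<Longrightarrow> y \<in> carrier A \<Longrightarrow> x \<otimes> y \<in> carrier A"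
    and "\<And>x y z. x \<in> carrier A \<Longrightarrow> y \<in> carrier A \<Longrightarrow> z \<in> carrier A \<Longrightarrow>
           (x \<otimes> y) \<otimes> z = x \<otimes> (y \<otimes> z)"
    and "\<And>x. x \<in> carrier A \<Longrightarrow> \<one> \<otimes> x = x"
    and "\<And>x. x \<in> carrier A \<Longrightarrow> x \<otimes> \<one> = x"
    and "\<And>x y z. x \<in> carrier A \<Longrightarrow> y \<in> carrier A \<Longrightarrow> z \<in> carrier A \<Longrightarrow>
           (x \<oplus> y) \<otimes> z = x \<otimes> z \<oplus> y \<otimes> z"
    and "\<And>x y z. x \<in> carrier A \<Longrightarrow> y \<in> carrier A \<Longrightarrow> z \<in> carrier A \<Longrightarrow>
           z \<otimes> (x \<oplus> y) = z \<otimes> x \<oplus> z \<otimes> y"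
    and "\<And>c x y. x \<in> carrier A \<Longrightarrow> y \<in> carrier A \<Longrightarrow> (c \<odot> x) \<otimes> y = c \<odot> (x \<otimes> y)"
    and "\<And>c x y. x \<in> carrier A \<Longrightarrow> y \<in> carrier A \<Longrightarrow> x \<otimes> (c \<odot> y) = c \<odot> (x \<otimes> y)"
  shows "unital_algebra A"
proof -
  interpret vectorspace class_ring A by fact
  have "abelian_group A" ..
  moreover have "monoid A" by (rule monoidI) (use assms in auto)
  ultimately have "ring A" by (rule ringI) (use assms in auto)
  then show ?thesis
    by (intro unital_algebra.intro unital_algebra_axioms.intro assms)
qed

lemma vectorspaceD:
  fixes V :: "('k::field, 'v) module"
  assumes "vectorspace class_ring V"
  shows "\<zero>\<^bsub>V\<^esub> \<in> carrier V"
    and "\<And>v w. v \<in> carrier V \<Longrightarrow> w \<in> carrier V \<Longrightarrow> v \<oplus>\<^bsub>V\<^esub> w \<in> carrier V"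
    and "\<And>c v. v \<in> carrier V \<Longrightarrow> c \<odot>\<^bsub>V\<^esub> v \<in> carrier V"
    and "\<And>v w. v \<in> carrier V \<Longrightarrow> w \<in> carrier V \<Longrightarrow> v \<oplus>\<^bsub>V\<^esub> w = w \<oplus>\<^bsub>V\<^esub> v"
    and "\<And>u v w. u \<in> carrier V \<Longrightarrow> v \<in> carrier V \<Longrightarrow> w \<in> carrier V \<Longrightarrow>
           (u \<oplus>\<^bsub>V\<^esub> v) \<oplus>\<^bsub>V\<^esub> w = u \<oplus>\<^bsub>V\<^esub> (v \<oplus>\<^bsub>V\<^esub> w)"
    and "\<And>v. v \<in> carrier V \<Longrightarrow> v \<oplus>\<^bsub>V\<^esub> \<zero>\<^bsub>V\<^esub> = v"
    and "\<And>v. v \<in> carrier V \<Longrightarrow> 0 \<odot>\<^bsub>V\<^esub> v = \<zero>\<^bsub>V\<^esub>"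
    and "\<And>v. v \<in> carrier V \<Longrightarrow> 1 \<odot>\<^bsub>V\<^esub> v = v"
    and "\<And>a b v. v \<in> carrier V \<Longrightarrow> (a * b) \<odot>\<^bsub>V\<^esub> v = a \<odot>\<^bsub>V\<^esub> (b \<odot>\<^bsub>V\<^esub> v)"
    and "\<And>a b v. v \<in> carrier V \<Longrightarrow> (a + b) \<odot>\<^bsub>V\<^esub> v = a \<odot>\<^bsub>V\<^esub> v \<oplus>\<^bsub>V\<^esub> b \<odot>\<^bsub>V\<^esub> v"
    and "\<And>a v w. v \<in> carrier V \<Longrightarrow> w \<in> carrier V \<Longrightarrow>
           a \<odot>\<^bsub>V\<^esub> (v \<oplus>\<^bsub>V\<^esub> w) = a \<odot>\<^bsub>V\<^esub> v \<oplus>\<^bsub>V\<^esub> a \<odot>\<^bsub>V\<^esub> w"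
proof -
  interpret vectorspace class_ring V by fact
  show "\<And>u v w. u \<in> carrier V \<Longrightarrow> v \<in> carrier V \<Longrightarrow> w \<in> carrier V \<Longrightarrow>
           (u \<oplus>\<^bsub>V\<^esub> v) \<oplus>\<^bsub>V\<^esub> w = u \<oplus>\<^bsub>V\<^esub> (v \<oplus>\<^bsub>V\<^esub> w)" by (rule M.a_assoc)
  show "\<And>v w. v \<in> carrier V \<Longrightarrow> w \<in> carrier V \<Longrightarrow> v \<oplus>\<^bsub>V\<^esub> w = w \<oplus>\<^bsub>V\<^esub> v"
    by (rule M.a_comm)
  show "\<And>v. v \<in> carrier V \<Longrightarrow> 1 \<odot>\<^bsub>V\<^esub> v = v" using smult_one by simp
  show "\<And>v. v \<in> carrier V \<Longrightarrow> 0 \<odot>\<^bsub>V\<^esub> v = \<zero>\<^bsub>V\<^esub>" using lmult_0 by simp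
  show "\<And>a b v. v \<in> carrier V \<Longrightarrow> (a * b) \<odot>\<^bsub>V\<^esub> v = a \<odot>\<^bsub>V\<^esub> (b \<odot>\<^bsub>V\<^esub> v)"
    using smult_assoc1 by simp
  show "\<And>a b v. v \<in> carrier V \<Longrightarrow> (a + b) \<odot>\<^bsub>V\<^esub> v = a \<odot>\<^bsub>V\<^esub> v \<oplus>\<^bsub>V\<^esub> b \<odot>\<^bsub>V\<^esub> v"
    using smult_l_distr by simp
  show "\<And>a v w. v \<in> carrier V \<Longrightarrow> w \<in> carrier V \<Longrightarrow>
           a \<odot>\<^bsub>V\<^esub> (v \<oplus>\<^bsub>V\<^esub> w) = a \<odot>\<^bsub>V\<^esub> v \<oplus>\<^bsub>V\<^esub> a \<odot>\<^bsub>V\<^esub> w"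
    using smult_r_distr by simp
  show "\<And>c v. v \<in> carrier V \<Longrightarrow> c \<odot>\<^bsub>V\<^esub> v \<in> carrier V" using smult_closed by simp
  have V: "abelian_monoid V" ..
  show "\<zero>\<^bsub>V\<^esub> \<in> carrier V" by (rule abelian_monoid.zero_closed[OF V])
  show "\<And>v w. v \<in> carrier V \<Longrightarrow> w \<in> carrier V \<Longrightarrow> v \<oplus>\<^bsub>V\<^esub> w \<in> carrier V"
    by (rule abelian_monoid.a_closed[OF V])
  show "\<And>v. v \<in> carrier V \<Longrightarrow> v \<oplus>\<^bsub>V\<^esub> \<zero>\<^bsub>V\<^esub> = v"
    by (rule abelian_monoid.r_zero[OF V])
qed

text \<open>Every law involves at most three elements, so it suffices that any three elements come from
a common vector space. This covers quotients, which are the image of one space, and direct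
limits, where any three elements come from a common stage.\<close>

lemma vectorspace_locally_image:
  fixes V :: "('k::field, 'v) module"
  assumes "\<zero>\<^bsub>V\<^esub> \<in> carrier V"
    and local: "\<And>x y z. x \<in> carrier V \<Longrightarrow> y \<in> carrier V \<Longrightarrow> z \<in> carrier V \<Longrightarrow>
      \<exists>(M :: ('k, 'm) module) p. vectorspace class_ring M \<and> p \<in> linear_maps M V \<and>
        {x, y, z} \<subseteq> p ` carrier M"
  shows "vectorspace class_ring V"
proof -
  have closed: "x \<oplus>\<^bsub>V\<^esub> y \<in> carrier V" "c \<odot>\<^bsub>V\<^esub> x \<in> carrier V"
    "x \<oplus>\<^bsub>V\<^esub> y = y \<oplus>\<^bsub>V\<^esub> x" "(x \<oplus>\<^bsub>V\<^esub> y) \<oplus>\<^bsub>V\<^esub> z = x \<oplus>\<^bsub>V\<^esub> (y \<oplus>\<^bsub>V\<^esub> z)"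
    "x \<oplus>\<^bsub>V\<^esub> \<zero>\<^bsub>V\<^esub> = x" "0 \<odot>\<^bsub>V\<^esub> x = \<zero>\<^bsub>V\<^esub>" "1 \<odot>\<^bsub>V\<^esub> x = x"
    "(c * d) \<odot>\<^bsub>V\<^esub> x = c \<odot>\<^bsub>V\<^esub> (d \<odot>\<^bsub>V\<^esub> x)"
    "(c + d) \<odot>\<^bsub>V\<^esub> x = c \<odot>\<^bsub>V\<^esub> x \<oplus>\<^bsub>V\<^esub> d \<odot>\<^bsub>V\<^esub> x"
    "c \<odot>\<^bsub>V\<^esub> (x \<oplus>\<^bsub>V\<^esub> y) = c \<odot>\<^bsub>V\<^esub> x \<oplus>\<^bsub>V\<^esub> c \<odot>\<^bsub>V\<^esub> y"
    if xyz: "x \<in> carrier V" "y \<in> carrier V" "z \<in> carrier V" for x y z c d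
  proof -
    obtain M :: "('k, 'm) module" and p where M: "vectorspace class_ring M"
      and p: "p \<in> linear_maps M V" and "{x, y, z} \<subseteq> p ` carrier M"
      using local[OF xyz] by blast
    then obtain a b e where abc: "a \<in> carrier M" "b \<in> carrier M" "e \<in> carrier M"
      and eq: "x = p a" "y = p b" "z = p e"
      by auto
    note comm = vectorspaceD(4)[OF M abc(1,2)] and M = vectorspaceD(1-3,5-)[OF M]
      and p1 = linear_mapsD(1)[OF p]
      and p = linear_mapsD(2-4)[OF p, symmetric]
    show "x \<oplus>\<^bsub>V\<^esub> y = y \<oplus>\<^bsub>V\<^esub> x"
      by (simp add: eq p abc comm)
    show "x \<oplus>\<^bsub>V\<^esub> y \<in> carrier V" "c \<odot>\<^bsub>V\<^esub> x \<in> carrier V"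
      "(x \<oplus>\<^bsub>V\<^esub> y) \<oplus>\<^bsub>V\<^esub> z = x \<oplus>\<^bsub>V\<^esub> (y \<oplus>\<^bsub>V\<^esub> z)"
      "x \<oplus>\<^bsub>V\<^esub> \<zero>\<^bsub>V\<^esub> = x" "0 \<odot>\<^bsub>V\<^esub> x = \<zero>\<^bsub>V\<^esub>" "1 \<odot>\<^bsub>V\<^esub> x = x"
      "(c * d) \<odot>\<^bsub>V\<^esub> x = c \<odot>\<^bsub>V\<^esub> (d \<odot>\<^bsub>V\<^esub> x)"
      "(c + d) \<odot>\<^bsub>V\<^esub> x = c \<odot>\<^bsub>V\<^esub> x \<oplus>\<^bsub>V\<^esub> d \<odot>\<^bsub>V\<^esub> x"
      "c \<odot>\<^bsub>V\<^esub> (x \<oplus>\<^bsub>V\<^esub> y) = c \<odot>\<^bsub>V\<^esub> x \<oplus>\<^bsub>V\<^esub> c \<odot>\<^bsub>V\<^esub> y"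
      by (simp_all only: eq p p1 M abc)
  qed
  show ?thesis
    by (rule vectorspaceI) (rule assms(1) | (rule closed; assumption))+
qed

lemma unital_algebra_locally_image:
  fixes A :: "('k::field, 'a) module" (structure)
  assumes "\<zero> \<in> carrier A" "\<one> \<in> carrier A"
    and local: "\<And>x y z. x \<in> carrier A \<Longrightarrow> y \<in> carrier A \<Longrightarrow> z \<in> carrier A \<Longrightarrow>
      \<exists>(M :: ('k, 'm) module) p. unital_algebra M \<and> p \<in> algebra_maps M A \<and>
        {x, y, z} \<subseteq> p ` carrier M"
  shows "unital_algebra A"
proof -
  have laws: "x \<otimes> y \<in> carrier A" "(x \<otimes> y) \<otimes> z = x \<otimes> (y \<otimes> z)" "\<one> \<otimes> x = x" "x \<otimes> \<one> = x"
    "(x \<oplus> y) \<otimes> z = x \<otimes> z \<oplus> y \<otimes> z" "z \<otimes> (x \<oplus> y) = z \<otimes> x \<oplus> z \<otimes> y"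
    "(c \<odot> x) \<otimes> y = c \<odot> (x \<otimes> y)" "x \<otimes> (c \<odot> y) = c \<odot> (x \<otimes> y)"
    if xyz: "x \<in> carrier A" "y \<in> carrier A" "z \<in> carrier A" for x y z c
  proof -
    obtain M :: "('k, 'm) module" and p where M: "unital_algebra M"
      and p: "p \<in> algebra_maps M A" and "{x, y, z} \<subseteq> p ` carrier M"
      using local[OF xyz] by blast
    then obtain a b e where abc: "a \<in> carrier M" "b \<in> carrier M" "e \<in> carrier M"
      and eq: "x = p a" "y = p b" "z = p e"
      by auto
    interpret M: unital_algebra M by fact
    have M_smult: "c \<odot>\<^bsub>M\<^esub> v \<in> carrier M" if "v \<in> carrier M" for c v
      using that by simp
    note p1 = linear_mapsD(1)[OF algebra_mapsD(1)[OF p]]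
      and p = algebra_mapsD(2,3)[OF p, symmetric]
        linear_mapsD(2-4)[OF algebra_mapsD(1)[OF p], symmetric]
    show "x \<otimes> y \<in> carrier A" "(x \<otimes> y) \<otimes> z = x \<otimes> (y \<otimes> z)" "\<one> \<otimes> x = x" "x \<otimes> \<one> = x"
      "(x \<oplus> y) \<otimes> z = x \<otimes> z \<oplus> y \<otimes> z" "z \<otimes> (x \<oplus> y) = z \<otimes> x \<oplus> z \<otimes> y"
      "(c \<odot> x) \<otimes> y = c \<odot> (x \<otimes> y)" "x \<otimes> (c \<odot> y) = c \<odot> (x \<otimes> y)"
      using abc by (simp_all add: eq p p1 M.alg.m_assoc M.alg.l_distr M.alg.r_distr
          M.smult_mult_left M.smult_mult_right M_smult)
  qed
  have "vectorspace class_ring A"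
  proof (rule vectorspace_locally_image)
    fix x y z assume "x \<in> carrier A" "y \<in> carrier A" "z \<in> carrier A"
    then show "\<exists>(M :: ('k, 'm) module) p. vectorspace class_ring M \<and> p \<in> linear_maps M A \<and>
        {x, y, z} \<subseteq> p ` carrier M"
      using local algebra_mapsD(1) unital_algebra.axioms(1) by metis
  qed fact
  then show ?thesis
    by (rule unital_algebraI) (rule assms(2) | (rule laws; assumption))+
qed

lemma unital_algebraD:
  fixes A :: "('k::field, 'a) module" (structure)
  assumes "unital_algebra A"
  shows "\<zero> \<in> carrier A" "\<one> \<in> carrier A"
    and "\<And>x y. x \<in> carrier A \<Longrightarrow> y \<in> carrier A \<Longrightarrow> x \<oplus> y \<in> carrier A"
    and "\<And>x y. x \<in> carrier A \<Longrightarrow> y \<in> carrier A \<Longrightarrow> x \<otimes> y \<in> carrier A"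
    and "\<And>c x. x \<in> carrier A \<Longrightarrow> c \<odot> x \<in> carrier A"
    and "\<And>x. x \<in> carrier A \<Longrightarrow> \<one> \<otimes> x = x" "\<And>x. x \<in> carrier A \<Longrightarrow> x \<otimes> \<one> = x"
proof -
  interpret unital_algebra A by fact
  show "\<And>c x. x \<in> carrier A \<Longrightarrow> c \<odot> x \<in> carrier A" by simp
qed (insert assms, auto dest!: unital_algebra.axioms(2) intro: ring.ring_simprules monoid.l_one
  monoid.r_one ring.is_monoid)

section \<open>Quotients\<close>

lemma UN_eq_const:
  assumes "X \<noteq> {}" "\<And>x. x \<in> X \<Longrightarrow> f x = c"
  shows "(\<Union>x\<in>X. f x) = c"
  using assms by auto

definition subspace_of :: "('k::field, 'v) module \<Rightarrow> 'v set \<Rightarrow> bool" where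
  "subspace_of V N \<longleftrightarrow> N \<subseteq> carrier V \<and> \<zero>\<^bsub>V\<^esub> \<in> N \<and>
     (\<forall>x\<in>N. \<forall>y\<in>N. x \<oplus>\<^bsub>V\<^esub> y \<in> N) \<and> (\<forall>c. \<forall>x\<in>N. c \<odot>\<^bsub>V\<^esub> x \<in> N)"

locale quotient_space = vectorspace class_ring V for V :: "('k::field, 'v) module" +
  fixes N :: "'v set"
  assumes N: "subspace_of V N"
begin

lemma abelian: "abelian_group V" "abelian_monoid V" ..

text \<open>Closure under scalars thus includes closure under negation, so \<open>N\<close> is a subgroup.\<close>

lemma minus_eq_smult: "x \<in> carrier V \<Longrightarrow> \<ominus>\<^bsub>V\<^esub> x = (-1) \<odot>\<^bsub>V\<^esub> x"
  using smult_minus_1[of x] by (simp add: class_ring_simps)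

lemma abelian_subgroup: "abelian_subgroup N V"
proof (rule abelian_subgroupI3)
  show "additive_subgroup N V"
  proof (rule additive_subgroupI, rule group.subgroupI)
    show "Group.group (add_monoid V)" by (rule a_group)
    fix a assume "a \<in> N"
    then show "inv\<^bsub>add_monoid V\<^esub> a \<in> N"
      using N minus_eq_smult[of a] by (auto simp: subspace_of_def a_inv_def)
  qed (use N in \<open>auto simp: subspace_of_def\<close>)
qed unfold_locales

sublocale N: abelian_subgroup N V by (rule abelian_subgroup)

lemma coset_eq_iff:
  assumes "x \<in> carrier V" "y \<in> carrier V"
  shows "N +>\<^bsub>V\<^esub> x = N +>\<^bsub>V\<^esub> y \<longleftrightarrow> x \<ominus>\<^bsub>V\<^esub> y \<in> N"
proof -
  have "x \<ominus>\<^bsub>V\<^esub> y \<in> N \<longleftrightarrow> x \<in> N +>\<^bsub>V\<^esub> y"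
    using N.a_rcos_module[OF assms(2,1)] by (simp add: a_minus_def)
  moreover have "x \<in> N +>\<^bsub>V\<^esub> y \<longleftrightarrow> N +>\<^bsub>V\<^esub> x = N +>\<^bsub>V\<^esub> y"
    using N.a_repr_independence'[OF _ assms(2)] N.a_rcos_self[OF assms(1)] by metis
  ultimately show ?thesis by simp
qed

lemma coset_zero: "N +>\<^bsub>V\<^esub> \<zero>\<^bsub>V\<^esub> = N"
  using abelian_group.a_coset_add_zero[OF abelian(1)] N by (simp add: subspace_of_def)

lemma coset_eq_N_iff:
  assumes "x \<in> carrier V"
  shows "N +>\<^bsub>V\<^esub> x = N \<longleftrightarrow> x \<in> N"
  using coset_eq_iff[OF assms, of "\<zero>\<^bsub>V\<^esub>"] assms by (simp add: coset_zero a_minus_def minus_eq_smult)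

abbreviation "Q \<equiv> quotient_module V N"

lemma carrier_quotient: "carrier Q = (\<lambda>x. N +>\<^bsub>V\<^esub> x) ` carrier V"
  by (auto simp: quotient_module_def A_RCOSETS_def')

text \<open>Two representatives \<open>x\<close>, \<open>y\<close> differ by an element of \<open>N\<close>, and so do \<open>c x\<close> and \<open>c y\<close>; hence
all members of the union that defines the scalar multiplication agree.\<close>

lemma smult_coset:
  assumes "x \<in> carrier V"
  shows "c \<odot>\<^bsub>Q\<^esub> (N +>\<^bsub>V\<^esub> x) = N +>\<^bsub>V\<^esub> (c \<odot>\<^bsub>V\<^esub> x)"
  unfolding quotient_module_def module.simps
proof (rule UN_eq_const)
  show "N +>\<^bsub>V\<^esub> x \<noteq> {}" using N.a_rcos_self[OF assms] by blast
  fix y assume y: "y \<in> N +>\<^bsub>V\<^esub> x"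
  then have yV: "y \<in> carrier V" using abelian_monoid.a_r_coset_subset_G[OF abelian(2) N.a_subset
    assms] by blast
  have "y \<ominus>\<^bsub>V\<^esub> x \<in> N" using y N.a_rcos_module[OF assms yV] by (simp add: a_minus_def)
  then have "c \<odot>\<^bsub>V\<^esub> (y \<ominus>\<^bsub>V\<^esub> x) \<in> N" using N by (simp add: subspace_of_def)
  then have "c \<odot>\<^bsub>V\<^esub> y \<ominus>\<^bsub>V\<^esub> c \<odot>\<^bsub>V\<^esub> x \<in> N"
    using yV assms by (simp add: a_minus_def smult_r_distr smult_r_minus)
  then show "N +>\<^bsub>V\<^esub> (c \<odot>\<^bsub>V\<^esub> y) = N +>\<^bsub>V\<^esub> (c \<odot>\<^bsub>V\<^esub> x)"
    using yV assms by (simp add: coset_eq_iff)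
qed

lemma coset_linear: "(\<lambda>x. N +>\<^bsub>V\<^esub> x) \<in> linear_maps V Q"
proof (rule linear_mapsI)
  show "N +>\<^bsub>V\<^esub> \<zero>\<^bsub>V\<^esub> = \<zero>\<^bsub>Q\<^esub>"
    by (simp only: coset_zero) (simp add: quotient_module_def)
  show "N +>\<^bsub>V\<^esub> (x \<oplus>\<^bsub>V\<^esub> y) = (N +>\<^bsub>V\<^esub> x) \<oplus>\<^bsub>Q\<^esub> (N +>\<^bsub>V\<^esub> y)"
    if "x \<in> carrier V" "y \<in> carrier V" for x y
    using N.a_rcos_sum[OF that] by (simp add: quotient_module_def)
qed (simp_all add: smult_coset carrier_quotient)

lemma quotient_vectorspace: "vectorspace class_ring Q"
proof (rule vectorspace_locally_image)
  show "\<zero>\<^bsub>Q\<^esub> \<in> carrier Q"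
    using linear_mapsD(1,4)[OF coset_linear] by (metis M.zero_closed)
  fix x y z assume "x \<in> carrier Q" "y \<in> carrier Q" "z \<in> carrier Q"
  then have "{x, y, z} \<subseteq> (\<lambda>x. N +>\<^bsub>V\<^esub> x) ` carrier V"
    by (simp add: carrier_quotient)
  then show "\<exists>(M :: ('k, 'v) module) p. vectorspace class_ring M \<and> p \<in> linear_maps M Q \<and>
      {x, y, z} \<subseteq> p ` carrier M"
    using coset_linear vectorspace_axioms by blast
qed

end

locale quotient_algebra = unital_algebra A for A :: "('k::field, 'a) module" (structure) +
  fixes N :: "'a set"
  assumes N: "subspace_of A N"
    and left_ideal: "x \<in> carrier A \<Longrightarrow> n \<in> N \<Longrightarrow> x \<otimes> n \<in> N"
    and right_ideal: "x \<in> carrier A \<Longrightarrow> n \<in> N \<Longrightarrow> n \<otimes> x \<in> N"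
begin

sublocale quotient_space A N by unfold_locales (rule N)

lemma coset_algebra_map: "(\<lambda>x. N +> x) \<in> algebra_maps A Q"
proof (rule algebra_mapsI[OF coset_linear])
  have "ideal N A"
    by (rule idealI) (simp_all add: left_ideal right_ideal alg.ring_axioms N.a_subgroup)
  then show "N +> (x \<otimes> y) = (N +> x) \<otimes>\<^bsub>Q\<^esub> (N +> y)"
    if "x \<in> carrier A" "y \<in> carrier A" for x y
    using ideal.rcoset_mult_add that by (fastforce simp: quotient_module_def)
qed (simp add: quotient_module_def)

lemma quotient_unital_algebra: "unital_algebra Q"
proof (rule unital_algebra_locally_image)
  show "\<zero>\<^bsub>Q\<^esub> \<in> carrier Q"
    by (rule vectorspaceD(1)[OF quotient_vectorspace])
  show "\<one>\<^bsub>Q\<^esub> \<in> carrier Q"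
    using linear_mapsD(1)[OF coset_linear] algebra_mapsD(3)[OF coset_algebra_map]
    by (metis alg.one_closed)
  fix x y z assume "x \<in> carrier Q" "y \<in> carrier Q" "z \<in> carrier Q"
  then have "{x, y, z} \<subseteq> (\<lambda>x. N +> x) ` carrier A"
    by (simp add: carrier_quotient)
  then show "\<exists>(M :: ('k, 'a) module) p. unital_algebra M \<and> p \<in> algebra_maps M Q \<and>
      {x, y, z} \<subseteq> p ` carrier M"
    using coset_algebra_map unital_algebra_axioms by blast
qed

end

section \<open>Direct limits\<close>

text \<open>Elements at different stages are identified when their images at some later stage agree, so
compatibility of the transition maps with composition already puts \<open>x\<close> and \<open>\<phi> j j x\<close> into the
same class.\<close>

locale directed_algebras =
  fixes P :: "'j set" and leq :: "'j \<Rightarrow> 'j \<Rightarrow> bool"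
    and B :: "'j \<Rightarrow> ('k::field, 'x) module" and \<phi> :: "'j \<Rightarrow> 'j \<Rightarrow> 'x \<Rightarrow> 'x"
  assumes nonempty: "P \<noteq> {}"
    and leq_refl: "j \<in> P \<Longrightarrow> leq j j"
    and leq_trans: "j \<in> P \<Longrightarrow> k \<in> P \<Longrightarrow> l \<in> P \<Longrightarrow> leq j k \<Longrightarrow> leq k l \<Longrightarrow> leq j l"
    and directed: "j \<in> P \<Longrightarrow> k \<in> P \<Longrightarrow> \<exists>l\<in>P. leq j l \<and> leq k l"
    and algebra: "j \<in> P \<Longrightarrow> unital_algebra (B j)"
    and map: "j \<in> P \<Longrightarrow> k \<in> P \<Longrightarrow> leq j k \<Longrightarrow> \<phi> j k \<in> algebra_maps (B j) (B k)"
    and map_comp: "j \<in> P \<Longrightarrow> k \<in> P \<Longrightarrow> l \<in> P \<Longrightarrow> leq j k \<Longrightarrow> leq k l \<Longrightarrow> x \<in> carrier (B j) \<Longrightarrow>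
      \<phi> k l (\<phi> j k x) = \<phi> j l x"
begin

abbreviation "R \<equiv> limit_rel P leq B \<phi>"
abbreviation "L \<equiv> direct_limit P leq B \<phi>"

definition cls :: "'j \<Rightarrow> 'x \<Rightarrow> ('j \<times> 'x) set" where
  "cls j x = R `` {(j, x)}"

lemma map_closed: "j \<in> P \<Longrightarrow> k \<in> P \<Longrightarrow> leq j k \<Longrightarrow> x \<in> carrier (B j) \<Longrightarrow> \<phi> j k x \<in> carrier (B k)"
  using linear_mapsD(1)[OF algebra_mapsD(1)[OF map]] by blast

lemma equiv_R: "equiv (Sigma P (\<lambda>j. carrier (B j))) R"
proof (rule equivI)
  show "refl_on (Sigma P (\<lambda>j. carrier (B j))) R"
    using leq_refl by (auto simp: refl_on_def limit_rel_def)
  show "R \<subseteq> Sigma P (\<lambda>j. carrier (B j)) \<times> Sigma P (\<lambda>j. carrier (B j))"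
    by (auto simp: limit_rel_def)
  show "sym R"
    unfolding sym_def limit_rel_def by (auto; metis)
  show "trans R"
  proof (rule transI, clarify)
    fix j x k y l z
    assume "((j, x), (k, y)) \<in> R" "((k, y), (l, z)) \<in> R"
    then obtain m n where in_P: "j \<in> P" "k \<in> P" "l \<in> P" "m \<in> P" "n \<in> P"
      and el: "x \<in> carrier (B j)" "y \<in> carrier (B k)" "z \<in> carrier (B l)"
      and m: "leq j m" "leq k m" "\<phi> j m x = \<phi> k m y"
      and n: "leq k n" "leq l n" "\<phi> k n y = \<phi> l n z"
      by (auto simp: limit_rel_def)
    obtain r where r: "r \<in> P" "leq m r" "leq n r"
      using directed in_P by blast
    have "\<phi> j r x = \<phi> m r (\<phi> j m x)"
      using map_comp in_P el m r by metis
    also have "\<dots> = \<phi> k r y"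
      using map_comp in_P el m r by metis
    also have "\<dots> = \<phi> n r (\<phi> k n y)"
      using map_comp in_P el n r by metis
    also have "\<dots> = \<phi> l r z"
      using map_comp in_P el n r by metis
    finally show "((j, x), (l, z)) \<in> R"
      using in_P el r m n leq_trans unfolding limit_rel_def by blast
  qed
qed

lemma class_eq_iff:
  assumes "j \<in> P" "k \<in> P" "x \<in> carrier (B j)" "y \<in> carrier (B k)"
  shows "cls j x = cls k y \<longleftrightarrow> (\<exists>l\<in>P. leq j l \<and> leq k l \<and> \<phi> j l x = \<phi> k l y)"
  unfolding cls_def using assms
  by (subst eq_equiv_class_iff[OF equiv_R]) (auto simp: limit_rel_def)

lemma class_map:
  assumes "j \<in> P" "k \<in> P" "leq j k" "x \<in> carrier (B j)"
  shows "cls k (\<phi> j k x) = cls j x"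
proof -
  have "\<phi> k k (\<phi> j k x) = \<phi> j k x" "\<phi> j k x \<in> carrier (B k)"
    using assms by (simp_all add: map_comp leq_refl map_closed)
  then show ?thesis
    using assms leq_refl by (subst class_eq_iff) auto
qed

lemma in_cls:
  assumes "j \<in> P" "x \<in> carrier (B j)"
  shows "(k, y) \<in> cls j x \<longleftrightarrow> k \<in> P \<and> y \<in> carrier (B k) \<and> cls k y = cls j x"
proof -
  have "(k, y) \<in> cls j x \<longleftrightarrow> ((k, y), (j, x)) \<in> R"
    using equiv_R by (auto simp: cls_def equiv_def sym_def)
  also have "\<dots> \<longleftrightarrow> k \<in> P \<and> y \<in> carrier (B k) \<and> cls k y = cls j x"
    using assms eq_equiv_class_iff[OF equiv_R, of "(k, y)" "(j, x)"]
    unfolding cls_def by (auto simp: limit_rel_def)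
  finally show ?thesis .
qed

lemma carrier_limit: "carrier L = {cls j x | j x. j \<in> P \<and> x \<in> carrier (B j)}"
  by (auto simp: direct_limit_def cls_def quotient_def)

text \<open>Addition and multiplication are treated alike: any operation that the transition maps
preserve is well defined on classes, since representatives that agree at a later stage have
results that agree at a later stage.\<close>

lemma class_operation:
  assumes op_closed: "\<And>j x y. j \<in> P \<Longrightarrow> x \<in> carrier (B j) \<Longrightarrow> y \<in> carrier (B j) \<Longrightarrow> f j x y \<in> carrier (B j)"
    and op_map: "\<And>j k x y. j \<in> P \<Longrightarrow> k \<in> P \<Longrightarrow> leq j k \<Longrightarrow> x \<in> carrier (B j) \<Longrightarrow> y \<in> carrier (B j) \<Longrightarrow>
      \<phi> j k (f j x y) = f k (\<phi> j k x) (\<phi> j k y)"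
    and i: "i \<in> P" "x \<in> carrier (B i)" "y \<in> carrier (B i)"
  shows "(\<Union>(j, x)\<in>cls i x. \<Union>(k, y)\<in>cls i y. \<Union>l\<in>{l \<in> P. leq j l \<and> leq k l}.
    cls l (f l (\<phi> j l x) (\<phi> k l y))) = cls i (f i x y)"
proof -
  have eq: "cls l (f l (\<phi> j l x') (\<phi> k l y')) = cls i (f i x y)"
    if jk: "j \<in> P" "k \<in> P" "x' \<in> carrier (B j)" "y' \<in> carrier (B k)"
      and cl: "cls j x' = cls i x" "cls k y' = cls i y"
      and l: "l \<in> P" "leq j l" "leq k l" for j k l x' y'
  proof -
    obtain a where a: "a \<in> P" "leq j a" "leq i a" "\<phi> j a x' = \<phi> i a x"
      using cl(1) jk i by (auto simp: class_eq_iff)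
    obtain b where b: "b \<in> P" "leq k b" "leq i b" "\<phi> k b y' = \<phi> i b y"
      using cl(2) jk i by (auto simp: class_eq_iff)
    obtain c where c: "c \<in> P" "leq a c" "leq b c"
      using directed a(1) b(1) by blast
    obtain m where m: "m \<in> P" "leq c m" "leq l m"
      using directed c(1) l(1) by blast
    have am: "leq a m" "leq b m" "leq i m"
      using leq_trans a b c m i by blast+
    have "\<phi> l m (f l (\<phi> j l x') (\<phi> k l y')) = f m (\<phi> j m x') (\<phi> k m y')"
      using jk l m by (simp add: op_map map_closed map_comp)
    also have "\<phi> j m x' = \<phi> i m x"
      using map_comp[of j a m x'] map_comp[of i a m x] jk i a m am by simp
    also have "\<phi> k m y' = \<phi> i m y"
      using map_comp[of k b m y'] map_comp[of i b m y] jk i b m am by simp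
    also have "f m (\<phi> i m x) (\<phi> i m y) = \<phi> i m (f i x y)"
      using op_map i m am by simp
    finally have "\<phi> l m (f l (\<phi> j l x') (\<phi> k l y')) = \<phi> i m (f i x y)" .
    then show ?thesis
      using m am i l jk by (subst class_eq_iff) (auto intro!: op_closed map_closed)
  qed
  have self: "(i, x) \<in> cls i x" "(i, y) \<in> cls i y"
    using i by (auto simp: in_cls)
  show ?thesis
  proof (intro UN_eq_const, use self in blast, clarify, intro UN_eq_const, use self in blast,
      clarify, intro UN_eq_const)
    fix j x' k y' assume "(j, x') \<in> cls i x" "(k, y') \<in> cls i y"
    then have jk: "j \<in> P" "k \<in> P" "x' \<in> carrier (B j)" "y' \<in> carrier (B k)"
      "cls j x' = cls i x" "cls k y' = cls i y"
      using i by (auto simp: in_cls)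
    show "{l \<in> P. leq j l \<and> leq k l} \<noteq> {}"
      using directed jk(1,2) by blast
    show "cls l (f l (\<phi> j l x') (\<phi> k l y')) = cls i (f i x y)" if "l \<in> {l \<in> P. leq j l \<and> leq k l}" for l
      using eq[OF jk] that by blast
  qed
qed

lemma class_algebra_map:
  assumes i: "i \<in> P"
  shows "cls i \<in> algebra_maps (B i) L"
proof -
  interpret unital_algebra "B i" by (rule algebra[OF i])
  note maps = algebra_mapsD[OF map] linear_mapsD[OF algebra_mapsD(1)[OF map]]
  have const: "(\<Union>j\<in>P. cls j (z j)) = cls i (z i)"
    if "\<And>j. j \<in> P \<Longrightarrow> z j \<in> carrier (B j)" "\<And>j k. j \<in> P \<Longrightarrow> k \<in> P \<Longrightarrow> leq j k \<Longrightarrow> \<phi> j k (z j) = z k" for z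
  proof (rule UN_eq_const[OF nonempty])
    fix j assume j: "j \<in> P"
    obtain l where "l \<in> P" "leq j l" "leq i l"
      using directed i j by blast
    then show "cls j (z j) = cls i (z i)"
      using class_map[of j l "z j"] class_map[of i l "z i"] that i j by simp
  qed
  note closed = unital_algebraD[OF algebra]
  show ?thesis
  proof (intro algebra_mapsI linear_mapsI)
    fix x assume "x \<in> carrier (B i)"
    then show "cls i x \<in> carrier L" using i by (auto simp: carrier_limit)
  next
    fix x y assume xy: "x \<in> carrier (B i)" "y \<in> carrier (B i)"
    show "cls i (x \<oplus>\<^bsub>B i\<^esub> y) = cls i x \<oplus>\<^bsub>L\<^esub> cls i y"
      unfolding direct_limit_def module.simps ring.simps cls_def[symmetric]
      by (rule class_operation[symmetric]) (simp_all add: closed maps i xy)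
    show "cls i (x \<otimes>\<^bsub>B i\<^esub> y) = cls i x \<otimes>\<^bsub>L\<^esub> cls i y"
      unfolding direct_limit_def module.simps ring.simps monoid.simps cls_def[symmetric]
      by (rule class_operation[symmetric]) (simp_all add: closed maps i xy)
  next
    fix c x assume x: "x \<in> carrier (B i)"
    show "cls i (c \<odot>\<^bsub>B i\<^esub> x) = c \<odot>\<^bsub>L\<^esub> cls i x"
      unfolding direct_limit_def module.simps cls_def[symmetric]
    proof (rule UN_eq_const[symmetric], goal_cases nonempty const)
      case nonempty
      have "(i, x) \<in> cls i x" using i x by (simp add: in_cls)
      then show ?case by blast
    next
      case (const p)
      obtain j y where p: "p = (j, y)" by (cases p)
      then have j: "j \<in> P" "y \<in> carrier (B j)" and eq: "cls j y = cls i x"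
        using const i x by (simp_all add: in_cls)
      then obtain l where l: "l \<in> P" "leq j l" "leq i l" "\<phi> j l y = \<phi> i l x"
        using i x by (auto simp: class_eq_iff)
      have "\<phi> j l (c \<odot>\<^bsub>B j\<^esub> y) = \<phi> i l (c \<odot>\<^bsub>B i\<^esub> x)"
        using l j i x by (simp add: maps)
      then have "cls j (c \<odot>\<^bsub>B j\<^esub> y) = cls i (c \<odot>\<^bsub>B i\<^esub> x)"
        using j i x l(1-3) closed by (subst class_eq_iff) auto
      then show ?case by (simp add: p)
    qed
  next
    show "cls i \<zero>\<^bsub>B i\<^esub> = \<zero>\<^bsub>L\<^esub>"
      unfolding direct_limit_def module.simps ring.simps cls_def[symmetric]
      by (rule const[symmetric]) (simp_all add: closed maps)
    show "cls i \<one>\<^bsub>B i\<^esub> = \<one>\<^bsub>L\<^esub>"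
      unfolding direct_limit_def module.simps monoid.simps cls_def[symmetric]
      by (rule const[symmetric]) (simp_all add: closed maps)
  qed
qed

theorem limit_unital_algebra: "unital_algebra L"
proof (rule unital_algebra_locally_image)
  obtain i where i: "i \<in> P" using nonempty by blast
  interpret unital_algebra "B i" by (rule algebra[OF i])
  note mp = class_algebra_map[OF i]
  show "\<zero>\<^bsub>L\<^esub> \<in> carrier L"
    using linear_mapsD(1,4)[OF algebra_mapsD(1)[OF mp]] vectorspaceD(1)[OF vectorspace_axioms] by metis
  show "\<one>\<^bsub>L\<^esub> \<in> carrier L"
    using linear_mapsD(1)[OF algebra_mapsD(1)[OF mp]] algebra_mapsD(3)[OF mp] alg.one_closed by metis
  fix x y z assume "x \<in> carrier L" "y \<in> carrier L" "z \<in> carrier L"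
  then obtain j a k b l c where jkl: "j \<in> P" "k \<in> P" "l \<in> P"
    and abc: "a \<in> carrier (B j)" "b \<in> carrier (B k)" "c \<in> carrier (B l)"
    and eq: "x = cls j a" "y = cls k b" "z = cls l c"
    by (auto simp: carrier_limit)
  obtain m' where m': "m' \<in> P" "leq j m'" "leq k m'" using directed jkl by blast
  obtain m where m: "m \<in> P" "leq m' m" "leq l m" using directed jkl m' by blast
  have le: "leq j m" "leq k m" using leq_trans jkl m m' by blast+
  have "x = cls m (\<phi> j m a)" "y = cls m (\<phi> k m b)" "z = cls m (\<phi> l m c)"
    using jkl m le abc by (simp_all add: eq class_map)
  then have "{x, y, z} \<subseteq> cls m ` carrier (B m)"
    using jkl m le abc map_closed by blast
  then show "\<exists>(M :: ('k, 'x) module) p. unital_algebra M \<and> p \<in> algebra_maps M L \<and>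
      {x, y, z} \<subseteq> p ` carrier M"
    using class_algebra_map[OF m(1)] algebra[OF m(1)] by blast
qed

end

section \<open>Monoid algebras\<close>

text \<open>A finitely supported \<open>u\<close> stands for the formal combination \<open>(\<Sum>x. u x * x)\<close>, and this is the
value at \<open>u\<close> of the linear extension of \<open>g\<close>. All constructions on formal combinations are
governed by simple rules for their pairings; the coefficient at \<open>z\<close> is the pairing with the
indicator function of \<open>z\<close>, so identities such as associativity become identities of iterated
pairings.\<close>

definition pairing :: "('x \<Rightarrow> 'k::field) \<Rightarrow> ('x \<Rightarrow> 'k) \<Rightarrow> 'k" where
  "pairing u g = (\<Sum>x | u x \<noteq> 0. u x * g x)"

abbreviation delta :: "'x \<Rightarrow> 'x \<Rightarrow> 'k::field" where
  "delta x \<equiv> (\<lambda>z. of_bool (z = x))"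

text \<open>The linear extension of \<open>f\<close> to formal combinations.\<close>

definition pushforward :: "('x \<Rightarrow> 'y) \<Rightarrow> ('x \<Rightarrow> 'k::field) \<Rightarrow> 'y \<Rightarrow> 'k" where
  "pushforward f u = (\<lambda>z. \<Sum>x\<in>{x. u x \<noteq> 0 \<and> f x = z}. u x)"

lemma pairing_eq_sum:
  assumes "finite T" "{x. u x \<noteq> 0} \<subseteq> T"
  shows "pairing u g = (\<Sum>x\<in>T. u x * g x)"
  unfolding pairing_def using assms by (intro sum.mono_neutral_left) auto

lemma pairing_cong: "(\<And>x. u x \<noteq> 0 \<Longrightarrow> g x = h x) \<Longrightarrow> pairing u g = pairing u h"
  unfolding pairing_def by (intro sum.cong) auto

lemma pairing_add:
  assumes "finite {x. u x \<noteq> 0}" "finite {x. v x \<noteq> 0}"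
  shows "pairing (\<lambda>z. u z + v z) g = pairing u g + pairing v g"
proof -
  let ?T = "{x. u x \<noteq> 0} \<union> {x. v x \<noteq> 0}"
  have "pairing (\<lambda>z. u z + v z) g = (\<Sum>x\<in>?T. (u x + v x) * g x)"
    by (rule pairing_eq_sum) (use assms in auto)
  also have "\<dots> = (\<Sum>x\<in>?T. u x * g x) + (\<Sum>x\<in>?T. v x * g x)"
    by (simp add: distrib_right sum.distrib)
  also have "(\<Sum>x\<in>?T. u x * g x) = pairing u g"
    by (rule pairing_eq_sum[symmetric]) (use assms in auto)
  also have "(\<Sum>x\<in>?T. v x * g x) = pairing v g"
    by (rule pairing_eq_sum[symmetric]) (use assms in auto)
  finally show ?thesis .
qed

lemma pairing_scale: "pairing (\<lambda>z. c * u z) g = c * pairing u g"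
proof (cases "c = 0")
  case False
  then have "{x. c * u x \<noteq> 0} = {x. u x \<noteq> 0}" by auto
  then show ?thesis by (simp add: pairing_def sum_distrib_left mult.assoc)
qed (simp add: pairing_def)

lemma pairing_add_right: "pairing u (\<lambda>x. g x + h x) = pairing u g + pairing u h"
  by (simp add: pairing_def distrib_left sum.distrib)

lemma pairing_scale_right: "pairing u (\<lambda>x. c * g x) = c * pairing u g"
  by (simp add: pairing_def sum_distrib_left mult_ac)

lemma pairing_delta [simp]: "pairing (delta x) g = g x"
  by (subst pairing_eq_sum[of "{x}"]) auto

lemma pairing_zero [simp]: "pairing (\<lambda>x. 0) g = 0"
  by (simp add: pairing_def)

lemma pairing_of_bool:
  assumes "finite {x. u x \<noteq> 0}"
  shows "pairing u (\<lambda>x. of_bool (z = x)) = u z"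
proof -
  have "pairing u (\<lambda>x. of_bool (z = x)) = (\<Sum>x\<in>insert z {x. u x \<noteq> 0}. u x * of_bool (z = x))"
    by (rule pairing_eq_sum) (use assms in auto)
  also have "\<dots> = (\<Sum>x\<in>insert z {x. u x \<noteq> 0}. if z = x then u x else 0)"
    by (intro sum.cong) auto
  also have "\<dots> = u z" using assms by (subst sum.delta') auto
  finally show ?thesis .
qed

text \<open>Products and push-forwards are both of the form \<open>(\<Sum>p\<in>X. c p * h p)\<close>, a formal combination
in which the points \<open>h p\<close> may coincide. Pairing does not require to collect coinciding points
first.\<close>

lemma
  fixes w :: "'y \<Rightarrow> 'k::field"
  assumes "finite X" and w: "\<And>z. w z = (\<Sum>p\<in>X. c p * of_bool (z = h p))"
  shows finite_combination: "finite {z. w z \<noteq> 0}"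
    and support_combination: "{z. w z \<noteq> 0} \<subseteq> h ` X"
    and pairing_combination: "pairing w g = (\<Sum>p\<in>X. c p * g (h p))"
proof -
  show sub: "{z. w z \<noteq> 0} \<subseteq> h ` X"
  proof
    fix z assume "z \<in> {z. w z \<noteq> 0}"
    then have "(\<Sum>p\<in>X. c p * of_bool (z = h p)) \<noteq> 0" using w by simp
    then obtain p where "p \<in> X" "c p * of_bool (z = h p) \<noteq> 0"
      by (rule sum.not_neutral_contains_not_neutral)
    then show "z \<in> h ` X" by (auto split: if_splits)
  qed
  then show "finite {z. w z \<noteq> 0}" using assms(1) finite_surj by blast
  have "pairing w g = (\<Sum>z\<in>h ` X. w z * g z)"
    by (rule pairing_eq_sum) (use assms(1) sub in auto)
  also have "\<dots> = (\<Sum>z\<in>h ` X. \<Sum>p\<in>X. c p * of_bool (z = h p) * g z)"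
    by (simp add: w sum_distrib_right)
  also have "\<dots> = (\<Sum>p\<in>X. \<Sum>z\<in>h ` X. c p * of_bool (z = h p) * g z)"
    by (rule sum.swap)
  also have "\<dots> = (\<Sum>p\<in>X. c p * g (h p))"
  proof (rule sum.cong[OF refl])
    fix p assume p: "p \<in> X"
    have "(\<Sum>z\<in>h ` X. c p * of_bool (z = h p) * g z) = (\<Sum>z\<in>h ` X. if z = h p then c p * g z else 0)"
      by (intro sum.cong) auto
    also have "\<dots> = c p * g (h p)" using p assms(1) by (subst sum.delta) auto
    finally show "(\<Sum>z\<in>h ` X. c p * of_bool (z = h p) * g z) = c p * g (h p)" .
  qed
  finally show "pairing w g = (\<Sum>p\<in>X. c p * g (h p))" .
qed

lemma pushforward_apply:
  assumes "finite {x. u x \<noteq> 0}"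
  shows "pushforward f u z = (\<Sum>x | u x \<noteq> 0. u x * of_bool (z = f x))"
proof -
  have "(\<Sum>x | u x \<noteq> 0. u x * of_bool (z = f x)) = (\<Sum>x\<in>{x. u x \<noteq> 0}. if z = f x then u x else 0)"
    by (intro sum.cong) auto
  also have "\<dots> = (\<Sum>x\<in>{x. u x \<noteq> 0} \<inter> {x. z = f x}. u x)"
    using assms by (simp add: sum.If_cases)
  also have "{x. u x \<noteq> 0} \<inter> {x. z = f x} = {x. u x \<noteq> 0 \<and> f x = z}" by auto
  finally show ?thesis by (simp add: pushforward_def)
qed

lemma
  assumes "finite {x. u x \<noteq> 0}"
  shows finite_pushforward: "finite {z. pushforward f u z \<noteq> 0}"
    and support_pushforward: "{z. pushforward f u z \<noteq> 0} \<subseteq> f ` {x. u x \<noteq> 0}"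
    and pairing_pushforward: "pairing (pushforward f u) g = pairing u (\<lambda>x. g (f x))"
    and pushforward_eq_pairing: "pushforward f u z = pairing u (\<lambda>x. of_bool (z = f x))"
proof -
  note c = assms pushforward_apply[OF assms]
  show "finite {z. pushforward f u z \<noteq> 0}" by (rule finite_combination[OF c])
  show "{z. pushforward f u z \<noteq> 0} \<subseteq> f ` {x. u x \<noteq> 0}" by (rule support_combination[OF c])
  show "pairing (pushforward f u) g = pairing u (\<lambda>x. g (f x))"
    by (subst pairing_combination[OF c]) (simp add: pairing_def)
  show "pushforward f u z = pairing u (\<lambda>x. of_bool (z = f x))"
    by (subst pushforward_apply[OF assms]) (simp add: pairing_def)
qed

lemma pushforward_delta: "pushforward f (delta x :: 'x \<Rightarrow> 'k::field) = delta (f x)"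
  by (rule ext, subst pushforward_eq_pairing) (simp_all)

abbreviation free_algebra :: "('x, 'm) monoid_scheme \<Rightarrow> ('k::field, 'x \<Rightarrow> 'k) module" (\<open>\<F>\<close>) where
  "\<F> \<equiv> monoid_algebra"

lemma monoid_algebra_simps:
  "u \<in> carrier (\<F> G) \<longleftrightarrow> finite {x. u x \<noteq> 0} \<and> {x. u x \<noteq> 0} \<subseteq> carrier G"
  "\<one>\<^bsub>\<F> G\<^esub> = delta \<one>\<^bsub>G\<^esub>" "\<zero>\<^bsub>\<F> G\<^esub> = (\<lambda>z. 0)"
  "u \<oplus>\<^bsub>\<F> G\<^esub> v = (\<lambda>z. u z + v z)" "c \<odot>\<^bsub>\<F> G\<^esub> u = (\<lambda>z. c * u z)"
  by (simp_all add: monoid_algebra_def)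

lemma mult_apply:
  assumes "finite {x. u x \<noteq> 0}" "finite {x. v x \<noteq> 0}"
  shows "(u \<otimes>\<^bsub>\<F> G\<^esub> v) z = (\<Sum>p\<in>{x. u x \<noteq> 0} \<times> {x. v x \<noteq> 0}.
    (u (fst p) * v (snd p)) * of_bool (z = fst p \<otimes>\<^bsub>G\<^esub> snd p))"
proof -
  let ?T = "{x. u x \<noteq> 0} \<times> {x. v x \<noteq> 0}"
  have "(\<Sum>p\<in>?T. (u (fst p) * v (snd p)) * of_bool (z = fst p \<otimes>\<^bsub>G\<^esub> snd p)) =
      (\<Sum>p\<in>?T. if z = fst p \<otimes>\<^bsub>G\<^esub> snd p then u (fst p) * v (snd p) else 0)"
    by (intro sum.cong) auto
  also have "\<dots> = (\<Sum>p\<in>?T \<inter> {p. z = fst p \<otimes>\<^bsub>G\<^esub> snd p}. u (fst p) * v (snd p))"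
    using assms by (simp add: sum.If_cases)
  also have "?T \<inter> {p. z = fst p \<otimes>\<^bsub>G\<^esub> snd p} =
      {(x, y). u x \<noteq> 0 \<and> v y \<noteq> 0 \<and> x \<otimes>\<^bsub>G\<^esub> y = z}" by auto
  finally show ?thesis by (simp add: monoid_algebra_def case_prod_beta')
qed

lemma
  assumes "finite {x. u x \<noteq> 0}" "finite {x. v x \<noteq> 0}"
  shows finite_mult: "finite {z. (u \<otimes>\<^bsub>\<F> G\<^esub> v) z \<noteq> 0}"
    and support_mult: "{z. (u \<otimes>\<^bsub>\<F> G\<^esub> v) z \<noteq> 0} \<subseteq> (\<lambda>(x, y). x \<otimes>\<^bsub>G\<^esub> y) ` ({x. u x \<noteq> 0} \<times> {x. v x \<noteq> 0})"
    and pairing_mult: "pairing (u \<otimes>\<^bsub>\<F> G\<^esub> v) g = pairing u (\<lambda>x. pairing v (\<lambda>y. g (x \<otimes>\<^bsub>G\<^esub> y)))"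
    and mult_eq_pairing: "(u \<otimes>\<^bsub>\<F> G\<^esub> v) z = pairing u (\<lambda>x. pairing v (\<lambda>y. of_bool (z = x \<otimes>\<^bsub>G\<^esub> y)))"
proof -
  have T: "finite ({x. u x \<noteq> 0} \<times> {x. v x \<noteq> 0})" using assms by simp
  note c = T mult_apply[OF assms]
  show "finite {z. (u \<otimes>\<^bsub>\<F> G\<^esub> v) z \<noteq> 0}" by (rule finite_combination[OF c])
  show "{z. (u \<otimes>\<^bsub>\<F> G\<^esub> v) z \<noteq> 0} \<subseteq> (\<lambda>(x, y). x \<otimes>\<^bsub>G\<^esub> y) ` ({x. u x \<noteq> 0} \<times> {x. v x \<noteq> 0})"
    using support_combination[OF c] by (simp add: case_prod_beta')
  show "pairing (u \<otimes>\<^bsub>\<F> G\<^esub> v) g = pairing u (\<lambda>x. pairing v (\<lambda>y. g (x \<otimes>\<^bsub>G\<^esub> y)))"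
    by (subst pairing_combination[OF c])
      (simp add: pairing_def sum_distrib_left sum.cartesian_product case_prod_beta' mult.assoc)
  show "(u \<otimes>\<^bsub>\<F> G\<^esub> v) z = pairing u (\<lambda>x. pairing v (\<lambda>y. of_bool (z = x \<otimes>\<^bsub>G\<^esub> y)))"
    by (subst mult_apply[OF assms])
      (simp add: pairing_def sum_distrib_left sum.cartesian_product case_prod_beta' mult.assoc)
qed

lemma finite_delta: "finite {z. (of_bool (z = x) :: 'k::field) \<noteq> 0}" by simp

lemma delta_closed: "x \<in> carrier G \<Longrightarrow> delta x \<in> carrier (\<F> G)"
  by (auto simp: monoid_algebra_simps)

lemma delta_mult: "delta x \<otimes>\<^bsub>\<F> G\<^esub> delta y = delta (x \<otimes>\<^bsub>G\<^esub> y)"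
  by (rule ext, subst mult_eq_pairing) simp_all

lemma monoid_algebra_vectorspace: "vectorspace class_ring (\<F> G :: ('k::field, 'x \<Rightarrow> 'k) module)"
proof (rule vectorspaceI)
  fix u v :: "'x \<Rightarrow> 'k" assume "u \<in> carrier (\<F> G)" "v \<in> carrier (\<F> G)"
  then have "finite ({x. u x \<noteq> 0} \<union> {x. v x \<noteq> 0})" "{x. u x \<noteq> 0} \<union> {x. v x \<noteq> 0} \<subseteq> carrier G"
    by (auto simp: monoid_algebra_simps)
  moreover have "{x. u x + v x \<noteq> 0} \<subseteq> {x. u x \<noteq> 0} \<union> {x. v x \<noteq> 0}" by auto
  ultimately have "finite {x. u x + v x \<noteq> 0}" "{x. u x + v x \<noteq> 0} \<subseteq> carrier G"
    using finite_subset by blast+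
  then show "u \<oplus>\<^bsub>\<F> G\<^esub> v \<in> carrier (\<F> G)" by (simp add: monoid_algebra_simps)
next
  fix c :: 'k and u :: "'x \<Rightarrow> 'k" assume u: "u \<in> carrier (\<F> G)"
  have "{x. c * u x \<noteq> 0} \<subseteq> {x. u x \<noteq> 0}" by auto
  then have "finite {x. c * u x \<noteq> 0}" "{x. c * u x \<noteq> 0} \<subseteq> carrier G"
    using u finite_subset by (auto simp: monoid_algebra_simps)
  then show "c \<odot>\<^bsub>\<F> G\<^esub> u \<in> carrier (\<F> G)" by (simp add: monoid_algebra_simps)
qed (auto simp: monoid_algebra_simps algebra_simps)

text \<open>Both bracketings of a product of three elements are the same iterated pairing with an
indicator function, up to associativity in \<open>G\<close>.\<close>

lemma monoid_algebra_unital_algebra: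
  assumes "Group.monoid G"
  shows "unital_algebra (\<F> G :: ('k::field, 'x \<Rightarrow> 'k) module)"
proof (rule unital_algebraI)
  interpret G: Group.monoid G by fact
  have fin: "finite {x. u x \<noteq> 0}" and sub: "u x \<noteq> 0 \<Longrightarrow> x \<in> carrier G"
    if "u \<in> carrier (\<F> G)" for u :: "'x \<Rightarrow> 'k" and x
    using that by (auto simp: monoid_algebra_simps)
  note me = mult_eq_pairing[of _ _ G, OF fin fin]
  show closed: "u \<otimes>\<^bsub>\<F> G\<^esub> v \<in> carrier (\<F> G)" if "u \<in> carrier (\<F> G)" "v \<in> carrier (\<F> G)"
    for u v :: "'x \<Rightarrow> 'k"
  proof -
    have "(\<lambda>(x, y). x \<otimes>\<^bsub>G\<^esub> y) ` ({x. u x \<noteq> 0} \<times> {x. v x \<noteq> 0}) \<subseteq> carrier G"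
      using sub[OF that(1)] sub[OF that(2)] by auto
    then show ?thesis
      using finite_mult[OF fin fin, OF that] support_mult[OF fin fin, OF that]
      unfolding monoid_algebra_simps(1) by blast
  qed
  show "u \<otimes>\<^bsub>\<F> G\<^esub> v \<otimes>\<^bsub>\<F> G\<^esub> w = u \<otimes>\<^bsub>\<F> G\<^esub> (v \<otimes>\<^bsub>\<F> G\<^esub> w)"
    if uvw: "u \<in> carrier (\<F> G)" "v \<in> carrier (\<F> G)" "w \<in> carrier (\<F> G)" for u v w :: "'x \<Rightarrow> 'k"
  proof
    fix z
    have "(u \<otimes>\<^bsub>\<F> G\<^esub> v \<otimes>\<^bsub>\<F> G\<^esub> w) z =
        pairing u (\<lambda>x. pairing v (\<lambda>y. pairing w (\<lambda>t. of_bool (z = (x \<otimes>\<^bsub>G\<^esub> y) \<otimes>\<^bsub>G\<^esub> t))))"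
      by (simp add: me[OF closed[OF uvw(1,2)] uvw(3)] pairing_mult fin uvw)
    also have "\<dots> = pairing u (\<lambda>x. pairing v (\<lambda>y. pairing w (\<lambda>t. of_bool (z = x \<otimes>\<^bsub>G\<^esub> (y \<otimes>\<^bsub>G\<^esub> t)))))"
      using uvw sub by (intro pairing_cong) (simp add: G.m_assoc)
    also have "\<dots> = (u \<otimes>\<^bsub>\<F> G\<^esub> (v \<otimes>\<^bsub>\<F> G\<^esub> w)) z"
      by (simp add: me[OF uvw(1) closed[OF uvw(2,3)]] pairing_mult fin uvw)
    finally show "(u \<otimes>\<^bsub>\<F> G\<^esub> v \<otimes>\<^bsub>\<F> G\<^esub> w) z = (u \<otimes>\<^bsub>\<F> G\<^esub> (v \<otimes>\<^bsub>\<F> G\<^esub> w)) z" .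
  qed
  show one: "\<one>\<^bsub>\<F> G\<^esub> \<in> carrier (\<F> G :: ('k, 'x \<Rightarrow> 'k) module)"
    unfolding monoid_algebra_simps(2) by (rule delta_closed) simp
  show "\<one>\<^bsub>\<F> G\<^esub> \<otimes>\<^bsub>\<F> G\<^esub> u = u" if u: "u \<in> carrier (\<F> G)" for u :: "'x \<Rightarrow> 'k"
  proof
    fix z
    have "(\<one>\<^bsub>\<F> G\<^esub> \<otimes>\<^bsub>\<F> G\<^esub> u) z = pairing u (\<lambda>y. of_bool (z = \<one>\<^bsub>G\<^esub> \<otimes>\<^bsub>G\<^esub> y))"
      using me[OF one u] by (simp add: monoid_algebra_simps(2))
    also have "\<dots> = pairing u (\<lambda>y. of_bool (z = y))"
      by (rule pairing_cong) (simp add: sub[OF u])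
    finally show "(\<one>\<^bsub>\<F> G\<^esub> \<otimes>\<^bsub>\<F> G\<^esub> u) z = u z" by (simp add: pairing_of_bool fin u)
  qed
  show "u \<otimes>\<^bsub>\<F> G\<^esub> \<one>\<^bsub>\<F> G\<^esub> = u" if u: "u \<in> carrier (\<F> G)" for u :: "'x \<Rightarrow> 'k"
  proof
    fix z
    have "(u \<otimes>\<^bsub>\<F> G\<^esub> \<one>\<^bsub>\<F> G\<^esub>) z = pairing u (\<lambda>y. of_bool (z = y \<otimes>\<^bsub>G\<^esub> \<one>\<^bsub>G\<^esub>))"
      using me[OF u one] by (simp add: monoid_algebra_simps(2))
    also have "\<dots> = pairing u (\<lambda>y. of_bool (z = y))"
      by (rule pairing_cong) (simp add: sub[OF u])
    finally show "(u \<otimes>\<^bsub>\<F> G\<^esub> \<one>\<^bsub>\<F> G\<^esub>) z = u z" by (simp add: pairing_of_bool fin u)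
  qed
  have V: "u \<oplus>\<^bsub>\<F> G\<^esub> v \<in> carrier (\<F> G)" "c \<odot>\<^bsub>\<F> G\<^esub> u \<in> carrier (\<F> G)"
    if "u \<in> carrier (\<F> G)" "v \<in> carrier (\<F> G)" for u v :: "'x \<Rightarrow> 'k" and c
    using vectorspaceD(2,3)[OF monoid_algebra_vectorspace] that by blast+
  show "(u \<oplus>\<^bsub>\<F> G\<^esub> v) \<otimes>\<^bsub>\<F> G\<^esub> w = u \<otimes>\<^bsub>\<F> G\<^esub> w \<oplus>\<^bsub>\<F> G\<^esub> v \<otimes>\<^bsub>\<F> G\<^esub> w"
    and "w \<otimes>\<^bsub>\<F> G\<^esub> (u \<oplus>\<^bsub>\<F> G\<^esub> v) = w \<otimes>\<^bsub>\<F> G\<^esub> u \<oplus>\<^bsub>\<F> G\<^esub> w \<otimes>\<^bsub>\<F> G\<^esub> v"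
    if uvw: "u \<in> carrier (\<F> G)" "v \<in> carrier (\<F> G)" "w \<in> carrier (\<F> G)" for u v w :: "'x \<Rightarrow> 'k"
    using me[OF V(1)[OF uvw(1,2)] uvw(3)] me[OF uvw(3) V(1)[OF uvw(1,2)]]
    by (auto simp: monoid_algebra_simps(4) me uvw pairing_add fin pairing_add_right)
  show "(c \<odot>\<^bsub>\<F> G\<^esub> u) \<otimes>\<^bsub>\<F> G\<^esub> v = c \<odot>\<^bsub>\<F> G\<^esub> (u \<otimes>\<^bsub>\<F> G\<^esub> v)"
    and "u \<otimes>\<^bsub>\<F> G\<^esub> (c \<odot>\<^bsub>\<F> G\<^esub> v) = c \<odot>\<^bsub>\<F> G\<^esub> (u \<otimes>\<^bsub>\<F> G\<^esub> v)"
    if uv: "u \<in> carrier (\<F> G)" "v \<in> carrier (\<F> G)" for u v :: "'x \<Rightarrow> 'k" and c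
    using me[OF V(2)[OF uv] uv(2)] me[OF uv(1) V(2)[OF uv(2) uv(1)]]
    by (auto simp: monoid_algebra_simps(5) me uv pairing_scale pairing_scale_right)
qed (rule monoid_algebra_vectorspace)

text \<open>The basis vectors span, in the form of an induction principle.\<close>

lemma monoid_algebra_induct:
  assumes W: "subspace_of (\<F> G :: ('k::field, 'x \<Rightarrow> 'k) module) W" and "\<And>x. x \<in> carrier G \<Longrightarrow> delta x \<in> W"
  shows "carrier (\<F> G) \<subseteq> W"
proof
  fix u :: "'x \<Rightarrow> 'k" assume "u \<in> carrier (\<F> G)"
  then have "finite {x. u x \<noteq> 0}" "{x. u x \<noteq> 0} \<subseteq> carrier G"
    by (auto simp: monoid_algebra_simps)
  moreover have "u \<in> W" if "finite X" "X \<subseteq> carrier G" "{x. u x \<noteq> 0} \<subseteq> X" for X and u :: "'x \<Rightarrow> 'k"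
    using that
  proof (induction X arbitrary: u)
    case empty
    then have "u = \<zero>\<^bsub>\<F> G\<^esub>" by (auto simp: monoid_algebra_simps)
    then show ?case using W by (simp add: subspace_of_def)
  next
    case (insert a X)
    have "(\<lambda>z. if z = a then 0 else u z) \<in> W" using insert by (intro insert.IH) auto
    moreover have "u a \<odot>\<^bsub>\<F> G\<^esub> delta a \<in> W"
      using W assms(2) insert.prems by (simp add: subspace_of_def)
    ultimately have "(\<lambda>z. if z = a then 0 else u z) \<oplus>\<^bsub>\<F> G\<^esub> (u a \<odot>\<^bsub>\<F> G\<^esub> delta a) \<in> W"
      using W by (simp add: subspace_of_def)
    also have "(\<lambda>z. if z = a then 0 else u z) \<oplus>\<^bsub>\<F> G\<^esub> (u a \<odot>\<^bsub>\<F> G\<^esub> delta a) = u"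
      by (auto simp: monoid_algebra_simps)
    finally show ?case .
  qed
  ultimately show "u \<in> W" by blast
qed

lemma pushforward_algebra_map:
  fixes G :: "('x, 'm) monoid_scheme" and H :: "('y, 'n) monoid_scheme"
  assumes "\<And>x. x \<in> carrier G \<Longrightarrow> f x \<in> carrier H"
    and "\<And>x y. x \<in> carrier G \<Longrightarrow> y \<in> carrier G \<Longrightarrow> f (x \<otimes>\<^bsub>G\<^esub> y) = f x \<otimes>\<^bsub>H\<^esub> f y"
    and "f \<one>\<^bsub>G\<^esub> = \<one>\<^bsub>H\<^esub>"
  shows "pushforward f \<in> algebra_maps (\<F> G) (\<F> H :: ('k::field, 'y \<Rightarrow> 'k) module)"
proof (intro algebra_mapsI linear_mapsI)
  have fin: "finite {x. u x \<noteq> 0}" and sub: "u x \<noteq> 0 \<Longrightarrow> x \<in> carrier G"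
    if "u \<in> carrier (\<F> G)" for u :: "'x \<Rightarrow> 'k" and x
    using that by (auto simp: monoid_algebra_simps)
  fix u v :: "'x \<Rightarrow> 'k" and c :: 'k
  assume u: "u \<in> carrier (\<F> G)"
  show "pushforward f u \<in> carrier (\<F> H)"
    using finite_pushforward[OF fin[OF u], of f] support_pushforward[OF fin[OF u], of f] sub[OF u]
      assms(1)
    unfolding monoid_algebra_def by auto
  have cu: "c \<odot>\<^bsub>\<F> G\<^esub> u \<in> carrier (\<F> G)"
    by (rule vectorspaceD(3)[OF monoid_algebra_vectorspace u])
  show "pushforward f (c \<odot>\<^bsub>\<F> G\<^esub> u) = c \<odot>\<^bsub>\<F> H\<^esub> pushforward f u"
    using pushforward_eq_pairing[OF fin[OF cu], of f] pushforward_eq_pairing[OF fin[OF u], of f]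
    by (simp add: monoid_algebra_simps pairing_scale fun_eq_iff)
  assume v: "v \<in> carrier (\<F> G)"
  have uv: "u \<oplus>\<^bsub>\<F> G\<^esub> v \<in> carrier (\<F> G)"
    by (rule vectorspaceD(2)[OF monoid_algebra_vectorspace u v])
  show "pushforward f (u \<oplus>\<^bsub>\<F> G\<^esub> v) = pushforward f u \<oplus>\<^bsub>\<F> H\<^esub> pushforward f v"
    using pushforward_eq_pairing[OF fin[OF uv], of f] pushforward_eq_pairing[OF fin[OF u], of f]
      pushforward_eq_pairing[OF fin[OF v], of f]
    by (simp add: monoid_algebra_simps pairing_add fin[OF u] fin[OF v] fun_eq_iff)
  show "pushforward f (u \<otimes>\<^bsub>\<F> G\<^esub> v) = pushforward f u \<otimes>\<^bsub>\<F> H\<^esub> pushforward f v"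
  proof
    fix z
    have "pushforward f (u \<otimes>\<^bsub>\<F> G\<^esub> v) z = pairing u (\<lambda>x. pairing v (\<lambda>y. of_bool (z = f (x \<otimes>\<^bsub>G\<^esub> y))))"
      by (simp add: pushforward_eq_pairing finite_mult pairing_mult fin[OF u] fin[OF v])
    also have "\<dots> = pairing u (\<lambda>x. pairing v (\<lambda>y. of_bool (z = f x \<otimes>\<^bsub>H\<^esub> f y)))"
      by (intro pairing_cong) (simp add: sub[OF u] sub[OF v] assms(2))
    also have "\<dots> = (pushforward f u \<otimes>\<^bsub>\<F> H\<^esub> pushforward f v) z"
      by (simp add: mult_eq_pairing finite_pushforward pairing_pushforward fin[OF u] fin[OF v])
    finally show "pushforward f (u \<otimes>\<^bsub>\<F> G\<^esub> v) z =
      (pushforward f u \<otimes>\<^bsub>\<F> H\<^esub> pushforward f v) z" .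
  qed
qed (simp_all add: monoid_algebra_def pushforward_delta assms(3) pushforward_def)

section \<open>Subspaces and induced maps\<close>

lemma vectorspace_a_minus:
  fixes V :: "('k::field, 'v) module"
  assumes "vectorspace class_ring V" "x \<in> carrier V" "y \<in> carrier V"
  shows "x \<ominus>\<^bsub>V\<^esub> y = x \<oplus>\<^bsub>V\<^esub> (-1) \<odot>\<^bsub>V\<^esub> y"
proof -
  interpret vectorspace class_ring V by fact
  show ?thesis
    using smult_minus_1[OF assms(3)] by (simp add: a_minus_def class_ring_simps)
qed

text \<open>Claims about all elements of a span or of a monoid algebra are proved below by exhibiting
the set where the claim holds as a preimage or an equalizer of linear maps, so that generators
suffice.\<close>

lemma subspace_of_preimage:
  assumes "vectorspace class_ring M" "p \<in> linear_maps M N" "subspace_of N W"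
  shows "subspace_of M {x \<in> carrier M. p x \<in> W}"
  using assms(3) linear_mapsD[OF assms(2)] vectorspaceD(1-3)[OF assms(1)]
  by (auto simp: subspace_of_def)

lemma subspace_of_equalizer:
  assumes "vectorspace class_ring M" "p \<in> linear_maps M N" "q \<in> linear_maps M N"
  shows "subspace_of M {x \<in> carrier M. p x = q x}"
  using linear_mapsD(2-4)[OF assms(2)] linear_mapsD(2-4)[OF assms(3)] vectorspaceD(1-3)[OF assms(1)]
  by (auto simp: subspace_of_def)

lemma linear_maps_comp:
  assumes "p \<in> linear_maps L M" "q \<in> linear_maps M N"
  shows "(\<lambda>x. q (p x)) \<in> linear_maps L N"
  by (intro linear_mapsI) (simp_all add: linear_mapsD[OF assms(1)] linear_mapsD[OF assms(2)])

lemma (in unital_algebra)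
  assumes "a \<in> carrier A"
  shows left_mult_linear: "(\<lambda>x. a \<otimes> x) \<in> linear_maps A A"
    and right_mult_linear: "(\<lambda>x. x \<otimes> a) \<in> linear_maps A A"
  using assms by (auto intro!: linear_mapsI simp: smult_mult_left smult_mult_right alg.l_distr
    alg.r_distr)

lemma
  fixes V :: "('k::field, 'v) module"
  assumes "vectorspace class_ring V" "X \<subseteq> carrier V"
  shows subspace_of_span: "subspace_of V (LinearCombinations.module.span class_ring V X)"
    and in_span_of: "X \<subseteq> LinearCombinations.module.span class_ring V X"
    and span_minimal: "subspace_of V W \<Longrightarrow> X \<subseteq> W \<Longrightarrow> LinearCombinations.module.span class_ring V X \<subseteq> W"
proof -
  interpret vectorspace class_ring V by fact
  have "LinearCombinations.submodule class_ring (span X) V"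
    by (rule span_is_submodule[OF assms(2)])
  then show "subspace_of V (span X)"
    by (auto simp: LinearCombinations.submodule_def subspace_of_def)
  show "X \<subseteq> span X" by (rule in_own_span[OF assms(2)])
  assume "subspace_of V W" "X \<subseteq> W"
  moreover from this have "LinearCombinations.submodule class_ring W V"
    using module_axioms by (auto simp: LinearCombinations.submodule_def subspace_of_def)
  ultimately show "span X \<subseteq> W" using span_is_subset by blast
qed

text \<open>An algebra map that respects the ideals induces a map of the quotients. It is given as a
union over representatives, the form in which \<^const>\<open>tensor_map\<close> is defined.\<close>

lemma
  assumes M: "quotient_algebra M N" and M': "quotient_algebra M' N'"
    and p: "p \<in> algebra_maps M M'" and pN: "p ` N \<subseteq> N'"
  shows induced_map_coset: "u \<in> carrier M \<Longrightarrow>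
      (\<Union>x\<in>N +>\<^bsub>M\<^esub> u. N' +>\<^bsub>M'\<^esub> p x) = N' +>\<^bsub>M'\<^esub> p u"
    and induced_map_algebra_map:
      "(\<lambda>X. \<Union>x\<in>X. N' +>\<^bsub>M'\<^esub> p x) \<in> algebra_maps (quotient_module M N) (quotient_module M' N')"
proof -
  interpret M: quotient_algebra M N by fact
  interpret M': quotient_algebra M' N' by fact
  note pl = linear_mapsD[OF algebra_mapsD(1)[OF p]] and pm = algebra_mapsD(2,3)[OF p]
  show coset: "(\<Union>x\<in>N +>\<^bsub>M\<^esub> u. N' +>\<^bsub>M'\<^esub> p x) = N' +>\<^bsub>M'\<^esub> p u"
    if u: "u \<in> carrier M" for u
  proof (rule UN_eq_const)
    show "N +>\<^bsub>M\<^esub> u \<noteq> {}" using M.N.a_rcos_self[OF u] by blast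
    fix x assume x: "x \<in> N +>\<^bsub>M\<^esub> u"
    then have xM: "x \<in> carrier M"
      using abelian_monoid.a_r_coset_subset_G[OF M.abelian(2) M.N.a_subset u] by blast
    have "x \<ominus>\<^bsub>M\<^esub> u \<in> N"
      using x M.N.a_rcos_module[OF u xM] by (simp add: a_minus_def)
    then have "p (x \<ominus>\<^bsub>M\<^esub> u) \<in> N'" using pN by blast
    also have "p (x \<ominus>\<^bsub>M\<^esub> u) = p x \<ominus>\<^bsub>M'\<^esub> p u"
      using xM u vectorspaceD(3)[OF M.vectorspace_axioms u, of "-1"]
      by (simp add: vectorspace_a_minus[OF M.vectorspace_axioms] vectorspace_a_minus[OF
        M'.vectorspace_axioms] pl)
    finally show "N' +>\<^bsub>M'\<^esub> p x = N' +>\<^bsub>M'\<^esub> p u"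
      using xM u pl(1) by (simp add: M'.coset_eq_iff)
  qed
  have N: "N = N +>\<^bsub>M\<^esub> \<zero>\<^bsub>M\<^esub>" by (simp only: M.coset_zero)
  note c = linear_mapsD[OF M.coset_linear] algebra_mapsD(2,3)[OF M.coset_algebra_map]
    and c' = linear_mapsD[OF M'.coset_linear] algebra_mapsD(2,3)[OF M'.coset_algebra_map]
  have V: "\<zero>\<^bsub>M\<^esub> \<in> carrier M" "\<And>c x. x \<in> carrier M \<Longrightarrow> c \<odot>\<^bsub>M\<^esub> x \<in> carrier M"
    by (simp_all add: vectorspaceD[OF M.vectorspace_axioms])
  show "(\<lambda>X. \<Union>x\<in>X. N' +>\<^bsub>M'\<^esub> p x) \<in> algebra_maps (quotient_module M N) (quotient_module M' N')"
  proof (intro algebra_mapsI linear_mapsI, unfold M.carrier_quotient M'.carrier_quotient;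
    (elim imageE)?)
    show "(\<Union>x\<in>\<zero>\<^bsub>M.Q\<^esub>. N' +>\<^bsub>M'\<^esub> p x) = \<zero>\<^bsub>M'.Q\<^esub>"
      using coset[OF V(1)] c(4) c'(4) pl(4) by simp
    show "(\<Union>x\<in>\<one>\<^bsub>M.Q\<^esub>. N' +>\<^bsub>M'\<^esub> p x) = \<one>\<^bsub>M'.Q\<^esub>"
      using coset[OF M.alg.one_closed] c(6) c'(6) pm(2) by simp
  next
    fix X x assume "X = N +>\<^bsub>M\<^esub> x" "x \<in> carrier M"
    then show "(\<Union>x\<in>X. N' +>\<^bsub>M'\<^esub> p x) \<in> (\<lambda>x. N' +>\<^bsub>M'\<^esub> x) ` carrier M'"
      using coset pl(1) by simp
  next
    fix c X x assume "X = N +>\<^bsub>M\<^esub> x" "x \<in> carrier M"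
    then show "(\<Union>x\<in>c \<odot>\<^bsub>M.Q\<^esub> X. N' +>\<^bsub>M'\<^esub> p x) = c \<odot>\<^bsub>M'.Q\<^esub> (\<Union>x\<in>X. N' +>\<^bsub>M'\<^esub> p x)"
      using coset pl c c' V by (simp add: c(3)[symmetric])
  next
    fix X x Y y assume "X = N +>\<^bsub>M\<^esub> x" "Y = N +>\<^bsub>M\<^esub> y" "x \<in> carrier M" "y \<in> carrier M"
    then show "(\<Union>x\<in>X \<oplus>\<^bsub>M.Q\<^esub> Y. N' +>\<^bsub>M'\<^esub> p x) =
        (\<Union>x\<in>X. N' +>\<^bsub>M'\<^esub> p x) \<oplus>\<^bsub>M'.Q\<^esub> (\<Union>x\<in>Y. N' +>\<^bsub>M'\<^esub> p x)"
      and "(\<Union>x\<in>X \<otimes>\<^bsub>M.Q\<^esub> Y. N' +>\<^bsub>M'\<^esub> p x) =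
        (\<Union>x\<in>X. N' +>\<^bsub>M'\<^esub> p x) \<otimes>\<^bsub>M'.Q\<^esub> (\<Union>x\<in>Y. N' +>\<^bsub>M'\<^esub> p x)"
      using coset pl c'(2,5) pm by (simp_all add: c(2,5)[symmetric])
  qed
qed

lemma pairing_diff:
  assumes "finite {x. u x \<noteq> 0}" "finite {x. v x \<noteq> 0}"
  shows "pairing (\<lambda>z. u z - v z) g = pairing u g - pairing v g"
  using pairing_add[of u "\<lambda>z. -1 * v z" g] pairing_scale[of "-1" v g] assms by simp

lemma finite_diff_support:
  fixes u v :: "'x \<Rightarrow> 'k::field"
  assumes "finite {x. u x \<noteq> 0}" "finite {x. v x \<noteq> 0}"
  shows "finite {x. u x - v x \<noteq> 0}"
  by (rule finite_subset[of _ "{x. u x \<noteq> 0} \<union> {x. v x \<noteq> 0}"]) (use assms in auto)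

lemma finite_scale_support:
  fixes u :: "'x \<Rightarrow> 'k::field"
  assumes "finite {x. u x \<noteq> 0}"
  shows "finite {x. c * u x \<noteq> 0}"
  by (rule finite_subset[of _ "{x. u x \<noteq> 0}"]) (use assms in auto)

section \<open>Finite tensor products\<close>

text \<open>The two kinds of generators of the kernel of the tensor product, as formal combinations of
families.\<close>

definition add_relation ::
  "('i \<Rightarrow> ('k::field, 'b) module) \<Rightarrow> ('i \<Rightarrow> 'b) \<Rightarrow> 'i \<Rightarrow> 'b \<Rightarrow> 'b \<Rightarrow> ('i \<Rightarrow> 'b) \<Rightarrow> 'k" where
  "add_relation A x i a b = (\<lambda>z. of_bool (z = x(i := a \<oplus>\<^bsub>A i\<^esub> b)) -
     of_bool (z = x(i := a)) - of_bool (z = x(i := b)))"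

definition smult_relation ::
  "('i \<Rightarrow> ('k::field, 'b) module) \<Rightarrow> ('i \<Rightarrow> 'b) \<Rightarrow> 'i \<Rightarrow> 'k \<Rightarrow> 'b \<Rightarrow> ('i \<Rightarrow> 'b) \<Rightarrow> 'k" where
  "smult_relation A x i c a = (\<lambda>z. of_bool (z = x(i := c \<odot>\<^bsub>A i\<^esub> a)) - c * of_bool (z = x(i := a)))"

lemma multilinear_relations_eq:
  "multilinear_relations A S =
     {add_relation A x i a b | x i a b. x \<in> (\<Pi>\<^sub>E i\<in>S. carrier (A i)) \<and> i \<in> S \<and>
        a \<in> carrier (A i) \<and> b \<in> carrier (A i)}
   \<union> {smult_relation A x i c a | x i a c. x \<in> (\<Pi>\<^sub>E i\<in>S. carrier (A i)) \<and> i \<in> S \<and> a \<in> carrier (A i)}"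
  unfolding multilinear_relations_def add_relation_def smult_relation_def ..

lemma relationI:
  assumes "x \<in> carrier (product_group S A)" "i \<in> S" "a \<in> carrier (A i)"
  shows "b \<in> carrier (A i) \<Longrightarrow> add_relation A x i a b \<in> multilinear_relations A S"
    and "smult_relation A x i c a \<in> multilinear_relations A S"
  using assms unfolding multilinear_relations_eq carrier_product_group by blast+

lemma finite_relation:
  "finite {z. add_relation A x i a b z \<noteq> 0}" "finite {z. smult_relation A x i c a z \<noteq> 0}"
  unfolding add_relation_def smult_relation_def
  by (intro finite_diff_support finite_scale_support; simp)+

text \<open>A function is additive and homogeneous in position \<open>i\<close> exactly if its pairings with the
relations vanish.\<close>

lemma pairing_relation:
  "pairing (add_relation A x i a b) g = g (x(i := a \<oplus>\<^bsub>A i\<^esub> b)) - g (x(i := a)) - g (x(i := b))"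
  "pairing (smult_relation A x i c a) g = g (x(i := c \<odot>\<^bsub>A i\<^esub> a)) - c * g (x(i := a))"
  unfolding add_relation_def smult_relation_def
  by (simp_all only: pairing_diff finite_diff_support finite_scale_support finite_delta
    pairing_scale pairing_delta)

lemma PiE_fun_upd: "x \<in> (\<Pi>\<^sub>E i\<in>S. B i) \<Longrightarrow> i \<in> S \<Longrightarrow> a \<in> B i \<Longrightarrow> x(i := a) \<in> (\<Pi>\<^sub>E i\<in>S. B i)"
  by (auto simp: PiE_iff extensional_def)

locale tensor_factors =
  fixes A :: "'i \<Rightarrow> ('k::field, 'b) module" and I :: "'i set"
  assumes factor: "i \<in> I \<Longrightarrow> unital_algebra (A i)"
begin

abbreviation "G S \<equiv> product_group S A"
abbreviation "F S \<equiv> free_tensors A S"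
abbreviation "K S \<equiv> tensor_kernel A S"
abbreviation "fill \<equiv> fill_units A"

lemmas factor_closed = unital_algebraD[OF factor]

lemma monoid_G:
  assumes "S \<subseteq> I"
  shows "Group.monoid (G S)"
proof (rule monoidI)
  fix x y z assume xyz: "x \<in> carrier (G S)" "y \<in> carrier (G S)" "z \<in> carrier (G S)"
  show "x \<otimes>\<^bsub>G S\<^esub> y \<otimes>\<^bsub>G S\<^esub> z = x \<otimes>\<^bsub>G S\<^esub> (y \<otimes>\<^bsub>G S\<^esub> z)"
  proof
    fix i
    show "(x \<otimes>\<^bsub>G S\<^esub> y \<otimes>\<^bsub>G S\<^esub> z) i = (x \<otimes>\<^bsub>G S\<^esub> (y \<otimes>\<^bsub>G S\<^esub> z)) i"
    proof (cases "i \<in> S")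
      case True
      then interpret unital_algebra "A i" using factor assms by blast
      have "x i \<in> carrier (A i)" "y i \<in> carrier (A i)" "z i \<in> carrier (A i)"
        using True xyz by (auto simp: PiE_iff)
      then show ?thesis using True by (simp add: alg.m_assoc)
    qed simp
  qed
qed (use assms in \<open>auto simp: PiE_iff subset_iff factor_closed fun_eq_iff extensional_def\<close>)

lemma F_algebra: "S \<subseteq> I \<Longrightarrow> unital_algebra (F S)"
  by (intro monoid_algebra_unital_algebra monoid_G)

lemma F_vectorspace: "vectorspace class_ring (F S)"
  by (rule monoid_algebra_vectorspace)

lemma relations_closed:
  assumes "S \<subseteq> I"
  shows "multilinear_relations A S \<subseteq> carrier (F S)"
proof -
  have delta: "delta x \<in> carrier (F S)" if "x \<in> (\<Pi>\<^sub>E i\<in>S. carrier (A i))" for x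
    using that by (intro delta_closed) simp
  note V = vectorspaceD(2,3)[OF F_vectorspace, of _ S, unfolded monoid_algebra_simps(4,5)]
  have minus: "(\<lambda>z. u z - c * v z) \<in> carrier (F S)" if "u \<in> carrier (F S)" "v \<in> carrier (F S)" for u v c
    using V(1)[OF that(1) V(2)[OF that(2), of "-c"]] by simp
  have "add_relation A x i a b \<in> carrier (F S)"
    if "x \<in> (\<Pi>\<^sub>E i\<in>S. carrier (A i))" "i \<in> S" "a \<in> carrier (A i)" "b \<in> carrier (A i)" for x i a b
  proof -
    have "delta (x(i := a \<oplus>\<^bsub>A i\<^esub> b)) \<in> carrier (F S)" "delta (x(i := a)) \<in> carrier (F S)"
      "delta (x(i := b)) \<in> carrier (F S)"
      using that assms by (intro delta PiE_fun_upd; auto simp: factor_closed subset_iff)+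
    from minus[OF minus[OF this(1,2), of 1] this(3), of 1] show ?thesis
      by (simp add: add_relation_def)
  qed
  moreover have "smult_relation A x i c a \<in> carrier (F S)"
    if "x \<in> (\<Pi>\<^sub>E i\<in>S. carrier (A i))" "i \<in> S" "a \<in> carrier (A i)" for x i a c
  proof -
    have "delta (x(i := c \<odot>\<^bsub>A i\<^esub> a)) \<in> carrier (F S)" "delta (x(i := a)) \<in> carrier (F S)"
      using that assms by (intro delta PiE_fun_upd; auto simp: factor_closed subset_iff)+
    from minus[OF this, of c] show ?thesis
      by (simp add: smult_relation_def)
  qed
  ultimately show ?thesis unfolding multilinear_relations_eq by blast
qed

lemma
  assumes "S \<subseteq> I"
  shows kernel_subspace: "subspace_of (F S) (K S)"
    and relations_in_kernel: "multilinear_relations A S \<subseteq> K S"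
    and kernel_minimal: "subspace_of (F S) W \<Longrightarrow> multilinear_relations A S \<subseteq> W \<Longrightarrow> K S \<subseteq> W"
  unfolding tensor_kernel_def
  using subspace_of_span[OF F_vectorspace relations_closed[OF assms]]
    in_span_of[OF F_vectorspace relations_closed[OF assms]]
    span_minimal[OF F_vectorspace relations_closed[OF assms]] by simp_all

lemma kernel_closed: "S \<subseteq> I \<Longrightarrow> K S \<subseteq> carrier (F S)"
  using kernel_subspace by (auto simp: subspace_of_def)

lemma mult_fun_upd:
  assumes "i \<in> S"
  shows "y \<otimes>\<^bsub>G S\<^esub> x(i := a) = (y \<otimes>\<^bsub>G S\<^esub> x)(i := y i \<otimes>\<^bsub>A i\<^esub> a)"
    and "x(i := a) \<otimes>\<^bsub>G S\<^esub> y = (x \<otimes>\<^bsub>G S\<^esub> y)(i := a \<otimes>\<^bsub>A i\<^esub> y i)"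
  using assms by (auto simp: fun_eq_iff)

text \<open>Multiplication by a family \<open>y\<close> turns the relation at \<open>x\<close> with entries \<open>a\<close>, \<open>b\<close> in position
\<open>i\<close> into the relation at \<open>y x\<close> with entries \<open>y i a\<close>, \<open>y i b\<close>, because the multiplication of \<open>A i\<close>
is bilinear.\<close>

lemma delta_mult_relation:
  assumes S: "S \<subseteq> I" and y: "y \<in> carrier (G S)" and r: "r \<in> multilinear_relations A S"
  shows "delta y \<otimes>\<^bsub>F S\<^esub> r \<in> multilinear_relations A S" "r \<otimes>\<^bsub>F S\<^esub> delta y \<in> multilinear_relations A S"
proof -
  have left: "delta y \<otimes>\<^bsub>F S\<^esub> u = pushforward (\<lambda>x. y \<otimes>\<^bsub>G S\<^esub> x) u"
    and right: "u \<otimes>\<^bsub>F S\<^esub> delta y = pushforward (\<lambda>x. x \<otimes>\<^bsub>G S\<^esub> y) u"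
    if "finite {x. u x \<noteq> 0}" for u :: "('i \<Rightarrow> 'b) \<Rightarrow> 'k"
    by (rule ext, simp add: that mult_eq_pairing pushforward_eq_pairing)+
  consider (add) x i a b where "r = add_relation A x i a b" "x \<in> carrier (G S)" "i \<in> S"
      "a \<in> carrier (A i)" "b \<in> carrier (A i)"
    | (smult) x i c a where "r = smult_relation A x i c a" "x \<in> carrier (G S)" "i \<in> S" "a
      \<in> carrier (A i)"
    using r unfolding multilinear_relations_eq by auto
  then have "delta y \<otimes>\<^bsub>F S\<^esub> r \<in> multilinear_relations A S \<and> r \<otimes>\<^bsub>F S\<^esub> delta y \<in> multilinear_relations A S"
  proof cases
    case add
    then have i: "i \<in> I" using S by blast
    interpret Ai: unital_algebra "A i" by (rule factor[OF i])
    have yi: "y i \<in> carrier (A i)" using y add(3) by (auto simp: PiE_iff)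
    have "delta y \<otimes>\<^bsub>F S\<^esub> r = add_relation A (y \<otimes>\<^bsub>G S\<^esub> x) i (y i \<otimes>\<^bsub>A i\<^esub> a) (y i \<otimes>\<^bsub>A i\<^esub> b)"
      unfolding add(1) left[OF finite_relation(1)]
      by (rule ext, subst pushforward_eq_pairing[OF finite_relation(1)])
        (simp only: pairing_relation mult_fun_upd[OF add(3)], simp only: add_relation_def
          Ai.alg.r_distr[OF add(4,5) yi, symmetric])
    moreover have "r \<otimes>\<^bsub>F S\<^esub> delta y = add_relation A (x \<otimes>\<^bsub>G S\<^esub> y) i (a \<otimes>\<^bsub>A i\<^esub> y i) (b \<otimes>\<^bsub>A i\<^esub> y i)"
      unfolding add(1) right[OF finite_relation(1)]
      by (rule ext, subst pushforward_eq_pairing[OF finite_relation(1)])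
        (simp only: pairing_relation mult_fun_upd[OF add(3)], simp only: add_relation_def
          Ai.alg.l_distr[OF add(4,5) yi, symmetric])
    moreover have "y \<otimes>\<^bsub>G S\<^esub> x \<in> carrier (G S)" "x \<otimes>\<^bsub>G S\<^esub> y \<in> carrier (G S)"
      using y add(2) by (simp_all only: Group.monoid.m_closed[OF monoid_G[OF S]])
    ultimately show ?thesis
      using add(3-) yi by (simp only:) (blast intro: relationI Ai.alg.m_closed)
  next
    case smult
    then have i: "i \<in> I" using S by blast
    interpret Ai: unital_algebra "A i" by (rule factor[OF i])
    have yi: "y i \<in> carrier (A i)" using y smult(3) by (auto simp: PiE_iff)
    have "delta y \<otimes>\<^bsub>F S\<^esub> r = smult_relation A (y \<otimes>\<^bsub>G S\<^esub> x) i c (y i \<otimes>\<^bsub>A i\<^esub> a)"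
      unfolding smult(1) left[OF finite_relation(2)]
      by (rule ext, subst pushforward_eq_pairing[OF finite_relation(2)])
        (simp only: pairing_relation mult_fun_upd[OF smult(3)], simp only: smult_relation_def
          Ai.smult_mult_right[OF yi smult(4)])
    moreover have "r \<otimes>\<^bsub>F S\<^esub> delta y = smult_relation A (x \<otimes>\<^bsub>G S\<^esub> y) i c (a \<otimes>\<^bsub>A i\<^esub> y i)"
      unfolding smult(1) right[OF finite_relation(2)]
      by (rule ext, subst pushforward_eq_pairing[OF finite_relation(2)])
        (simp only: pairing_relation mult_fun_upd[OF smult(3)], simp only: smult_relation_def
          Ai.smult_mult_left[OF smult(4) yi])
    moreover have "y \<otimes>\<^bsub>G S\<^esub> x \<in> carrier (G S)" "x \<otimes>\<^bsub>G S\<^esub> y \<in> carrier (G S)"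
      using y smult(2) by (simp_all only: Group.monoid.m_closed[OF monoid_G[OF S]])
    ultimately show ?thesis
      using smult(3-) yi by (simp only:) (blast intro: relationI Ai.alg.m_closed)
  qed
  then show "delta y \<otimes>\<^bsub>F S\<^esub> r \<in> multilinear_relations A S" "r \<otimes>\<^bsub>F S\<^esub> delta y \<in> multilinear_relations A S"
    by blast+
qed

text \<open>Linear extension of the previous lemma, first from relations to the kernel and then from
families to their formal combinations.\<close>

lemma kernel_ideal:
  assumes S: "S \<subseteq> I" and u: "u \<in> carrier (F S)" and k: "k \<in> K S"
  shows "u \<otimes>\<^bsub>F S\<^esub> k \<in> K S" "k \<otimes>\<^bsub>F S\<^esub> u \<in> K S"
proof -
  interpret unital_algebra "F S" by (rule F_algebra[OF S])
  have kF: "k \<in> carrier (F S)" using k kernel_closed[OF S] by blast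
  have d: "delta y \<otimes>\<^bsub>F S\<^esub> k \<in> K S" "k \<otimes>\<^bsub>F S\<^esub> delta y \<in> K S" if y: "y \<in> carrier (G S)" for y
  proof -
    have dy: "delta y \<in> carrier (F S)" by (rule delta_closed[OF y])
    have "K S \<subseteq> {x \<in> carrier (F S). delta y \<otimes>\<^bsub>F S\<^esub> x \<in> K S}"
      using S delta_mult_relation(1)[OF S y] relations_closed[OF S] relations_in_kernel[OF S]
      by (intro kernel_minimal subspace_of_preimage[OF F_vectorspace left_mult_linear[OF dy]
        kernel_subspace]) auto
    then show "delta y \<otimes>\<^bsub>F S\<^esub> k \<in> K S" using k by blast
    have "K S \<subseteq> {x \<in> carrier (F S). x \<otimes>\<^bsub>F S\<^esub> delta y \<in> K S}"
      using S delta_mult_relation(2)[OF S y] relations_closed[OF S] relations_in_kernel[OF S]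
      by (intro kernel_minimal subspace_of_preimage[OF F_vectorspace right_mult_linear[OF dy]
        kernel_subspace]) auto
    then show "k \<otimes>\<^bsub>F S\<^esub> delta y \<in> K S" using k by blast
  qed
  have "carrier (F S) \<subseteq> {x \<in> carrier (F S). x \<otimes>\<^bsub>F S\<^esub> k \<in> K S}"
    using d(1) delta_closed[where G = "G S"]
    by (intro monoid_algebra_induct subspace_of_preimage[OF F_vectorspace right_mult_linear[OF kF]
      kernel_subspace[OF S]]) auto
  then show "u \<otimes>\<^bsub>F S\<^esub> k \<in> K S" using u by blast
  have "carrier (F S) \<subseteq> {x \<in> carrier (F S). k \<otimes>\<^bsub>F S\<^esub> x \<in> K S}"
    using d(2) delta_closed[where G = "G S"]
    by (intro monoid_algebra_induct subspace_of_preimage[OF F_vectorspace left_mult_linear[OF kF]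
      kernel_subspace[OF S]]) auto
  then show "k \<otimes>\<^bsub>F S\<^esub> u \<in> K S" using u by blast
qed

lemma F_quotient: "S \<subseteq> I \<Longrightarrow> quotient_algebra (F S) (K S)"
  by (intro quotient_algebra.intro quotient_algebra_axioms.intro F_algebra kernel_subspace kernel_ideal)

lemma finite_tensor_algebra: "S \<subseteq> I \<Longrightarrow> unital_algebra (finite_tensor A S)"
  unfolding finite_tensor_def by (rule quotient_algebra.quotient_unital_algebra[OF F_quotient])

lemma fill_closed:
  assumes "S \<subseteq> T" "T \<subseteq> I" "x \<in> carrier (G S)"
  shows "fill S T x \<in> carrier (G T)"
  using assms by (auto simp: fill_units_def factor_closed PiE_iff subset_iff)

lemma fill_map:
  assumes "S \<subseteq> T" "T \<subseteq> I"
  shows "pushforward (fill S T) \<in> algebra_maps (F S) (F T)"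
proof (rule pushforward_algebra_map)
  fix x y assume "x \<in> carrier (G S)" "y \<in> carrier (G S)"
  then show "fill S T (x \<otimes>\<^bsub>G S\<^esub> y) = fill S T x \<otimes>\<^bsub>G T\<^esub> fill S T y"
    using assms by (auto simp: fill_units_def factor_closed fun_eq_iff subset_iff)
qed (use assms fill_closed in \<open>auto simp: fill_units_def fun_eq_iff\<close>)

text \<open>Filling in units does not touch the position in which a relation lives, so it maps
relations to relations.\<close>

lemma fill_kernel:
  assumes ST: "S \<subseteq> T" "T \<subseteq> I"
  shows "pushforward (fill S T) ` K S \<subseteq> K T"
proof -
  have S: "S \<subseteq> I" using ST by blast
  have upd: "fill S T (x(i := a)) = (fill S T x)(i := a)" if "i \<in> S" for x i a
    using that ST by (auto simp: fill_units_def fun_eq_iff)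
  have "pushforward (fill S T) r \<in> multilinear_relations A T" if r: "r \<in> multilinear_relations A S"
    for r
  proof -
    consider (add) x i a b where "r = add_relation A x i a b" "x \<in> carrier (G S)" "i \<in> S"
        "a \<in> carrier (A i)" "b \<in> carrier (A i)"
      | (smult) x i c a where "r = smult_relation A x i c a" "x \<in> carrier (G S)" "i \<in> S" "a
        \<in> carrier (A i)"
      using r unfolding multilinear_relations_eq by auto
    then show ?thesis
    proof cases
      case add
      have "pushforward (fill S T) r = add_relation A (fill S T x) i a b"
        unfolding add(1)
        by (rule ext, subst pushforward_eq_pairing[OF finite_relation(1)])
          (simp only: pairing_relation upd[OF add(3)], simp only: add_relation_def)
      then show ?thesis
        using add fill_closed[OF ST add(2)] ST(1) by (simp only:) (blast intro: relationI)
    next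
      case smult
      have "pushforward (fill S T) r = smult_relation A (fill S T x) i c a"
        unfolding smult(1)
        by (rule ext, subst pushforward_eq_pairing[OF finite_relation(2)])
          (simp only: pairing_relation upd[OF smult(3)], simp only: smult_relation_def)
      then show ?thesis
        using smult fill_closed[OF ST smult(2)] ST(1) by (simp only:) (blast intro: relationI)
    qed
  qed
  then have "K S \<subseteq> {u \<in> carrier (F S). pushforward (fill S T) u \<in> K T}"
    using relations_closed[OF S] relations_in_kernel[OF ST(2)]
    by (intro kernel_minimal[OF S] subspace_of_preimage[OF F_vectorspace
          algebra_mapsD(1)[OF fill_map[OF ST]] kernel_subspace[OF ST(2)]]) auto
  then show ?thesis by blast
qed

lemma tensor_map_eq: "tensor_map A S T X = (\<Union>u\<in>X. K T +>\<^bsub>F T\<^esub> pushforward (fill S T) u)"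
  by (simp add: tensor_map_def pushforward_def)

lemma
  assumes ST: "S \<subseteq> T" "T \<subseteq> I"
  shows tensor_map_coset: "u \<in> carrier (F S) \<Longrightarrow>
      tensor_map A S T (K S +>\<^bsub>F S\<^esub> u) = K T +>\<^bsub>F T\<^esub> pushforward (fill S T) u"
    and tensor_map_algebra_map: "tensor_map A S T \<in> algebra_maps (finite_tensor A S) (finite_tensor
      A T)"
proof -
  have S: "S \<subseteq> I" using ST by blast
  note * = F_quotient[OF S] F_quotient[OF ST(2)] fill_map[OF ST] fill_kernel[OF ST]
  show "tensor_map A S T (K S +>\<^bsub>F S\<^esub> u) = K T +>\<^bsub>F T\<^esub> pushforward (fill S T) u"
    if "u \<in> carrier (F S)" using induced_map_coset[OF * that] by (simp add: tensor_map_eq)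
  show "tensor_map A S T \<in> algebra_maps (finite_tensor A S) (finite_tensor A T)"
    using induced_map_algebra_map[OF *] by (simp add: finite_tensor_def tensor_map_eq[abs_def])
qed

lemma pushforward_fill_fill:
  assumes "S \<subseteq> T" "T \<subseteq> U" "u \<in> carrier (F S)"
  shows "pushforward (fill T U) (pushforward (fill S T) u) = pushforward (fill S U) u"
proof
  fix z
  have fin: "finite {x. u x \<noteq> 0}" using assms(3) by (simp add: monoid_algebra_simps)
  have "fill T U (fill S T x) = fill S U x" for x
    using assms by (auto simp: fill_units_def fun_eq_iff)
  then show "pushforward (fill T U) (pushforward (fill S T) u) z = pushforward (fill S U) u z"
    by (subst pushforward_eq_pairing[OF finite_pushforward[OF fin]], subst pairing_pushforward[OF fin],
        subst pushforward_eq_pairing[OF fin]) simp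
qed

abbreviation "P \<equiv> {S. finite S \<and> S \<subseteq> I}"

sublocale directed_algebras P "(\<subseteq>)" "finite_tensor A" "tensor_map A"
proof (rule directed_algebras.intro)
  fix j k l x
  assume S: "j \<in> P" "k \<in> P" "l \<in> P" "j \<subseteq> k" "k \<subseteq> l" and x: "x \<in> carrier (finite_tensor A j)"
  interpret j: quotient_algebra "F j" "K j" by (rule F_quotient) (use S in blast)
  obtain u where u: "u \<in> carrier (F j)" "x = K j +>\<^bsub>F j\<^esub> u"
    using x by (auto simp: finite_tensor_def j.carrier_quotient)
  have "pushforward (fill j k) u \<in> carrier (F k)"
    using linear_mapsD(1)[OF algebra_mapsD(1)[OF fill_map]] S u by blast
  then show "tensor_map A k l (tensor_map A j k x) = tensor_map A j l x"
    using S u tensor_map_coset[of j k] tensor_map_coset[of k l] tensor_map_coset[of j l]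
      pushforward_fill_fill[of j k l u] by auto
next
  fix j k assume "j \<in> P" "k \<in> P"
  then show "\<exists>l\<in>P. j \<subseteq> l \<and> k \<subseteq> l" by (intro bexI[of _ "j \<union> k"]) auto
qed (auto intro: finite_tensor_algebra tensor_map_algebra_map)

end

section \<open>The infinite tensor product\<close>

context tensor_factors
begin

abbreviation "\<A> \<equiv> infinite_tensor A I"

lemma infinite_tensor_algebra: "unital_algebra \<A>"
  unfolding infinite_tensor_def by (rule limit_unital_algebra)

text \<open>The canonical map from the formal combinations of families over \<open>S\<close> to the limit. Every
element of the limit arises in this way from some finite \<open>S\<close>.\<close>

definition stage :: "'i set \<Rightarrow> (('i \<Rightarrow> 'b) \<Rightarrow> 'k) \<Rightarrow> ('i set \<times> (('i \<Rightarrow> 'b) \<Rightarrow> 'k) set) set" where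
  "stage S u = cls S (K S +>\<^bsub>F S\<^esub> u)"

lemma stage_algebra_map:
  assumes "S \<in> P"
  shows "stage S \<in> algebra_maps (F S) \<A>"
proof -
  interpret quotient_algebra "F S" "K S" by (rule F_quotient) (use assms in blast)
  have "cls S \<in> algebra_maps (quotient_module (F S) (K S)) \<A>"
    using class_algebra_map[OF assms] by (simp add: finite_tensor_def infinite_tensor_def)
  from algebra_maps_comp[OF coset_algebra_map this unital_algebra_axioms]
  show ?thesis unfolding stage_def .
qed

lemmas stage_linear = linear_mapsD[OF algebra_mapsD(1)[OF stage_algebra_map]]
lemmas stage_mult = algebra_mapsD(2,3)[OF stage_algebra_map]

lemma carrier_infinite_tensor: "carrier \<A> = (\<Union>S\<in>P. stage S ` carrier (F S))"
proof -
  have ft: "carrier (finite_tensor A S) = (\<lambda>u. K S +>\<^bsub>F S\<^esub> u) ` carrier (F S)" if "S \<in> P" for S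
  proof -
    interpret quotient_algebra "F S" "K S" by (rule F_quotient) (use that in blast)
    show ?thesis by (simp add: carrier_quotient finite_tensor_def)
  qed
  have "carrier \<A> = (\<Union>S\<in>P. cls S ` carrier (finite_tensor A S))"
    unfolding infinite_tensor_def carrier_limit by auto
  also have "\<dots> = (\<Union>S\<in>P. stage S ` carrier (F S))"
    by (intro SUP_cong refl) (simp only: ft image_image flip: stage_def)
  finally show ?thesis .
qed

lemma coset_in_finite_tensor:
  assumes "S \<in> P" "u \<in> carrier (F S)"
  shows "K S +>\<^bsub>F S\<^esub> u \<in> carrier (finite_tensor A S)"
proof -
  interpret quotient_algebra "F S" "K S" by (rule F_quotient) (use assms in blast)
  show ?thesis using assms(2) by (simp add: carrier_quotient finite_tensor_def)
qed

lemma stage_fill: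
  assumes "S \<subseteq> T" "T \<in> P" "u \<in> carrier (F S)"
  shows "stage T (pushforward (fill S T) u) = stage S u"
proof -
  have S: "S \<in> P" "T \<subseteq> I" using assms finite_subset by auto
  show ?thesis
    unfolding stage_def
    using class_map[OF S(1) assms(2,1) coset_in_finite_tensor[OF S(1) assms(3)]]
      tensor_map_coset[OF assms(1) S(2) assms(3)] by simp
qed

text \<open>An element vanishes in the limit only if at some later stage it is a combination of
relations.\<close>

lemma stage_eq_zeroD:
  assumes S: "S \<in> P" and u: "u \<in> carrier (F S)" and "stage S u = \<zero>\<^bsub>\<A>\<^esub>"
  obtains T where "T \<in> P" "S \<subseteq> T" "pushforward (fill S T) u \<in> K T"
proof -
  have z: "\<zero>\<^bsub>F S\<^esub> \<in> carrier (F S)" by (rule vectorspaceD(1)[OF F_vectorspace])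
  have "stage S u = stage S \<zero>\<^bsub>F S\<^esub>" using assms(3) stage_linear(4)[OF S] by simp
  then obtain T where T: "T \<in> P" "S \<subseteq> T"
    and eq: "tensor_map A S T (K S +>\<^bsub>F S\<^esub> u) = tensor_map A S T (K S +>\<^bsub>F S\<^esub> \<zero>\<^bsub>F S\<^esub>)"
    unfolding stage_def
    by (subst (asm) class_eq_iff[OF S S coset_in_finite_tensor[OF S u] coset_in_finite_tensor[OF S
      z]]) blast
  have TI: "T \<subseteq> I" using T by blast
  interpret quotient_algebra "F T" "K T" by (rule F_quotient[OF TI])
  note fl = linear_mapsD[OF algebra_mapsD(1)[OF fill_map[OF T(2) TI]]]
  have "K T +>\<^bsub>F T\<^esub> pushforward (fill S T) u = K T"
    using eq tensor_map_coset[OF T(2) TI u] tensor_map_coset[OF T(2) TI z] fl(4) coset_zero by simp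
  then have "pushforward (fill S T) u \<in> K T"
    using coset_eq_N_iff[OF fl(1)[OF u]] by simp
  then show thesis using that T by blast
qed

lemma stage_kernel:
  assumes S: "S \<in> P" and k: "k \<in> K S"
  shows "stage S k = \<zero>\<^bsub>\<A>\<^esub>"
proof -
  have SI: "S \<subseteq> I" using S by blast
  interpret quotient_algebra "F S" "K S" by (rule F_quotient[OF SI])
  have kF: "k \<in> carrier (F S)" using k kernel_closed[OF SI] by blast
  have "K S +>\<^bsub>F S\<^esub> k = K S +>\<^bsub>F S\<^esub> \<zero>\<^bsub>F S\<^esub>"
    using coset_eq_N_iff[OF kF] k coset_zero by simp
  then have "stage S k = stage S \<zero>\<^bsub>F S\<^esub>" unfolding stage_def by simp
  then show ?thesis using stage_linear(4)[OF S] by simp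
qed

definition pure :: "'i set \<Rightarrow> ('i \<Rightarrow> 'b) \<Rightarrow> ('i set \<times> (('i \<Rightarrow> 'b) \<Rightarrow> 'k) set) set" where
  "pure S x = stage S (delta x)"

definition factor_emb :: "'i \<Rightarrow> 'b \<Rightarrow> ('i set \<times> (('i \<Rightarrow> 'b) \<Rightarrow> 'k) set) set" where
  "factor_emb i a = pure {i} (\<lambda>j\<in>{i}. a)"

definition single :: "'i set \<Rightarrow> 'i \<Rightarrow> 'b \<Rightarrow> 'i \<Rightarrow> 'b" where
  "single T i a = (\<lambda>j\<in>T. if j = i then a else \<one>\<^bsub>A j\<^esub>)"

lemma pure_closed: "S \<in> P \<Longrightarrow> x \<in> carrier (G S) \<Longrightarrow> pure S x \<in> carrier \<A>"
  unfolding pure_def by (intro stage_linear(1) delta_closed)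

lemma pure_mult:
  assumes "S \<in> P" "x \<in> carrier (G S)" "y \<in> carrier (G S)"
  shows "pure S x \<otimes>\<^bsub>\<A>\<^esub> pure S y = pure S (x \<otimes>\<^bsub>G S\<^esub> y)"
  unfolding pure_def
  using stage_mult(1)[OF assms(1) delta_closed[OF assms(2)] delta_closed[OF assms(3)]]
  by (simp only: delta_mult)

lemma pure_fill:
  assumes "S \<subseteq> T" "T \<in> P" "x \<in> carrier (G S)"
  shows "pure T (fill S T x) = pure S x"
  unfolding pure_def using stage_fill[OF assms(1,2) delta_closed[OF assms(3)]]
  by (simp only: pushforward_delta)

lemma pure_one: "S \<in> P \<Longrightarrow> pure S (\<lambda>i\<in>S. \<one>\<^bsub>A i\<^esub>) = \<one>\<^bsub>\<A>\<^esub>"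
  using stage_mult(2) by (simp add: pure_def monoid_algebra_simps)

lemma single_closed:
  assumes "T \<subseteq> I" "i \<in> T \<Longrightarrow> a \<in> carrier (A i)"
  shows "single T i a \<in> carrier (G T)"
  using assms by (auto simp: single_def factor_closed subset_iff)

text \<open>The image of \<open>a\<close> can be computed at any stage that contains \<open>i\<close>.\<close>

lemma factor_emb_eq:
  assumes "T \<in> P" "i \<in> T" "a \<in> carrier (A i)"
  shows "factor_emb i a = pure T (single T i a)"
proof -
  have "fill {i} T (\<lambda>j\<in>{i}. a) = single T i a"
    using assms by (auto simp: fill_units_def single_def fun_eq_iff)
  then show ?thesis
    unfolding factor_emb_def using pure_fill[of "{i}" T "\<lambda>j\<in>{i}. a"] assms by simp
qed

text \<open>At the stage \<open>insert i S\<close>, in every position at least one of the two families has the entry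
\<open>1\<close>.\<close>

lemma factor_emb_commute:
  assumes S: "S \<in> P" and i: "i \<in> I" "i \<notin> S" and a: "a \<in> carrier (A i)" and u: "u \<in> carrier (F S)"
  shows "factor_emb i a \<otimes>\<^bsub>\<A>\<^esub> stage S u = stage S u \<otimes>\<^bsub>\<A>\<^esub> factor_emb i a"
proof -
  interpret Q: unital_algebra \<A> by (rule infinite_tensor_algebra)
  let ?T = "insert i S"
  have T: "?T \<in> P" using S i by auto
  have ia: "factor_emb i a \<in> carrier \<A>"
    using T a by (subst factor_emb_eq[of ?T]) (auto intro!: pure_closed single_closed)
  have d: "factor_emb i a \<otimes>\<^bsub>\<A>\<^esub> stage S (delta x) = stage S (delta x) \<otimes>\<^bsub>\<A>\<^esub> factor_emb i a"
    if x: "x \<in> carrier (G S)" for x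
  proof -
    have fx: "fill S ?T x \<in> carrier (G ?T)"
      using T x by (intro fill_closed) auto
    have sc: "single ?T i a \<in> carrier (G ?T)" using T a by (intro single_closed) auto
    have "single ?T i a \<otimes>\<^bsub>G ?T\<^esub> fill S ?T x = fill S ?T x \<otimes>\<^bsub>G ?T\<^esub> single ?T i a"
    proof
      fix j
      have "x j \<in> carrier (A j)" if "j \<in> S" using x that by (auto simp: PiE_iff)
      then show "(single ?T i a \<otimes>\<^bsub>G ?T\<^esub> fill S ?T x) j = (fill S ?T x \<otimes>\<^bsub>G ?T\<^esub> single ?T i a) j"
        using i a T by (auto simp: single_def fill_units_def factor_closed subset_iff)
    qed
    then have "pure ?T (single ?T i a) \<otimes>\<^bsub>\<A>\<^esub> pure ?T (fill S ?T x) =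
        pure ?T (fill S ?T x) \<otimes>\<^bsub>\<A>\<^esub> pure ?T (single ?T i a)"
      by (simp only: pure_mult[OF T sc fx] pure_mult[OF T fx sc])
    moreover have "pure ?T (fill S ?T x) = stage S (delta x)"
      using pure_fill[OF _ T x] by (auto simp: pure_def)
    moreover have "pure ?T (single ?T i a) = factor_emb i a"
      using factor_emb_eq[OF T _ a] by simp
    ultimately show ?thesis by simp
  qed
  have lr: "(\<lambda>u. factor_emb i a \<otimes>\<^bsub>\<A>\<^esub> stage S u) \<in> linear_maps (F S) \<A>"
    "(\<lambda>u. stage S u \<otimes>\<^bsub>\<A>\<^esub> factor_emb i a) \<in> linear_maps (F S) \<A>"
    using linear_maps_comp[OF algebra_mapsD(1)[OF stage_algebra_map[OF S]] Q.left_mult_linear[OF ia]]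
      linear_maps_comp[OF algebra_mapsD(1)[OF stage_algebra_map[OF S]] Q.right_mult_linear[OF ia]]
    by simp_all
  have "carrier (F S) \<subseteq> {u \<in> carrier (F S). factor_emb i a \<otimes>\<^bsub>\<A>\<^esub> stage S u = stage S u \<otimes>\<^bsub>\<A>\<^esub> factor_emb i a}"
    using d delta_closed[where G = "G S"]
    by (intro monoid_algebra_induct subspace_of_equalizer[OF F_vectorspace lr]) auto
  then show ?thesis using u by blast
qed

text \<open>Additivity and homogeneity are the multilinear relations in the only position \<open>i\<close> of the
stage \<open>{i}\<close>.\<close>

lemma factor_emb_algebra_map:
  assumes i: "i \<in> I"
  shows "factor_emb i \<in> algebra_maps (A i) \<A>"
proof -
  interpret Ai: unital_algebra "A i" by (rule factor[OF i])
  interpret Q: unital_algebra \<A> by (rule infinite_tensor_algebra)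
  let ?x = "\<lambda>a. (\<lambda>j\<in>{i}. a)"
  have S: "{i} \<in> P" "{i} \<subseteq> I" using i by auto
  have x: "?x a \<in> carrier (G {i})" if "a \<in> carrier (A i)" for a using that by auto
  have d: "delta (?x a) \<in> carrier (F {i})" if "a \<in> carrier (A i)" for a
    using x[OF that] by (rule delta_closed)
  have upd: "(?x a)(i := b) = ?x b" for a b by (auto simp: fun_eq_iff)
  have closed: "factor_emb i a \<in> carrier \<A>" if "a \<in> carrier (A i)" for a
    unfolding factor_emb_def using pure_closed[OF S(1) x[OF that]] .
  have add: "factor_emb i (a \<oplus>\<^bsub>A i\<^esub> b) = factor_emb i a \<oplus>\<^bsub>\<A>\<^esub> factor_emb i b"
    if ab: "a \<in> carrier (A i)" "b \<in> carrier (A i)" for a b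
  proof -
    let ?r = "add_relation A (?x a) i a b"
    have r: "?r \<in> K {i}"
      using relations_in_kernel[OF S(2)] relationI(1)[OF x[OF ab(1)] _ ab] by blast
    have rF: "?r \<in> carrier (F {i})" using r kernel_closed[OF S(2)] by blast
    have ds: "delta (?x a) \<oplus>\<^bsub>F {i}\<^esub> delta (?x b) \<in> carrier (F {i})"
      using vectorspaceD(2)[OF F_vectorspace] d ab by blast
    have "delta (?x (a \<oplus>\<^bsub>A i\<^esub> b)) = ?r \<oplus>\<^bsub>F {i}\<^esub> (delta (?x a) \<oplus>\<^bsub>F {i}\<^esub> delta (?x b))"
      by (rule ext) (simp only: add_relation_def monoid_algebra_simps(4) upd, simp)
    then have "stage {i} (delta (?x (a \<oplus>\<^bsub>A i\<^esub> b))) =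
        \<zero>\<^bsub>\<A>\<^esub> \<oplus>\<^bsub>\<A>\<^esub> (stage {i} (delta (?x a)) \<oplus>\<^bsub>\<A>\<^esub> stage {i} (delta (?x b)))"
      by (simp only: stage_linear(2)[OF S(1) rF ds] stage_linear(2)[OF S(1) d[OF ab(1)] d[OF ab(2)]]
        stage_kernel[OF S(1) r])
    then show ?thesis
      using closed[OF ab(1)] closed[OF ab(2)] by (simp add: factor_emb_def pure_def)
  qed
  have smult: "factor_emb i (c \<odot>\<^bsub>A i\<^esub> a) = c \<odot>\<^bsub>\<A>\<^esub> factor_emb i a"
    if a: "a \<in> carrier (A i)" for a c
  proof -
    let ?r = "smult_relation A (?x a) i c a"
    have r: "?r \<in> K {i}"
      using relations_in_kernel[OF S(2)] relationI(2)[OF x[OF a] _ a] by blast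
    have rF: "?r \<in> carrier (F {i})" using r kernel_closed[OF S(2)] by blast
    have ds: "c \<odot>\<^bsub>F {i}\<^esub> delta (?x a) \<in> carrier (F {i})"
      using vectorspaceD(3)[OF F_vectorspace] d a by blast
    have "delta (?x (c \<odot>\<^bsub>A i\<^esub> a)) = ?r \<oplus>\<^bsub>F {i}\<^esub> (c \<odot>\<^bsub>F {i}\<^esub> delta (?x a))"
      by (rule ext) (simp only: smult_relation_def monoid_algebra_simps(4,5) upd, simp)
    then have "stage {i} (delta (?x (c \<odot>\<^bsub>A i\<^esub> a))) = \<zero>\<^bsub>\<A>\<^esub> \<oplus>\<^bsub>\<A>\<^esub> (c \<odot>\<^bsub>\<A>\<^esub> stage {i} (delta (?x a)))"
      by (simp only: stage_linear(2)[OF S(1) rF ds] stage_linear(3)[OF S(1) d[OF a]] stage_kernel[OF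
        S(1) r])
    then show ?thesis
      using closed[OF a] vectorspaceD(3)[OF Q.vectorspace_axioms closed[OF a]]
        by (simp add: factor_emb_def pure_def)
  qed
  have zero: "factor_emb i \<zero>\<^bsub>A i\<^esub> = \<zero>\<^bsub>\<A>\<^esub>"
    using smult[of "\<one>\<^bsub>A i\<^esub>" 0] vectorspaceD(7)[OF Ai.vectorspace_axioms] vectorspaceD(7)[OF
      Q.vectorspace_axioms] closed
    by simp
  have mult: "factor_emb i (a \<otimes>\<^bsub>A i\<^esub> b) = factor_emb i a \<otimes>\<^bsub>\<A>\<^esub> factor_emb i b"
    if ab: "a \<in> carrier (A i)" "b \<in> carrier (A i)" for a b
  proof -
    have "?x a \<otimes>\<^bsub>G {i}\<^esub> ?x b = ?x (a \<otimes>\<^bsub>A i\<^esub> b)" by (auto simp: fun_eq_iff)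
    then show ?thesis
      unfolding factor_emb_def using pure_mult[OF S(1) x[OF ab(1)] x[OF ab(2)]] by simp
  qed
  have one: "factor_emb i \<one>\<^bsub>A i\<^esub> = \<one>\<^bsub>\<A>\<^esub>"
  proof -
    have "?x \<one>\<^bsub>A i\<^esub> = (\<lambda>j\<in>{i}. \<one>\<^bsub>A j\<^esub>)" by (auto simp: fun_eq_iff)
    then show ?thesis unfolding factor_emb_def using pure_one[OF S(1)] by simp
  qed
  show ?thesis
    by (intro algebra_mapsI linear_mapsI) (simp_all add: closed add smult zero mult one)
qed

text \<open>A pure tensor is the product of the images of its entries.\<close>

lemma pure_in_generated:
  assumes W: "\<one>\<^bsub>\<A>\<^esub> \<in> W" "\<And>x y. x \<in> W \<Longrightarrow> y \<in> W \<Longrightarrow> x \<otimes>\<^bsub>\<A>\<^esub> y \<in> W"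
    and gen: "\<And>i a. i \<in> I \<Longrightarrow> a \<in> carrier (A i) \<Longrightarrow> factor_emb i a \<in> W"
    and "S \<in> P" "x \<in> carrier (G S)"
  shows "pure S x \<in> W"
proof -
  have "finite S" "S \<subseteq> I" using assms(4) by auto
  then show ?thesis using assms(5)
  proof (induction S arbitrary: x)
    case empty
    then have "x = (\<lambda>i\<in>{}. \<one>\<^bsub>A i\<^esub>)" by auto
    then have "pure {} x = \<one>\<^bsub>\<A>\<^esub>" using pure_one[of "{}"] by (simp only:) simp
    then show ?case using W(1) by simp
  next
    case (insert i S)
    let ?T = "insert i S" let ?y = "restrict x S"
    have T: "?T \<in> P" using insert by auto
    have xi: "x i \<in> carrier (A i)" and y: "?y \<in> carrier (G S)"
      using insert.prems by (auto simp: PiE_iff)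
    have fy: "fill S ?T ?y \<in> carrier (G ?T)" using T y by (intro fill_closed) auto
    have sc: "single ?T i (x i) \<in> carrier (G ?T)" using T xi by (intro single_closed) auto
    have "x = fill S ?T ?y \<otimes>\<^bsub>G ?T\<^esub> single ?T i (x i)"
    proof
      fix j
      have "x j \<in> carrier (A j)" if "j \<in> ?T" using insert.prems that by (auto simp: PiE_iff)
      moreover have "x j = undefined" if "j \<notin> ?T" using insert.prems that
        by (auto simp: PiE_iff extensional_def)
      ultimately show "x j = (fill S ?T ?y \<otimes>\<^bsub>G ?T\<^esub> single ?T i (x i)) j"
        using T insert.hyps by (auto simp: single_def fill_units_def factor_closed subset_iff)
    qed
    then have "pure ?T x = pure ?T (fill S ?T ?y) \<otimes>\<^bsub>\<A>\<^esub> pure ?T (single ?T i (x i))"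
      by (simp only: pure_mult[OF T fy sc])
    also have "\<dots> = pure S ?y \<otimes>\<^bsub>\<A>\<^esub> factor_emb i (x i)"
      by (simp only: pure_fill[OF subset_insertI T y] factor_emb_eq[OF T insertI1 xi])
    finally have "pure ?T x = pure S ?y \<otimes>\<^bsub>\<A>\<^esub> factor_emb i (x i)" .
    moreover have "pure S ?y \<in> W" "factor_emb i (x i) \<in> W"
      using insert.IH[OF _ y] insert.prems(1) gen[OF _ xi] by blast+
    ultimately show ?case
      using W(2) by (simp only:)
  qed
qed

lemma generated_by_factors:
  assumes W: "subspace_of \<A> W" "\<one>\<^bsub>\<A>\<^esub> \<in> W" "\<And>x y. x \<in> W \<Longrightarrow> y \<in> W \<Longrightarrow> x \<otimes>\<^bsub>\<A>\<^esub> y \<in> W"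
    and gen: "\<And>i a. i \<in> I \<Longrightarrow> a \<in> carrier (A i) \<Longrightarrow> factor_emb i a \<in> W"
  shows "carrier \<A> \<subseteq> W"
proof
  fix q assume "q \<in> carrier \<A>"
  then obtain S u where S: "S \<in> P" and u: "u \<in> carrier (F S)" "q = stage S u"
    by (auto simp: carrier_infinite_tensor)
  have "carrier (F S) \<subseteq> {u \<in> carrier (F S). stage S u \<in> W}"
    using pure_in_generated[OF W(2,3) gen S] delta_closed[where G = "G S"]
    by (intro monoid_algebra_induct subspace_of_preimage[OF F_vectorspace
          algebra_mapsD(1)[OF stage_algebra_map[OF S]] W(1)]) (auto simp: pure_def)
  then show "q \<in> W" using u by blast
qed

text \<open>The product of the functionals \<open>\<mu> j\<close> is multilinear, so its linear extension vanishes on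
the kernel at every stage. At every stage it sends the image of \<open>a\<close> to \<open>\<mu> i a\<close>, because the units
in the other positions contribute the factor \<open>1\<close>.\<close>

lemma factor_emb_nonzero:
  fixes \<mu> :: "'i \<Rightarrow> 'b \<Rightarrow> 'k"
  assumes add: "\<And>j a b. j \<in> I \<Longrightarrow> a \<in> carrier (A j) \<Longrightarrow> b \<in> carrier (A j) \<Longrightarrow> \<mu> j (a \<oplus>\<^bsub>A j\<^esub> b) = \<mu> j a + \<mu> j b"
    and smult: "\<And>j a c. j \<in> I \<Longrightarrow> a \<in> carrier (A j) \<Longrightarrow> \<mu> j (c \<odot>\<^bsub>A j\<^esub> a) = c * \<mu> j a"
    and one: "\<And>j. j \<in> I \<Longrightarrow> j \<noteq> i \<Longrightarrow> \<mu> j \<one>\<^bsub>A j\<^esub> = 1"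
    and i: "i \<in> I" and a: "a \<in> carrier (A i)" "\<mu> i a \<noteq> 0"
  shows "factor_emb i a \<noteq> \<zero>\<^bsub>\<A>\<^esub>"
proof
  let ?x = "\<lambda>j\<in>{i}. a"
  assume "factor_emb i a = \<zero>\<^bsub>\<A>\<^esub>"
  then have z: "stage {i} (delta ?x) = \<zero>\<^bsub>\<A>\<^esub>" by (simp only: factor_emb_def pure_def)
  have S: "{i} \<in> P" using i by auto
  have d: "delta ?x \<in> carrier (F {i})" by (rule delta_closed) (use a in auto)
  obtain T where T: "T \<in> P" "{i} \<subseteq> T" and k: "pushforward (fill {i} T) (delta ?x) \<in> K T"
    by (rule stage_eq_zeroD[OF S d z])
  have TI: "T \<subseteq> I" "finite T" using T by auto
  (* the product functional at the stage where a becomes a combination of relations *)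
  let ?\<Lambda> = "\<lambda>x. \<Prod>j\<in>T. \<mu> j (x j)"
  have prod: "?\<Lambda> (x(l := b)) = \<mu> l b * (\<Prod>j\<in>T - {l}. \<mu> j (x j))" if "l \<in> T" for x l b
    using TI(2) that by (subst prod.remove[of _ l]) (auto intro!: prod.cong)
  have "K T \<subseteq> {u \<in> carrier (F T). pairing u ?\<Lambda> = 0}"
  proof (rule kernel_minimal[OF TI(1)])
    show "subspace_of (F T) {u \<in> carrier (F T). pairing u ?\<Lambda> = 0}"
      using vectorspaceD(1-3)[OF F_vectorspace[of T]]
      by (auto simp: subspace_of_def monoid_algebra_simps(3,4,5) pairing_scale
        monoid_algebra_simps(1) pairing_add)
    show "multilinear_relations A T \<subseteq> {u \<in> carrier (F T). pairing u ?\<Lambda> = 0}"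
    proof
      fix r assume r: "r \<in> multilinear_relations A T"
      have "pairing r ?\<Lambda> = 0"
        using r[unfolded multilinear_relations_eq]
      proof (elim UnE CollectE exE conjE)
        fix x l b c assume l: "l \<in> T" "b \<in> carrier (A l)" "c \<in> carrier (A l)"
          and r: "r = add_relation A x l b c"
        have "\<mu> l (b \<oplus>\<^bsub>A l\<^esub> c) = \<mu> l b + \<mu> l c" using l TI by (intro add) auto
        then show ?thesis unfolding r pairing_relation prod[OF l(1)] by (simp add: algebra_simps)
      next
        fix x l b c assume l: "l \<in> T" "b \<in> carrier (A l)" and r: "r = smult_relation A x l c b"
        have "\<mu> l (c \<odot>\<^bsub>A l\<^esub> b) = c * \<mu> l b" using l TI by (intro smult) auto
        then show ?thesis unfolding r pairing_relation prod[OF l(1)] by (simp add: algebra_simps)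
      qed
      then show "r \<in> {u \<in> carrier (F T). pairing u ?\<Lambda> = 0}"
        using r relations_closed[OF TI(1)] by blast
    qed
  qed
  then have "pairing (pushforward (fill {i} T) (delta ?x)) ?\<Lambda> = 0" using k by blast
  then have "?\<Lambda> (fill {i} T ?x) = 0" by (simp only: pushforward_delta pairing_delta)
  moreover have "fill {i} T ?x j = (if j = i then a else \<one>\<^bsub>A j\<^esub>)" if "j \<in> T" for j
    using that by (simp add: fill_units_def)
  then have "?\<Lambda> (fill {i} T ?x) = (\<Prod>j\<in>T. if j = i then \<mu> i a else 1)"
    using TI one by (intro prod.cong) auto
  ultimately show False using a(2) T TI(2) by simp
qed

end

section \<open>Derivations\<close>

context unital_algebra
begin

definition commutator :: "'a \<Rightarrow> 'a \<Rightarrow> 'a" where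
  "commutator a x = (a \<otimes> x) \<ominus> (x \<otimes> a)"

lemma commutator_closed [simp]: "a \<in> carrier A \<Longrightarrow> x \<in> carrier A \<Longrightarrow> commutator a x \<in> carrier A"
  by (simp add: commutator_def)

lemma commutator_smult_form:
  assumes "a \<in> carrier A" "x \<in> carrier A"
  shows "commutator a x = (a \<otimes> x) \<oplus> (-1) \<odot> (x \<otimes> a)"
  unfolding commutator_def using vectorspace_a_minus[OF vectorspace_axioms] assms by simp

lemma commutator_eq_zero_iff:
  assumes "a \<in> carrier A" "x \<in> carrier A"
  shows "commutator a x = \<zero> \<longleftrightarrow> a \<otimes> x = x \<otimes> a"
  unfolding commutator_def using assms by simp

lemma commutator_flip:
  assumes "a \<in> carrier A" "x \<in> carrier A"
  shows "commutator a x = \<zero> \<longleftrightarrow> commutator x a = \<zero>"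
  using assms by (auto simp: commutator_eq_zero_iff)

lemma commutator_derivation:
  assumes "a \<in> carrier A" "x \<in> carrier A" "y \<in> carrier A"
  shows "commutator a (x \<otimes> y) = (commutator a x \<otimes> y) \<oplus> (x \<otimes> commutator a y)"
proof -
  have "x \<otimes> a \<otimes> y \<in> carrier A" "a \<otimes> x \<otimes> y \<in> carrier A" "x \<otimes> y \<otimes> a \<in> carrier A"
    using assms by simp_all
  then show ?thesis
    using assms unfolding commutator_def
    by (simp add: module.M.minus_eq alg.l_distr alg.r_distr alg.l_minus alg.r_minus alg.m_assoc
        module.M.a_assoc module.M.r_neg2 module.M.r_neg1)
qed

lemma smult_swap: "x \<in> carrier A \<Longrightarrow> c \<odot> (d \<odot> x) = d \<odot> (c \<odot> x)"
  using vectorspaceD(9)[OF vectorspace_axioms, symmetric] by (simp add: mult.commute)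

lemma add_swap:
  assumes "u \<in> carrier A" "v \<in> carrier A" "w \<in> carrier A" "z \<in> carrier A"
  shows "(u \<oplus> v) \<oplus> (w \<oplus> z) = (u \<oplus> w) \<oplus> (v \<oplus> z)"
  using assms by (simp add: module.M.a_ac)

lemma smult_carrier [simp]: "x \<in> carrier A \<Longrightarrow> c \<odot> x \<in> carrier A"
  by (rule vectorspaceD(3)[OF vectorspace_axioms])

lemma smult_add: "x \<in> carrier A \<Longrightarrow> y \<in> carrier A \<Longrightarrow> c \<odot> (x \<oplus> y) = c \<odot> x \<oplus> c \<odot> y"
  by (rule vectorspaceD(11)[OF vectorspace_axioms])

lemma commutator_linear_right:
  assumes "a \<in> carrier A"
  shows "commutator a \<in> linear_maps A A"
proof (rule linear_mapsI)
  show "commutator a \<zero> = \<zero>" using assms by (simp add: commutator_eq_zero_iff)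
qed (use assms in \<open>simp_all add: commutator_smult_form alg.l_distr alg.r_distr smult_add add_swap
      smult_mult_left smult_mult_right smult_swap\<close>)

lemma commutator_linear_left:
  assumes "x \<in> carrier A"
  shows "(\<lambda>a. commutator a x) \<in> linear_maps A A"
proof (rule linear_mapsI)
  show "commutator \<zero> x = \<zero>" using assms by (simp add: commutator_eq_zero_iff)
qed (use assms in \<open>simp_all add: commutator_smult_form alg.l_distr alg.r_distr smult_add add_swap
      smult_mult_left smult_mult_right smult_swap\<close>)

lemma Der_iff:
  "d \<in> carrier (Der A) \<longleftrightarrow> d \<in> extensional (carrier A) \<and> d \<in> linear_maps A A \<and>
     (\<forall>x\<in>carrier A. \<forall>y\<in>carrier A. d (x \<otimes> y) = (d x \<otimes> y) \<oplus> (x \<otimes> d y))"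
proof -
  have "d \<zero> = \<zero>" if "d \<in> LinearCombinations.module_hom class_ring A A"
  proof -
    have "d (0 \<odot> \<zero>) = 0 \<odot> d \<zero>" "d \<zero> \<in> carrier A"
      using LinearCombinations.module_hom_smult[OF that, of 0 "\<zero>"]
        funcset_mem[OF LinearCombinations.module_hom_closed[OF that], of "\<zero>"] by simp_all
    then show ?thesis
      using vectorspaceD(7)[OF vectorspace_axioms, of "\<zero>"] vectorspaceD(7)[OF vectorspace_axioms, of
        "d \<zero>"] by simp
  qed
  then show ?thesis by (auto simp: Der_def linear_maps_def)
qed

lemma Der_D:
  assumes "d \<in> carrier (Der A)"
  shows "x \<in> carrier A \<Longrightarrow> d x \<in> carrier A"
    and "x \<notin> carrier A \<Longrightarrow> d x = undefined"
    and "x \<in> carrier A \<Longrightarrow> y \<in> carrier A \<Longrightarrow> d (x \<oplus> y) = d x \<oplus> d y"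
    and "x \<in> carrier A \<Longrightarrow> d (c \<odot> x) = c \<odot> d x"
    and "x \<in> carrier A \<Longrightarrow> y \<in> carrier A \<Longrightarrow> d (x \<otimes> y) = (d x \<otimes> y) \<oplus> (x \<otimes> d y)"
    and "d \<in> linear_maps A A"
  using assms linear_mapsD[of d A A] by (auto simp: Der_iff extensional_def)

lemma Der_I:
  assumes "\<And>x. x \<in> carrier A \<Longrightarrow> d x \<in> carrier A"
    and "\<And>x. x \<notin> carrier A \<Longrightarrow> d x = undefined"
    and "\<And>x y. x \<in> carrier A \<Longrightarrow> y \<in> carrier A \<Longrightarrow> d (x \<oplus> y) = d x \<oplus> d y"
    and "\<And>c x. x \<in> carrier A \<Longrightarrow> d (c \<odot> x) = c \<odot> d x"
    and "\<And>x y. x \<in> carrier A \<Longrightarrow> y \<in> carrier A \<Longrightarrow> d (x \<otimes> y) = (d x \<otimes> y) \<oplus> (x \<otimes> d y)"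
  shows "d \<in> carrier (Der A)"
  using assms by (auto simp: Der_def LinearCombinations.module_hom_def extensional_def)

lemma Der_ops:
  "\<zero>\<^bsub>Der A\<^esub> = (\<lambda>x\<in>carrier A. \<zero>)"
  "d \<oplus>\<^bsub>Der A\<^esub> e = (\<lambda>x\<in>carrier A. d x \<oplus> e x)"
  "c \<odot>\<^bsub>Der A\<^esub> d = (\<lambda>x\<in>carrier A. c \<odot> d x)"
  by (simp_all add: Der_def)

text \<open>The operations are pointwise, so the laws hold pointwise; extensionality of derivations
makes this an equality of functions.\<close>

lemma Der_vectorspace: "vectorspace class_ring (Der A)"
proof (rule vectorspaceI)
  note V = vectorspaceD[OF vectorspace_axioms]
  show "\<zero>\<^bsub>Der A\<^esub> \<in> carrier (Der A)"
    by (rule Der_I) (simp_all add: Der_ops)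
  show "d \<oplus>\<^bsub>Der A\<^esub> e \<in> carrier (Der A)" if d: "d \<in> carrier (Der A)" "e \<in> carrier (Der A)" for d e
    using Der_D[OF d(1)] Der_D[OF d(2)]
    by (intro Der_I) (simp_all add: Der_ops add_swap smult_add alg.l_distr alg.r_distr)
  show "c \<odot>\<^bsub>Der A\<^esub> d \<in> carrier (Der A)" if d: "d \<in> carrier (Der A)" for c d
    using Der_D[OF d]
    by (intro Der_I) (simp_all add: Der_ops smult_add smult_swap smult_mult_left smult_mult_right)
  fix d e g assume deg: "d \<in> carrier (Der A)" "e \<in> carrier (Der A)" "g \<in> carrier (Der A)"
  show "d \<oplus>\<^bsub>Der A\<^esub> e = e \<oplus>\<^bsub>Der A\<^esub> d"
    unfolding Der_ops by (rule restrict_ext) (simp add: Der_D(1) deg V(4))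
  show "d \<oplus>\<^bsub>Der A\<^esub> e \<oplus>\<^bsub>Der A\<^esub> g = d \<oplus>\<^bsub>Der A\<^esub> (e \<oplus>\<^bsub>Der A\<^esub> g)"
    unfolding Der_ops by (rule restrict_ext) (simp add: Der_D(1) deg module.M.a_assoc)
next
  note V = vectorspaceD[OF vectorspace_axioms]
  fix a b :: 'k and d e assume d: "d \<in> carrier (Der A)"
  note D = Der_D(1,2)[OF d]
  show "d \<oplus>\<^bsub>Der A\<^esub> \<zero>\<^bsub>Der A\<^esub> = d" "1 \<odot>\<^bsub>Der A\<^esub> d = d"
    "0 \<odot>\<^bsub>Der A\<^esub> d = \<zero>\<^bsub>Der A\<^esub>"
    "(a * b) \<odot>\<^bsub>Der A\<^esub> d = a \<odot>\<^bsub>Der A\<^esub> (b \<odot>\<^bsub>Der A\<^esub> d)"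
    "(a + b) \<odot>\<^bsub>Der A\<^esub> d = a \<odot>\<^bsub>Der A\<^esub> d \<oplus>\<^bsub>Der A\<^esub> b \<odot>\<^bsub>Der A\<^esub> d"
    by (auto simp: Der_ops fun_eq_iff D V(6-10))
  assume e: "e \<in> carrier (Der A)"
  show "a \<odot>\<^bsub>Der A\<^esub> (d \<oplus>\<^bsub>Der A\<^esub> e) = a \<odot>\<^bsub>Der A\<^esub> d \<oplus>\<^bsub>Der A\<^esub> a \<odot>\<^bsub>Der A\<^esub> e"
    using Der_D(1)[OF e] by (auto simp: Der_ops fun_eq_iff D smult_add)
qed

lemma Inder_eq: "Inder A = (\<lambda>a. \<lambda>x\<in>carrier A. commutator a x) ` carrier A"
  by (simp add: Inder_def commutator_def)

lemma commutator_in_Der: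
  assumes "a \<in> carrier A"
  shows "(\<lambda>x\<in>carrier A. commutator a x) \<in> carrier (Der A)"
  using linear_mapsD[OF commutator_linear_right[OF assms]] assms
  by (intro Der_I) (simp_all add: commutator_derivation)

lemma Inder_subspace: "subspace_of (Der A) (Inder A)"
  unfolding subspace_of_def
proof (intro conjI ballI allI)
  note L = linear_mapsD[OF commutator_linear_left]
  show "Inder A \<subseteq> carrier (Der A)" unfolding Inder_eq using commutator_in_Der by blast
  have "\<zero>\<^bsub>Der A\<^esub> = (\<lambda>x\<in>carrier A. commutator \<zero> x)"
    unfolding Der_ops by (rule restrict_ext) (simp add: L)
  then show "\<zero>\<^bsub>Der A\<^esub> \<in> Inder A" unfolding Inder_eq by auto
  fix d assume "d \<in> Inder A"
  then obtain a where a: "a \<in> carrier A" "d = (\<lambda>x\<in>carrier A. commutator a x)" unfolding Inder_eq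
    by blast
  have "c \<odot>\<^bsub>Der A\<^esub> d = (\<lambda>x\<in>carrier A. commutator (c \<odot> a) x)" for c
    unfolding Der_ops by (rule restrict_ext) (simp add: L a)
  then show "c \<odot>\<^bsub>Der A\<^esub> d \<in> Inder A" for c unfolding Inder_eq using a by auto
  fix e assume "e \<in> Inder A"
  then obtain b where b: "b \<in> carrier A" "e = (\<lambda>x\<in>carrier A. commutator b x)" unfolding Inder_eq
    by blast
  have "d \<oplus>\<^bsub>Der A\<^esub> e = (\<lambda>x\<in>carrier A. commutator (a \<oplus> b) x)"
    unfolding Der_ops by (rule restrict_ext) (simp add: L a b)
  then show "d \<oplus>\<^bsub>Der A\<^esub> e \<in> Inder A" unfolding Inder_eq using a b by auto
qed

lemma Outder_quotient: "quotient_space (Der A) (Inder A)"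
  by (intro quotient_space.intro quotient_space_axioms.intro Der_vectorspace Inder_subspace)

end

text \<open>Since almost all \<open>e i\<close> commute with a given \<open>x\<close>, the infinite sum of the commutators \<open>c i
[e i, x]\<close> has only finitely many nonzero terms.\<close>

locale almost_central_family = unital_algebra A for A :: "('k::field, 'a) module" (structure) +
  fixes e :: "'i \<Rightarrow> 'a" and I :: "'i set"
  assumes e_closed: "i \<in> I \<Longrightarrow> e i \<in> carrier A"
    and finite_noncommuting: "x \<in> carrier A \<Longrightarrow> finite {i \<in> I. commutator (e i) x \<noteq> \<zero>}"
begin

definition noncommuting :: "'a \<Rightarrow> 'i set" where
  "noncommuting x = {i \<in> I. commutator (e i) x \<noteq> \<zero>}"

definition combination :: "'i set \<Rightarrow> ('i \<Rightarrow> 'k) \<Rightarrow> 'a" where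
  "combination T c = (\<Oplus>i\<in>T. c i \<odot> e i)"

text \<open>The finite part of the formal sum of the \<open>c i e i\<close> that is used depends on \<open>x\<close>. Any larger
finite part gives the same value, so finitely many arguments can be treated with a common one,
where the map agrees with an inner derivation.\<close>

definition sum_derivation :: "('i \<Rightarrow> 'k) \<Rightarrow> 'a \<Rightarrow> 'a" where
  "sum_derivation c = (\<lambda>x\<in>carrier A. commutator (combination (noncommuting x) c) x)"

lemma combination_closed: "T \<subseteq> I \<Longrightarrow> combination T c \<in> carrier A"
  unfolding combination_def by (rule module.M.finsum_closed) (use e_closed in auto)

lemma combination_insert:
  assumes "finite T" "i \<notin> T" "insert i T \<subseteq> I"
  shows "combination (insert i T) c = c i \<odot> e i \<oplus> combination T c"
  unfolding combination_def using assms e_closed by (subst module.M.finsum_insert) auto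

lemma combination_add:
  "finite T \<Longrightarrow> T \<subseteq> I \<Longrightarrow> combination T (\<lambda>i. c i + d i) = combination T c \<oplus> combination T d"
proof (induction T rule: finite_induct)
  case empty
  then show ?case by (simp add: combination_def)
next
  case (insert i T)
  then show ?case
    using e_closed by (simp add: combination_insert combination_closed vectorspaceD(10)[OF
      vectorspace_axioms] add_swap)
qed

lemma combination_smult:
  "finite T \<Longrightarrow> T \<subseteq> I \<Longrightarrow> combination T (\<lambda>i. b * c i) = b \<odot> combination T c"
proof (induction T rule: finite_induct)
  case empty
  then show ?case by (simp add: combination_def)
next
  case (insert i T)
  then show ?case
    using e_closed by (simp add: combination_insert combination_closed vectorspaceD(9)[OF
      vectorspace_axioms] smult_add)
qed

text \<open>The additional summands commute with \<open>x\<close>.\<close>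

lemma commutator_combination_mono:
  assumes T: "finite T" "T \<subseteq> I" and x: "x \<in> carrier A" "noncommuting x \<subseteq> T"
  shows "commutator (combination T c) x = commutator (combination (noncommuting x) c) x"
proof -
  note L = linear_mapsD[OF commutator_linear_left[OF x(1)]]
  have "finite U \<Longrightarrow> U \<subseteq> I \<Longrightarrow> U \<inter> noncommuting x = {} \<Longrightarrow>
    commutator (combination (U \<union> noncommuting x) c) x = commutator (combination (noncommuting x) c)
      x" for U
  proof (induction U rule: finite_induct)
    case (insert i U)
    have i: "commutator (e i) x = \<zero>" using insert.prems by (auto simp: noncommuting_def)
    have sub: "noncommuting x \<subseteq> I" "finite (noncommuting x)"
      using finite_noncommuting[OF x(1)] by (auto simp: noncommuting_def)
    have "combination (insert i U \<union> noncommuting x) c = c i \<odot> e i \<oplus> combination (U \<union> noncommuting x) c"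
      using insert sub by (simp add: combination_insert)
    then show ?case
      using insert sub e_closed i combination_closed[of "U \<union> noncommuting x" c]
      by (simp add: L) (simp add: combination_closed vectorspaceD(7)[OF vectorspace_axioms] x)
  qed simp
  from this[of "T - noncommuting x"] show ?thesis using T x(2) by (auto simp: Un_absorb2)
qed

lemma sum_derivation_eq:
  assumes "finite T" "T \<subseteq> I" "x \<in> carrier A" "noncommuting x \<subseteq> T"
  shows "sum_derivation c x = commutator (combination T c) x"
  using commutator_combination_mono[OF assms] assms(3) by (simp add: sum_derivation_def)

lemma finite_support: "x \<in> carrier A \<Longrightarrow> finite (noncommuting x)" "noncommuting x \<subseteq> I"
  using finite_noncommuting by (auto simp: noncommuting_def)

lemma sum_derivation_in_Der: "sum_derivation c \<in> carrier (Der A)"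
proof (rule Der_I)
  fix x y assume xy: "x \<in> carrier A" "y \<in> carrier A"
  (* a common finite part of the sum for all arguments that occur in the two laws *)
  let ?T = "noncommuting x \<union> noncommuting y \<union> noncommuting (x \<oplus> y) \<union> noncommuting (x \<otimes> y)"
  have T: "finite ?T" "?T \<subseteq> I"
    using finite_support xy by simp_all
  have w: "combination ?T c \<in> carrier A" by (rule combination_closed[OF T(2)])
  have eq: "sum_derivation c z = commutator (combination ?T c) z"
    if "z \<in> carrier A" "noncommuting z \<subseteq> ?T" for z
    using sum_derivation_eq[OF T that] .
  have "sum_derivation c x = commutator (combination ?T c) x" "sum_derivation c y
    = commutator (combination ?T c) y"
    "sum_derivation c (x \<oplus> y) = commutator (combination ?T c) (x \<oplus> y)"
    "sum_derivation c (x \<otimes> y) = commutator (combination ?T c) (x \<otimes> y)"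
    by (rule eq; use xy in auto)+
  then show "sum_derivation c (x \<oplus> y) = sum_derivation c x \<oplus> sum_derivation c y"
    and "sum_derivation c (x \<otimes> y) = (sum_derivation c x \<otimes> y) \<oplus> (x \<otimes> sum_derivation c y)"
    using linear_mapsD(2)[OF commutator_linear_right[OF w] xy] commutator_derivation[OF w xy]
      by simp_all
next
  fix b x assume x: "x \<in> carrier A"
  let ?T = "noncommuting x \<union> noncommuting (b \<odot> x)"
  have T: "finite ?T" "?T \<subseteq> I"
    using finite_support x by simp_all
  have w: "combination ?T c \<in> carrier A" by (rule combination_closed[OF T(2)])
  have "sum_derivation c x = commutator (combination ?T c) x"
    "sum_derivation c (b \<odot> x) = commutator (combination ?T c) (b \<odot> x)"
    by (rule sum_derivation_eq[OF T]; use x in auto)+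
  then show "sum_derivation c (b \<odot> x) = b \<odot> sum_derivation c x"
    using linear_mapsD(3)[OF commutator_linear_right[OF w] x] by simp
next
  fix x assume "x \<in> carrier A"
  then show "sum_derivation c x \<in> carrier A"
    unfolding sum_derivation_def using combination_closed finite_support(2) by simp
qed (simp add: sum_derivation_def)

lemma sum_derivation_add:
  "sum_derivation (\<lambda>i. c i + d i) = sum_derivation c \<oplus>\<^bsub>Der A\<^esub> sum_derivation d"
proof
  fix x
  show "sum_derivation (\<lambda>i. c i + d i) x = (sum_derivation c \<oplus>\<^bsub>Der A\<^esub> sum_derivation d) x"
    using linear_mapsD(2)[OF commutator_linear_left] combination_closed finite_support
    by (cases "x \<in> carrier A") (simp_all add: sum_derivation_def Der_ops combination_add)
qed

lemma sum_derivation_smult: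
  "sum_derivation (\<lambda>i. b * c i) = b \<odot>\<^bsub>Der A\<^esub> sum_derivation c"
proof
  fix x
  show "sum_derivation (\<lambda>i. b * c i) x = (b \<odot>\<^bsub>Der A\<^esub> sum_derivation c) x"
    using linear_mapsD(3)[OF commutator_linear_left] combination_closed finite_support
    by (cases "x \<in> carrier A") (simp_all add: sum_derivation_def Der_ops combination_smult)
qed

text \<open>On \<open>f i\<close>, only the summand of index \<open>i\<close> contributes, so the derivation takes the value \<open>c i
[e i, f i]\<close> there. If it is the commutator with \<open>a\<close>, then this vanishes for almost all \<open>i\<close>, as
\<open>a\<close> commutes with almost all \<open>f i\<close>.\<close>

lemma inner_sum_derivation_finite:
  assumes f: "\<And>i. i \<in> I \<Longrightarrow> f i \<in> carrier A"
    "\<And>x. x \<in> carrier A \<Longrightarrow> finite {i \<in> I. commutator (f i) x \<noteq> \<zero>}"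
    and ef: "\<And>i j. i \<in> I \<Longrightarrow> j \<in> I \<Longrightarrow> i \<noteq> j \<Longrightarrow> commutator (e j) (f i) = \<zero>"
    "\<And>i. i \<in> I \<Longrightarrow> commutator (e i) (f i) \<noteq> \<zero>"
    and inner: "sum_derivation c \<in> Inder A"
  shows "finite {i \<in> I. c i \<noteq> 0}"
proof -
  obtain a where a: "a \<in> carrier A" and D: "sum_derivation c = (\<lambda>x\<in>carrier A. commutator a x)"
    using inner unfolding Inder_eq by blast
  have "commutator (f i) a \<noteq> \<zero>" if i: "i \<in> I" "c i \<noteq> 0" for i
  proof
    assume "commutator (f i) a = \<zero>"
    then have "sum_derivation c (f i) = \<zero>"
      using D a f(1)[OF i(1)] commutator_flip by simp
    moreover have "noncommuting (f i) \<subseteq> {i}"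
      using ef(1) i by (auto simp: noncommuting_def)
    ultimately have "commutator (c i \<odot> e i \<oplus> combination {} c) (f i) = \<zero>"
      using sum_derivation_eq[of "{i}" "f i" c] i f(1) combination_insert[of "{}" i c] by simp
    then have "c i \<odot> commutator (e i) (f i) = \<zero>"
      using linear_mapsD(3)[OF commutator_linear_left[OF f(1)[OF i(1)]] e_closed[OF i(1)]]
        e_closed[OF i(1)]
      by (simp add: combination_def)
    then have "inverse (c i) \<odot> (c i \<odot> commutator (e i) (f i)) = inverse (c i) \<odot> (0 \<odot> \<zero>)"
      using vectorspaceD(7)[OF vectorspace_axioms, of "\<zero>"] by simp
    then have "commutator (e i) (f i) = \<zero>"
      using i e_closed f(1) vectorspaceD(7,8)[OF vectorspace_axioms]
      by (simp add: vectorspaceD(9)[OF vectorspace_axioms, symmetric])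
    then show False using ef(2) i by simp
  qed
  then have "{i \<in> I. c i \<noteq> 0} \<subseteq> {i \<in> I. commutator (f i) a \<noteq> \<zero>}" by blast
  then show ?thesis using f(2)[OF a] finite_subset by blast
qed

end

section \<open>Cardinalities and independent families\<close>

text \<open>Dedekind's independence of characters for the free monoid of words over \<open>I\<close>. If \<open>f\<close> and \<open>g\<close>
differ at \<open>i\<close>, the relation at \<open>i # w\<close> minus \<open>g i\<close> times the relation at \<open>w\<close> no longer involves
\<open>g\<close> and still has a nonzero multiple of \<open>a f\<close> as its coefficient at \<open>f\<close>.\<close>

lemma characters_independent:
  fixes a :: "('i \<Rightarrow> 'k::field) \<Rightarrow> 'k"
  assumes "finite X" "X \<subseteq> Func I UNIV"
    and "\<And>w. w \<in> lists I \<Longrightarrow> (\<Sum>f\<in>X. a f * prod_list (map f w)) = 0"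
  shows "\<forall>f\<in>X. a f = 0"
  using assms
proof (induction X arbitrary: a rule: finite_induct)
  case (insert g X)
  have "a f = 0" if f: "f \<in> X" for f
  proof -
    have "\<exists>i\<in>I. f i \<noteq> g i"
    proof (rule ccontr)
      assume "\<not> (\<exists>i\<in>I. f i \<noteq> g i)"
      moreover have "f \<in> Func I UNIV" "g \<in> Func I UNIV" using f insert.prems by auto
      ultimately have "f = g" by (force simp: Func_def fun_eq_iff)
      then show False using f insert.hyps by simp
    qed
    then obtain i where i: "i \<in> I" "f i \<noteq> g i" by blast
    (* the coefficient at g becomes zero, so the sum is over X only *)
    have "(\<Sum>h\<in>X. (a h * (h i - g i)) * prod_list (map h w)) = 0" if w: "w \<in> lists I" for w
    proof -
      have "(\<Sum>h\<in>insert g X. (a h * (h i - g i)) * prod_list (map h w)) =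
          (\<Sum>h\<in>insert g X. a h * prod_list (map h (i # w))) - g i * (\<Sum>h\<in>insert g X. a h * prod_list
            (map h w))"
        by (simp add: sum_distrib_left sum_subtractf[symmetric] algebra_simps del: sum.insert)
      also have "\<dots> = 0"
        using insert.prems(2)[of "i # w"] insert.prems(2)[OF w] i(1) w by simp
      finally show ?thesis using insert.hyps by simp
    qed
    then have "\<forall>h\<in>X. a h * (h i - g i) = 0"
      using insert.prems(1) by (intro insert.IH) auto
    then show ?thesis using f i by auto
  qed
  moreover have "a g = 0"
    using insert.prems(2)[of "[]"] insert.hyps calculation by simp
  ultimately show ?case by simp
qed simp

text \<open>The words over an infinite set can be listed along that set so that each of them occurs
infinitely often.\<close>

lemma ex_repetition_bij:
  assumes "infinite I"
  shows "\<exists>\<beta>. bij_betw \<beta> I (lists I \<times> (UNIV :: nat set))"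
proof -
  have inf: "infinite (lists I)"
    using card_of_ordLeq_infinite[OF card_of_lists assms] .
  have "|lists I \<times> (UNIV :: nat set)| =o |lists I|"
    using card_of_Times_infinite[OF inf, of "UNIV :: nat set"] inf
      by (simp add: infinite_iff_card_of_nat)
  also have "|lists I| =o |I|" using assms by (rule card_of_lists_infinite)
  finally have "|I| =o |lists I \<times> (UNIV :: nat set)|" by (rule ordIso_symmetric)
  then show ?thesis using card_of_ordIso by blast
qed

text \<open>With every value of a character repeated infinitely often, a combination of characters that
has finite support must vanish.\<close>

lemma ex_independent_sequences:
  assumes I: "infinite I"
  obtains u :: "('i \<Rightarrow> 'k::field) \<Rightarrow> 'i \<Rightarrow> 'k" where
    "\<And>X a. finite X \<Longrightarrow> X \<subseteq> Func I UNIV \<Longrightarrow> finite {i \<in> I. (\<Sum>f\<in>X. a f * u f i) \<noteq> 0} \<Longrightarrow> \<forall>f\<in>X. a f = 0"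
proof -
  obtain \<beta> where \<beta>: "bij_betw \<beta> I (lists I \<times> (UNIV :: nat set))"
    using ex_repetition_bij[OF I] by blast
  define u where "u = (\<lambda>(f :: 'i \<Rightarrow> 'k) i. prod_list (map f (fst (\<beta> i))))"
  have "\<forall>f\<in>X. a f = 0"
    if X: "finite X" "X \<subseteq> Func I UNIV" and fin: "finite {i \<in> I. (\<Sum>f\<in>X. a f * u f i) \<noteq> 0}" for X a
  proof (rule characters_independent[OF X])
    fix w assume w: "w \<in> lists I"
    (* the infinitely many places where the value at w occurs cannot all be in the finite support *)
    let ?N = "{i \<in> I. fst (\<beta> i) = w}"
    have "\<beta> ` ?N = {w} \<times> UNIV"
    proof
      show "{w} \<times> UNIV \<subseteq> \<beta> ` ?N"
      proof
        fix p assume "p \<in> {w} \<times> (UNIV :: nat set)"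
        then have "p \<in> \<beta> ` I" "fst p = w" using w bij_betw_imp_surj_on[OF \<beta>] by auto
        then show "p \<in> \<beta> ` ?N" by auto
      qed
      show "\<beta> ` ?N \<subseteq> {w} \<times> UNIV"
        by (intro image_subsetI) (simp add: mem_Times_iff)
    qed
    moreover have "infinite ({w} \<times> (UNIV :: nat set))"
      by (simp add: finite_cartesian_product_iff)
    ultimately have "infinite (\<beta> ` ?N)" by (simp only: not_False_eq_True)
    then have "infinite ?N" using finite_imageI[of ?N \<beta>] by blast
    then have "\<not> ?N \<subseteq> {i \<in> I. (\<Sum>f\<in>X. a f * u f i) \<noteq> 0}" using fin finite_subset by blast
    then show "(\<Sum>f\<in>X. a f * prod_list (map f w)) = 0" by (auto simp: u_def)
  qed
  then show thesis using that by blast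
qed

lemma index_le_cexp: "|I| \<le>o |Func I (UNIV :: 'k::field set)|"
proof -
  have "|I| \<le>o |UNIV :: 'k set| ^c |I|"
  proof (rule ordLeq_cexp2)
    have "inj_on (\<lambda>b::bool. of_bool b :: 'k) UNIV" by (auto simp: inj_on_def)
    then show "ctwo \<le>o |UNIV :: 'k set|"
      unfolding ctwo_def card_of_ordLeq[symmetric] by blast
  qed simp
  then show ?thesis by (simp add: cexp_def Field_card_of)
qed

lemma infinite_cexp:
  assumes "infinite I"
  shows "infinite (Func I (UNIV :: 'k::field set))"
  using index_le_cexp assms card_of_ordLeq_infinite by blast

text \<open>A linear image of the function space on \<open>I\<close> in which only finitely supported functions
become zero has the full dimension: the images of the functions from \<open>ex_independent_sequences\<close>
stay independent.\<close>

lemma cexp_le_vdim: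
  fixes V :: "('k::field, 'v) module" and \<tau> :: "('i \<Rightarrow> 'k) \<Rightarrow> 'v"
  assumes V: "vectorspace class_ring V" and I: "infinite I"
    and closed: "\<And>c. \<tau> c \<in> carrier V"
    and add: "\<And>c d. \<tau> (\<lambda>i. c i + d i) = \<tau> c \<oplus>\<^bsub>V\<^esub> \<tau> d"
    and smult: "\<And>b c. \<tau> (\<lambda>i. b * c i) = b \<odot>\<^bsub>V\<^esub> \<tau> c"
    and kernel: "\<And>c. \<tau> c = \<zero>\<^bsub>V\<^esub> \<Longrightarrow> finite {i \<in> I. c i \<noteq> 0}"
  shows "|UNIV :: 'k set| ^c |I| \<le>o vdim V"
proof -
  interpret vectorspace class_ring V by fact
  obtain u :: "('i \<Rightarrow> 'k) \<Rightarrow> 'i \<Rightarrow> 'k" where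
    u: "\<And>X a. finite X \<Longrightarrow> X \<subseteq> Func I UNIV \<Longrightarrow> finite {i \<in> I. (\<Sum>f\<in>X. a f * u f i) \<noteq> 0} \<Longrightarrow> \<forall>f\<in>X. a f = 0"
    using ex_independent_sequences[OF I] by blast
  let ?F = "Func I (UNIV :: 'k set)" and ?t = "\<lambda>f. \<tau> (u f)"
  have zero: "\<tau> (\<lambda>i. 0) = \<zero>\<^bsub>V\<^esub>"
    using smult[of 0 "\<lambda>i. 0"] vectorspaceD(7)[OF V closed, of "\<lambda>i. 0"] by simp
  have inj: "inj_on ?t ?F"
  proof (rule inj_onI, rule ccontr)
    fix f g assume fg: "f \<in> ?F" "g \<in> ?F" "?t f = ?t g" "f \<noteq> g"
    (* f and g with the same image would be related by the coefficients 1 and -1 *)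
    define a :: "('i \<Rightarrow> 'k) \<Rightarrow> 'k" where "a h = (if h = f then 1 else -1)" for h
    have "\<tau> (\<lambda>i. u f i + -1 * u g i) = ?t f \<oplus>\<^bsub>V\<^esub> (-1) \<odot>\<^bsub>V\<^esub> ?t g"
      by (simp only: add smult)
    also have "\<dots> = 1 \<odot>\<^bsub>V\<^esub> ?t g \<oplus>\<^bsub>V\<^esub> (-1) \<odot>\<^bsub>V\<^esub> ?t g"
      using fg(3) vectorspaceD(8)[OF V closed] by simp
    also have "\<dots> = \<zero>\<^bsub>V\<^esub>"
      using vectorspaceD(10)[OF V closed[of "u g"], of 1 "-1"] vectorspaceD(7)[OF V closed] by simp
    finally have "finite {i \<in> I. u f i + -1 * u g i \<noteq> 0}" by (rule kernel)
    moreover have "(\<Sum>h\<in>{f, g}. a h * u h i) = u f i + -1 * u g i" for i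
      using fg(4) by (simp add: a_def)
    ultimately have "finite {i \<in> I. (\<Sum>h\<in>{f, g}. a h * u h i) \<noteq> 0}" by simp
    then have "\<forall>h\<in>{f, g}. a h = 0" using fg by (intro u) auto
    then show False by (simp add: a_def)
  qed
  let ?L = "?t ` ?F" and ?s = "inv_into ?F ?t"
  have comb: "lincomb a A = \<tau> (\<lambda>i. \<Sum>l\<in>A. a l * u (?s l) i)" if "finite A" "A \<subseteq> ?L" for a A
    using that
  proof (induction A rule: finite_induct)
    case empty
    then show ?case by (simp add: zero lincomb_def)
  next
    case (insert l A)
    have l: "\<tau> (u (?s l)) = l" using insert.prems f_inv_into_f[of l ?t ?F] by simp
    have "lincomb a (A \<union> {l}) = a l \<odot>\<^bsub>V\<^esub> l \<oplus>\<^bsub>V\<^esub> lincomb a A"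
      by (rule lincomb_insert) (use insert closed in auto)
    also have "\<dots> = \<tau> (\<lambda>i. a l * u (?s l) i) \<oplus>\<^bsub>V\<^esub> \<tau> (\<lambda>i. \<Sum>l\<in>A. a l * u (?s l) i)"
      using insert l by (simp only: smult) simp
    also have "\<dots> = \<tau> (\<lambda>i. \<Sum>l\<in>insert l A. a l * u (?s l) i)"
      by (simp only: add[symmetric] sum.insert[OF insert.hyps])
    finally show ?case by simp
  qed
  have "lin_indpt ?L"
  proof (rule notI)
    assume "lin_dep ?L"
    then obtain A a v where A: "finite A" "A \<subseteq> ?L" "lincomb a A = \<zero>\<^bsub>V\<^esub>" "v \<in> A" "a v \<noteq> 0"
      unfolding lin_dep_def by (auto simp: class_ring_simps)
    have injs: "inj_on ?s A" using inj_on_inv_into[of A ?t ?F] A(2) by blast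
    have "\<tau> (\<lambda>i. \<Sum>l\<in>A. a l * u (?s l) i) = \<zero>\<^bsub>V\<^esub>" using comb[OF A(1,2), of a] A(3) by simp
    then have "finite {i \<in> I. (\<Sum>l\<in>A. a l * u (?s l) i) \<noteq> 0}" by (rule kernel)
    moreover have "(\<Sum>l\<in>A. a l * u (?s l) i) = (\<Sum>f\<in>?s ` A. a (?t f) * u f i)" for i
      using A(2) f_inv_into_f[of _ ?t ?F] by (subst sum.reindex[OF injs]) (auto intro!: sum.cong)
    ultimately have "finite {i \<in> I. (\<Sum>f\<in>?s ` A. a (?t f) * u f i) \<noteq> 0}" by simp
    moreover have "?s ` A \<subseteq> ?F" using A(2) inv_into_into[of _ ?t ?F] by blast
    ultimately have "\<forall>f\<in>?s ` A. a (?t f) = 0" using A(1) by (intro u) auto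
    then have "a (?t (?s v)) = 0" using A(4) by blast
    moreover have "?t (?s v) = v" using A(2,4) f_inv_into_f[of v ?t ?F] by blast
    ultimately show False using A(5) by simp
  qed
  moreover have "infinite ?L" using infinite_cexp[OF I] finite_imageD[OF _ inj] by blast
  moreover have "?L \<subseteq> carrier V" using closed by blast
  moreover obtain B where B: "basis B" "vdim V = |B|" by (rule vdim_basis[OF V])
  ultimately have "|?L| \<le>o vdim V" using card_indep_le_basis by simp
  moreover have "|?F| =o |?L|"
    using inj card_of_ordIso by (metis bij_betw_imageI)
  ultimately have "|?F| \<le>o vdim V" using ordIso_ordLeq_trans by blast
  then show ?thesis by (simp add: cexp_def Field_card_of)
qed

lemma vdim_le_card:
  assumes "vectorspace class_ring V"
  shows "vdim V \<le>o |carrier V|"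
proof -
  interpret vectorspace class_ring V by fact
  obtain B where B: "basis B" "vdim V = |B|" by (rule vdim_basis[OF assms])
  then show ?thesis using card_of_mono1[of B "carrier V"] by (simp add: basis_def)
qed

lemma lists_card_le:
  assumes "infinite X" "|Y| \<le>o |X|"
  shows "|lists Y| \<le>o |X|"
  using card_of_lists_mono[OF assms(2)] card_of_lists_infinite[OF assms(1)] ordLeq_ordIso_trans by blast

lemma Fpow_card_le:
  assumes "infinite X" "|Y| \<le>o |X|"
  shows "|Fpow Y| \<le>o |X|"
proof -
  have "Fpow Y \<subseteq> set ` lists Y"
  proof
    fix S assume "S \<in> Fpow Y"
    then obtain l where "set l = S" "S \<subseteq> Y" using finite_list by (auto simp: Fpow_def)
    then show "S \<in> set ` lists Y" by (auto simp: image_iff intro!: bexI[of _ l])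
  qed
  then have "|Fpow Y| \<le>o |lists Y|" using surj_imp_ordLeq by blast
  then show ?thesis using lists_card_le[OF assms] ordLeq_transitive by blast
qed

lemma PiE_card_le:
  assumes X: "infinite X" and S: "finite S" and B: "\<And>i. i \<in> S \<Longrightarrow> |B i| \<le>o |X|"
  shows "|\<Pi>\<^sub>E i\<in>S. B i| \<le>o |X|"
proof -
  obtain l where l: "set l = S" using finite_list[OF S] by blast
  have "inj_on (\<lambda>x. map x l) (\<Pi>\<^sub>E i\<in>S. B i)"
  proof (rule inj_onI)
    fix x y assume xy: "x \<in> (\<Pi>\<^sub>E i\<in>S. B i)" "y \<in> (\<Pi>\<^sub>E i\<in>S. B i)" "map x l = map y l"
    then show "x = y" using l by (intro PiE_ext[OF xy(1,2)]) auto
  qed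
  moreover have "(\<lambda>x. map x l) ` (\<Pi>\<^sub>E i\<in>S. B i) \<subseteq> lists (\<Union>i\<in>S. B i)"
  proof (rule image_subsetI)
    fix x assume x: "x \<in> (\<Pi>\<^sub>E i\<in>S. B i)"
    show "map x l \<in> lists (\<Union>i\<in>S. B i)"
      unfolding in_lists_conv_set using l PiE_mem[OF x] by auto
  qed
  ultimately have "|\<Pi>\<^sub>E i\<in>S. B i| \<le>o |lists (\<Union>i\<in>S. B i)|"
    using card_of_ordLeq by blast
  moreover have "|\<Union>i\<in>S. B i| \<le>o |X|"
    using S X by (intro card_of_UNION_ordLeq_infinite) (auto intro: B ordLess_imp_ordLeq
      finite_ordLess_infinite2)
  ultimately show ?thesis using lists_card_le[OF X] ordLeq_transitive by blast
qed

text \<open>A finitely supported function is determined by its graph over the support, a finite set of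
pairs.\<close>

lemma monoid_algebra_card_le:
  assumes X: "infinite X" and "|carrier G| \<le>o |X|" "|UNIV :: 'k::field set| \<le>o |X|"
  shows "|carrier (monoid_algebra G :: ('k, 'x \<Rightarrow> 'k) module)| \<le>o |X|"
proof -
  let ?C = "carrier (monoid_algebra G :: ('k, 'x \<Rightarrow> 'k) module)"
  let ?g = "\<lambda>u :: 'x \<Rightarrow> 'k. (\<lambda>x. (x, u x)) ` {x. u x \<noteq> 0}"
  have "inj_on ?g ?C"
  proof (rule inj_onI, rule ext)
    fix u v :: "'x \<Rightarrow> 'k" and x assume eq: "?g u = ?g v"
    show "u x = v x"
    proof (cases "u x = 0 \<and> v x = 0")
      case False
      then have "(x, u x) \<in> ?g u \<or> (x, v x) \<in> ?g v" by auto
      then have "(x, u x) \<in> ?g v \<or> (x, v x) \<in> ?g u" using eq by blast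
      then show ?thesis by auto
    qed simp
  qed
  moreover have "?g ` ?C \<subseteq> Fpow (carrier G \<times> UNIV)"
    by (auto simp: Fpow_def monoid_algebra_simps)
  ultimately have "|?C| \<le>o |Fpow (carrier G \<times> (UNIV :: 'k set))|"
    using card_of_ordLeq by blast
  moreover have "|carrier G \<times> (UNIV :: 'k set)| \<le>o |X|"
    using assms by (rule card_of_Times_ordLeq_infinite)
  ultimately show ?thesis using Fpow_card_le[OF X] ordLeq_transitive by blast
qed

section \<open>Matrix algebras\<close>

text \<open>The zero matrix if an index is out of range, so that matrix units of different sizes can be
indexed by the same set.\<close>

definition matrix_unit :: "nat \<Rightarrow> nat \<Rightarrow> nat \<Rightarrow> 'k::field mat" where
  "matrix_unit n p q = mat n n (\<lambda>ij. of_bool (ij = (p, q)))"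

lemma matrix_unit_mult:
  assumes "p < n" "q < n" "r < n" "s < n"
  shows "matrix_unit n p q * matrix_unit n r s = (if q = r then matrix_unit n p s else 0\<^sub>m n n
    :: 'a::field mat)"
proof (rule eq_matI)
  fix i j
  assume "i < dim_row (if q = r then matrix_unit n p s else (0\<^sub>m n n :: 'a mat))"
    "j < dim_col (if q = r then matrix_unit n p s else (0\<^sub>m n n :: 'a mat))"
  then have ij: "i < n" "j < n" by (auto simp: matrix_unit_def split: if_splits)
  have "(matrix_unit n p q * matrix_unit n r s) $$ (i, j) =
      (\<Sum>l<n. of_bool ((i, l) = (p, q)) * (of_bool ((l, j) = (r, s)) :: 'a))"
    using ij by (simp add: matrix_unit_def scalar_prod_def atLeast0LessThan)
  also have "\<dots> = (\<Sum>l<n. if l = q then of_bool (i = p \<and> q = r \<and> j = s) else 0)"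
    by (intro sum.cong) auto
  also have "\<dots> = of_bool (i = p \<and> q = r \<and> j = s)" using assms by simp
  finally have e: "(matrix_unit n p q * matrix_unit n r s) $$ (i, j) = (of_bool (i = p \<and> q = r \<and> j
    = s) :: 'a)" .
  show "(matrix_unit n p q * matrix_unit n r s) $$ (i, j) =
      (if q = r then matrix_unit n p s else 0\<^sub>m n n :: 'a mat) $$ (i, j)"
    unfolding e using ij by (simp add: matrix_unit_def)
qed (simp_all add: matrix_unit_def)

lemma matrix_units_span:
  assumes W: "subspace_of (module_mat TYPE('k::field) n n) W"
    and "\<And>p q. p < n \<Longrightarrow> q < n \<Longrightarrow> matrix_unit n p q \<in> W"
  shows "carrier_mat n n \<subseteq> W"
proof
  fix M :: "'k mat" assume M: "M \<in> carrier_mat n n"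
  have "finite X \<Longrightarrow> X \<subseteq> {..<n} \<times> {..<n} \<Longrightarrow> mat n n (\<lambda>ij. if ij \<in> X then M $$ ij else 0) \<in> W" for X
  proof (induction X rule: finite_induct)
    case empty
    have "mat n n (\<lambda>ij. if ij \<in> {} then M $$ ij else 0) = 0\<^sub>m n n" by auto
    then show ?case using W by (simp add: subspace_of_def module_mat_simps)
  next
    case (insert x X)
    obtain p q where x: "x = (p, q)" by (cases x)
    have "M $$ (p, q) \<cdot>\<^sub>m matrix_unit n p q \<in> W"
      using W assms(2) insert.prems x by (simp add: subspace_of_def module_mat_simps)
    then have "M $$ (p, q) \<cdot>\<^sub>m matrix_unit n p q + mat n n (\<lambda>ij. if ij \<in> X then M $$ ij else 0) \<in> W"
      using W insert by (simp add: subspace_of_def module_mat_simps)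
    also have "M $$ (p, q) \<cdot>\<^sub>m matrix_unit n p q + mat n n (\<lambda>ij. if ij \<in> X then M $$ ij else 0) =
        mat n n (\<lambda>ij. if ij \<in> insert x X then M $$ ij else 0)"
      using insert.hyps x by (intro eq_matI) (auto simp: matrix_unit_def)
    finally show ?case .
  qed
  from this[of "{..<n} \<times> {..<n}"]
  have "mat n n (\<lambda>ij. if ij \<in> {..<n} \<times> {..<n} then M $$ ij else 0) \<in> W" by simp
  also have "mat n n (\<lambda>ij. if ij \<in> {..<n} \<times> {..<n} then M $$ ij else 0) = M"
    using M by (intro eq_matI) auto
  finally show "M \<in> W" .
qed

text \<open>A matrix algebra with a chosen isomorphism, through which it inherits matrix units and
coordinates.\<close>

locale matrix_iso = unital_algebra A for A :: "('k::field, 'a) module" (structure) +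
  fixes n :: nat and h :: "'a \<Rightarrow> 'k mat"
  assumes iso: "h \<in> alg_iso A (module_mat TYPE('k) n n)"
begin

lemma
  shows h_closed: "x \<in> carrier A \<Longrightarrow> h x \<in> carrier_mat n n"
    and h_add: "x \<in> carrier A \<Longrightarrow> y \<in> carrier A \<Longrightarrow> h (x \<oplus> y) = h x + h y"
    and h_smult: "x \<in> carrier A \<Longrightarrow> h (c \<odot> x) = c \<cdot>\<^sub>m h x"
    and h_mult: "x \<in> carrier A \<Longrightarrow> y \<in> carrier A \<Longrightarrow> h (x \<otimes> y) = h x * h y"
    and h_one: "h \<one> = 1\<^sub>m n"
    and h_bij: "bij_betw h (carrier A) (carrier_mat n n)"
  using iso by (auto simp: alg_iso_def Ring.ring_hom_def LinearCombinations.module_hom_def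
    module_mat_simps)

lemma h_inj: "x \<in> carrier A \<Longrightarrow> y \<in> carrier A \<Longrightarrow> h x = h y \<Longrightarrow> x = y"
  using bij_betw_imp_inj_on[OF h_bij] by (blast dest: inj_onD)

lemma h_zero: "h \<zero> = 0\<^sub>m n n"
proof -
  have z: "\<zero> \<in> carrier A" by (rule vectorspaceD(1)[OF vectorspace_axioms])
  have "h \<zero> = h (0 \<odot> \<zero>)" using vectorspaceD(7)[OF vectorspace_axioms z] by (simp only:)
  also have "\<dots> = 0 \<cdot>\<^sub>m h \<zero>" by (rule h_smult[OF z])
  also have "\<dots> = 0\<^sub>m n n" using h_closed[OF z] by (intro eq_matI) auto
  finally show ?thesis .
qed

definition unit :: "nat \<Rightarrow> nat \<Rightarrow> 'a" where
  "unit p q = inv_into (carrier A) h (matrix_unit n p q)"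

lemma unit: "unit p q \<in> carrier A" "h (unit p q) = matrix_unit n p q"
proof -
  have "matrix_unit n p q \<in> h ` carrier A"
    using bij_betw_imp_surj_on[OF h_bij] by (simp add: matrix_unit_def)
  then show "unit p q \<in> carrier A" "h (unit p q) = matrix_unit n p q"
    unfolding unit_def by (auto intro: inv_into_into f_inv_into_f)
qed

definition coord :: "nat \<Rightarrow> nat \<Rightarrow> 'a \<Rightarrow> 'k" where
  "coord p q x = h x $$ (p, q)"

lemma coord_linear:
  assumes "p < n" "q < n"
  shows "x \<in> carrier A \<Longrightarrow> y \<in> carrier A \<Longrightarrow> coord p q (x \<oplus> y) = coord p q x + coord p q y"
    and "x \<in> carrier A \<Longrightarrow> coord p q (c \<odot> x) = c * coord p q x"
  using assms h_closed[of x] h_closed[of y] by (auto simp: coord_def h_add h_smult)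

lemma coord_one: "p < n \<Longrightarrow> coord p p \<one> = 1"
  by (simp add: coord_def h_one)

lemma units_span:
  assumes "subspace_of A W" "\<And>p q. unit p q \<in> W"
  shows "carrier A \<subseteq> W"
proof
  fix x assume x: "x \<in> carrier A"
  have sub: "W \<subseteq> carrier A" using assms(1) by (simp add: subspace_of_def)
  have "subspace_of (module_mat TYPE('k) n n) (h ` W)"
    unfolding subspace_of_def
  proof (intro conjI ballI allI)
    show "h ` W \<subseteq> carrier (module_mat TYPE('k) n n)"
      using sub h_closed by (auto simp: module_mat_simps)
    show "\<zero>\<^bsub>module_mat TYPE('k) n n\<^esub> \<in> h ` W"
      using assms(1) h_zero by (auto simp: subspace_of_def module_mat_simps image_iff
        intro!: bexI[of _ "\<zero>"])
    fix x y c assume "x \<in> h ` W"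
    then obtain a where a: "a \<in> W" "x = h a" by blast
    then have "c \<odot>\<^bsub>module_mat TYPE('k) n n\<^esub> x = h (c \<odot> a)" "c \<odot> a \<in> W"
      using sub assms(1) by (auto simp: module_mat_simps h_smult subspace_of_def subset_iff)
    then show "c \<odot>\<^bsub>module_mat TYPE('k) n n\<^esub> x \<in> h ` W" by simp
    assume "y \<in> h ` W"
    then obtain b where b: "b \<in> W" "y = h b" by blast
    then have "x \<oplus>\<^bsub>module_mat TYPE('k) n n\<^esub> y = h (a \<oplus> b)" "a \<oplus> b \<in> W"
      using a sub assms(1) by (auto simp: module_mat_simps h_add subspace_of_def subset_iff)
    then show "x \<oplus>\<^bsub>module_mat TYPE('k) n n\<^esub> y \<in> h ` W" by simp
  qed
  moreover have "matrix_unit n p q \<in> h ` W" for p q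
    using imageI[OF assms(2)[of p q], of h] unit(2) by simp
  ultimately have "carrier_mat n n \<subseteq> h ` W"
    by (intro matrix_units_span)
  then obtain y where "y \<in> W" "h x = h y" using h_closed[OF x] by blast
  then show "x \<in> W" using h_inj[OF x, of y] sub by blast
qed

lemma commutator_units:
  assumes "2 \<le> n"
  shows "coord 0 1 (commutator (unit 0 0) (unit 0 1)) = 1"
proof -
  have u: "unit 0 0 \<in> carrier A" "unit 0 1 \<in> carrier A" by (rule unit)+
  have "h (commutator (unit 0 0) (unit 0 1)) =
      matrix_unit n 0 0 * matrix_unit n 0 1 + (-1) \<cdot>\<^sub>m (matrix_unit n 0 1 * matrix_unit n 0 0)"
    using u vectorspaceD(3)[OF vectorspace_axioms]
    by (simp add: commutator_smult_form h_add h_smult h_mult unit(2))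
  also have "\<dots> = matrix_unit n 0 1"
    using assms by (auto simp: matrix_unit_mult) (auto simp: matrix_unit_def)
  finally show ?thesis using assms by (simp add: coord_def matrix_unit_def)
qed

lemma carrier_card_le:
  assumes "infinite X" "|UNIV :: 'k set| \<le>o |X|"
  shows "|carrier A| \<le>o |X|"
proof -
  have "inj_on (\<lambda>M :: 'k mat. map (\<lambda>ij. M $$ ij) (List.product [0..<n] [0..<n])) (carrier_mat n n)"
  proof (rule inj_onI)
    fix M N :: "'k mat" assume MN: "M \<in> carrier_mat n n" "N \<in> carrier_mat n n"
      and eq: "map (\<lambda>ij. M $$ ij) (List.product [0..<n] [0..<n]) = map (\<lambda>ij. N $$ ij) (List.product
        [0..<n] [0..<n])"
    show "M = N" using MN eq by (intro eq_matI) auto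
  qed
  then have "|carrier_mat n n :: 'k mat set| \<le>o |lists (UNIV :: 'k set)|"
    using card_of_ordLeq by blast
  moreover have "|carrier A| \<le>o |carrier_mat n n :: 'k mat set|"
    by (rule ordIso_imp_ordLeq[OF card_of_ordIsoI[OF h_bij]])
  ultimately show ?thesis using lists_card_le[OF assms] by (meson ordLeq_transitive)
qed

text \<open>For \<open>n = 1\<close>, any two elements are proportional, so a basis has at most one element.\<close>

lemma size_ge_2:
  assumes "cone <o vdim A" "1 \<le> n"
  shows "2 \<le> n"
proof (rule ccontr)
  assume "\<not> 2 \<le> n"
  then have n: "n = 1" using assms(2) by simp
  obtain B where B: "basis B" "vdim A = |B|" by (rule vdim_basis[OF vectorspace_axioms])
  have "\<not> (\<exists>a. B \<subseteq> {a})"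
  proof
    assume "\<exists>a. B \<subseteq> {a}"
    then obtain a where "B \<subseteq> {a}" by blast
    then have "|B| \<le>o |{a}|" by (rule card_of_mono1)
    moreover have "|{a}| \<le>o cone" unfolding cone_def by (rule card_of_singl_ordLeq) simp
    ultimately have "|B| \<le>o cone" using ordLeq_transitive by blast
    then show False using assms(1) B(2) not_ordLess_ordLeq by metis
  qed
  then obtain b c where bc: "b \<in> B" "c \<in> B" "b \<noteq> c" by blast
  have BA: "B \<subseteq> carrier A" and Bi: "lin_indpt B" using B(1) by (auto simp: basis_def)
  have bcA: "b \<in> carrier A" "c \<in> carrier A" using bc BA by auto
  let ?x = "coord 0 0 b" and ?y = "coord 0 0 c"
  (* the coefficients of the proportionality relation between b and c *)
  define a where "a v = (if v = b then ?y else - ?x)" for v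
  have yb: "?y \<odot> b \<in> carrier A" and xc: "(- ?x) \<odot> c \<in> carrier A"
    using bcA smult_carrier by blast+
  have "h (?y \<odot> b \<oplus> (- ?x) \<odot> c) = ?y \<cdot>\<^sub>m h b + (- ?x) \<cdot>\<^sub>m h c"
    by (simp only: h_add[OF yb xc] h_smult[OF bcA(1)] h_smult[OF bcA(2)])
  also have "\<dots> = h \<zero>"
    unfolding h_zero using h_closed[OF bcA(1)] h_closed[OF bcA(2)]
    by (intro eq_matI) (auto simp: n coord_def)
  finally have zero: "?y \<odot> b \<oplus> (- ?x) \<odot> c = \<zero>"
    using vectorspaceD(1,2)[OF vectorspace_axioms] yb xc by (intro h_inj) blast+
  have "lincomb a ({c} \<union> {b}) = a b \<odot> b \<oplus> lincomb a {c}"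
    by (rule lincomb_insert) (use bc bcA in auto)
  also have "lincomb a {c} = a c \<odot> c"
    using bcA smult_carrier by (simp add: lincomb_def)
  also have "a b = ?y" by (simp add: a_def)
  also have "a c = - ?x" using bc(3) by (simp add: a_def)
  finally have "lincomb a ({c} \<union> {b}) = \<zero>" by (simp only: zero)
  then have lc: "lincomb a {c, b} = \<zero>" by (simp only: Un_insert_left Un_empty_left)
  have "a b = 0 \<and> a c = 0"
  proof (rule ccontr)
    assume "\<not> (a b = 0 \<and> a c = 0)"
    then obtain v where "v \<in> {c, b}" "a v \<noteq> 0" by auto
    then have "lin_dep B"
      using bc lc by (intro lin_dep_crit[of "{c, b}" B a v]) (auto simp: class_ring_simps)
    then show False using Bi by blast
  qed
  then have "?x = 0" using bc by (simp add: a_def)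
  then have "h b = h \<zero>"
    unfolding h_zero using h_closed[OF bcA(1)] by (intro eq_matI) (auto simp: coord_def n)
  then have "b = \<zero>"
    by (rule h_inj[OF bcA(1) vectorspaceD(1)[OF vectorspace_axioms]])
  then show False using vs_zero_lin_dep[OF BA Bi] bc by blast
qed

end

section \<open>Derivations of infinite tensor products of matrix algebras\<close>

lemma (in unital_algebra) Der_one:
  assumes "d \<in> carrier (Der A)"
  shows "d \<one> = \<zero>"
proof -
  have d1: "d \<one> \<in> carrier A" by (rule Der_D(1)[OF assms alg.one_closed])
  have "d (\<one> \<otimes> \<one>) = (d \<one> \<otimes> \<one>) \<oplus> (\<one> \<otimes> d \<one>)"
    by (rule Der_D(5)[OF assms]) simp_all
  then have "d \<one> = d \<one> \<oplus> d \<one>" using d1 by simp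
  then show ?thesis using d1 by simp
qed

text \<open>The set where two derivations agree is a subalgebra.\<close>

lemma (in unital_algebra) Der_eqI:
  assumes d: "d \<in> carrier (Der A)" "d' \<in> carrier (Der A)"
    and gen: "\<And>W. subspace_of A W \<Longrightarrow> \<one> \<in> W \<Longrightarrow> (\<And>x y. x \<in> W \<Longrightarrow> y \<in> W \<Longrightarrow> x \<otimes> y \<in> W) \<Longrightarrow>
        X \<subseteq> W \<Longrightarrow> carrier A \<subseteq> W"
    and X: "X \<subseteq> carrier A" "\<And>x. x \<in> X \<Longrightarrow> d x = d' x"
  shows "d = d'"
proof
  fix x
  have "carrier A \<subseteq> {x \<in> carrier A. d x = d' x}"
  proof (rule gen)
    show "subspace_of A {x \<in> carrier A. d x = d' x}"
      by (rule subspace_of_equalizer[OF vectorspace_axioms Der_D(6)[OF d(1)] Der_D(6)[OF d(2)]])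
    show "\<one> \<in> {x \<in> carrier A. d x = d' x}"
      using Der_one[OF d(1)] Der_one[OF d(2)] by simp
    show "x \<otimes> y \<in> {x \<in> carrier A. d x = d' x}"
      if "x \<in> {x \<in> carrier A. d x = d' x}" "y \<in> {x \<in> carrier A. d x = d' x}" for x y
      using that Der_D(5)[OF d(1)] Der_D(5)[OF d(2)] by simp
    show "X \<subseteq> {x \<in> carrier A. d x = d' x}" using X by blast
  qed
  then show "d x = d' x"
    using Der_D(2)[OF d(1)] Der_D(2)[OF d(2)] by (cases "x \<in> carrier A") auto
qed

lemma algebra_map_commutator:
  assumes "unital_algebra A" "unital_algebra B" "p \<in> algebra_maps A B" "x \<in> carrier A" "y \<in> carrier A"
  shows "unital_algebra.commutator B (p x) (p y) = p (unital_algebra.commutator A x y)"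
proof -
  interpret A: unital_algebra A by fact
  interpret B: unital_algebra B by fact
  note p = linear_mapsD[OF algebra_mapsD(1)[OF assms(3)]] algebra_mapsD(2)[OF assms(3)]
  show ?thesis
    using assms(4,5) by (simp add: A.commutator_smult_form B.commutator_smult_form p)
qed

text \<open>The isomorphisms \<open>h\<close> with matrix algebras are chosen once for all factors; size at least
\<open>2\<close> makes every factor noncommutative.\<close>

locale matrix_tensor_factors = tensor_factors A I for A :: "'i \<Rightarrow> ('k::field, 'b) module"
  and I :: "'i set" +
  fixes n :: "'i \<Rightarrow> nat" and h :: "'i \<Rightarrow> 'b \<Rightarrow> 'k mat"
  assumes infinite: "infinite I"
    and matrix: "i \<in> I \<Longrightarrow> matrix_iso (A i) (n i) (h i)"
    and size: "i \<in> I \<Longrightarrow> 2 \<le> n i"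
begin

abbreviation "munit i \<equiv> matrix_iso.unit (A i) (n i) (h i)"

sublocale Q: unital_algebra \<A> by (rule infinite_tensor_algebra)

lemma munit_closed: "i \<in> I \<Longrightarrow> munit i p q \<in> carrier (A i)"
  by (rule matrix_iso.unit(1)[OF matrix])

lemma factor_emb_closed: "i \<in> I \<Longrightarrow> a \<in> carrier (A i) \<Longrightarrow> factor_emb i a \<in> carrier \<A>"
  by (rule linear_mapsD(1)[OF algebra_mapsD(1)[OF factor_emb_algebra_map]])

lemma commutator_distinct:
  assumes "i \<in> I" "j \<in> I" "i \<noteq> j" "a \<in> carrier (A i)" "b \<in> carrier (A j)"
  shows "Q.commutator (factor_emb i a) (factor_emb j b) = \<zero>\<^bsub>\<A>\<^esub>"
proof -
  have "(\<lambda>l\<in>{j}. b) \<in> carrier (G {j})" using assms by auto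
  then have "delta (\<lambda>l\<in>{j}. b) \<in> carrier (F {j})" by (rule delta_closed)
  moreover have "factor_emb j b = stage {j} (delta (\<lambda>l\<in>{j}. b))"
    by (simp only: factor_emb_def pure_def)
  ultimately have "factor_emb i a \<otimes>\<^bsub>\<A>\<^esub> factor_emb j b = factor_emb j b \<otimes>\<^bsub>\<A>\<^esub> factor_emb i a"
    using factor_emb_commute[of "{j}" i a "delta (\<lambda>l\<in>{j}. b)"] assms by simp
  then show ?thesis
    using assms Q.commutator_eq_zero_iff factor_emb_closed by simp
qed

lemma finite_noncommuting_factors:
  assumes a: "\<And>i. i \<in> I \<Longrightarrow> a i \<in> carrier (A i)" and x: "x \<in> carrier \<A>"
  shows "finite {i \<in> I. Q.commutator (factor_emb i (a i)) x \<noteq> \<zero>\<^bsub>\<A>\<^esub>}"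
proof -
  obtain S u where S: "S \<in> P" and u: "u \<in> carrier (F S)" "x = stage S u"
    using x by (auto simp: carrier_infinite_tensor)
  have "Q.commutator (factor_emb i (a i)) x = \<zero>\<^bsub>\<A>\<^esub>" if "i \<in> I" "i \<notin> S" for i
    using factor_emb_commute[OF S that a[OF that(1)] u(1)] factor_emb_closed[OF that(1) a[OF
      that(1)]] x u(2)
    by (subst Q.commutator_eq_zero_iff) auto
  then have "{i \<in> I. Q.commutator (factor_emb i (a i)) x \<noteq> \<zero>\<^bsub>\<A>\<^esub>} \<subseteq> S" by blast
  then show ?thesis using S finite_subset by blast
qed

text \<open>For the matrix units, \<open>[E\<^sub>0\<^sub>0, E\<^sub>0\<^sub>1] = E\<^sub>0\<^sub>1\<close>. It is detected by the coordinate \<open>(0, 1)\<close> in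
position \<open>i\<close> and the coordinate \<open>(0, 0)\<close>, which is \<open>1\<close> on units, in all other positions.\<close>

lemma commutator_same_nonzero:
  assumes i: "i \<in> I"
  shows "Q.commutator (factor_emb i (munit i 0 0)) (factor_emb i (munit i 0 1)) \<noteq> \<zero>\<^bsub>\<A>\<^esub>"
proof -
  interpret Ai: matrix_iso "A i" "n i" "h i" by (rule matrix[OF i])
  let ?c = "Ai.commutator (munit i 0 0) (munit i 0 1)"
  define \<mu> where "\<mu> j = matrix_iso.coord (h j) 0 (if j = i then 1 else 0)" for j
  have "factor_emb i ?c \<noteq> \<zero>\<^bsub>\<A>\<^esub>"
  proof (rule factor_emb_nonzero[of \<mu>])
    fix j a b c assume j: "j \<in> I"
    interpret Aj: matrix_iso "A j" "n j" "h j" by (rule matrix[OF j])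
    have n: "0 < n j" "(if j = i then 1 else 0) < n j" using size[OF j] by auto
    assume a: "a \<in> carrier (A j)"
    show "\<mu> j (c \<odot>\<^bsub>A j\<^esub> a) = c * \<mu> j a" unfolding \<mu>_def by (rule Aj.coord_linear(2)[OF n a])
    assume b: "b \<in> carrier (A j)"
    show "\<mu> j (a \<oplus>\<^bsub>A j\<^esub> b) = \<mu> j a + \<mu> j b" unfolding \<mu>_def by (rule Aj.coord_linear(1)[OF n a b])
  next
    fix j assume j: "j \<in> I" "j \<noteq> i"
    interpret Aj: matrix_iso "A j" "n j" "h j" by (rule matrix[OF j(1)])
    show "\<mu> j \<one>\<^bsub>A j\<^esub> = 1" using Aj.coord_one[of 0] size[OF j(1)] j(2) by (simp add: \<mu>_def)
  next
    show "?c \<in> carrier (A i)" by (rule Ai.commutator_closed[OF Ai.unit(1) Ai.unit(1)])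
    show "\<mu> i ?c \<noteq> 0" using Ai.commutator_units[OF size[OF i]] by (simp add: \<mu>_def)
  qed (rule i)
  then show ?thesis
    using algebra_map_commutator[OF factor[OF i] infinite_tensor_algebra factor_emb_algebra_map[OF
      i] Ai.unit(1) Ai.unit(1)] by simp
qed

sublocale family: almost_central_family \<A> "\<lambda>i. factor_emb i (munit i 0 0)" I
  by unfold_locales (simp_all add: factor_emb_closed munit_closed finite_noncommuting_factors)

lemma finite_of_inner:
  assumes "family.sum_derivation c \<in> Inder \<A>"
  shows "finite {i \<in> I. c i \<noteq> 0}"
  by (rule family.inner_sum_derivation_finite[where f = "\<lambda>i. factor_emb i (munit i 0 1)"])
    (use assms in \<open>simp_all add: factor_emb_closed munit_closed finite_noncommuting_factors
        commutator_distinct commutator_same_nonzero[unfolded One_nat_def]\<close>)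

sublocale outer: quotient_space "Der \<A>" "Inder \<A>" by (rule Q.Outder_quotient)

lemma cexp_le_vdim_Der: "|UNIV :: 'k set| ^c |I| \<le>o vdim (Der \<A>)"
proof (rule cexp_le_vdim[OF Q.Der_vectorspace infinite])
  fix c :: "'i \<Rightarrow> 'k"
  assume "family.sum_derivation c = \<zero>\<^bsub>Der \<A>\<^esub>"
  moreover have "\<zero>\<^bsub>Der \<A>\<^esub> \<in> Inder \<A>"
    using Q.Inder_subspace by (simp only: subspace_of_def)
  ultimately show "finite {i \<in> I. c i \<noteq> 0}"
    by (intro finite_of_inner) (simp only:)
qed (rule family.sum_derivation_in_Der family.sum_derivation_add family.sum_derivation_smult)+

lemma cexp_le_vdim_Outder: "|UNIV :: 'k set| ^c |I| \<le>o vdim (Outder \<A>)"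
  unfolding Outder_def
proof (rule cexp_le_vdim[OF outer.quotient_vectorspace infinite])
  let ?t = "\<lambda>c. Inder \<A> +>\<^bsub>Der \<A>\<^esub> family.sum_derivation c"
  note D = family.sum_derivation_in_Der and L = linear_mapsD[OF outer.coset_linear]
  fix b :: 'k and c d :: "'i \<Rightarrow> 'k"
  show "?t c \<in> carrier outer.Q" by (rule L(1)[OF D])
  show "?t (\<lambda>i. c i + d i) = ?t c \<oplus>\<^bsub>outer.Q\<^esub> ?t d"
    using L(2)[OF D D] by (simp only: family.sum_derivation_add)
  show "?t (\<lambda>i. b * c i) = b \<odot>\<^bsub>outer.Q\<^esub> ?t c"
    using L(3)[OF D] by (simp only: family.sum_derivation_smult)
  assume "?t c = \<zero>\<^bsub>outer.Q\<^esub>"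
  then have "?t c = Inder \<A>" by (simp add: quotient_module_def)
  then show "finite {i \<in> I. c i \<noteq> 0}"
    using outer.coset_eq_N_iff[OF D] by (intro finite_of_inner) blast
qed

abbreviation "X \<equiv> Func I (UNIV :: 'k set)"

lemma field_le_X: "|UNIV :: 'k set| \<le>o |X|"
proof -
  have "I \<noteq> {}" using infinite by auto
  then have "|UNIV :: 'k set| \<le>o |UNIV :: 'k set| ^c |I|"
    by (intro ordLeq_cexp1) (simp_all add: card_of_ordIso_czero_iff_empty)
  then show ?thesis by (simp add: cexp_def Field_card_of)
qed

text \<open>There are at most \<open>|X|\<close> finite index sets, and at each stage at most \<open>|X|\<close> families and
formal combinations of them.\<close>

lemma carrier_le_X: "|carrier \<A>| \<le>o |X|"
  unfolding carrier_infinite_tensor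
proof (rule card_of_UNION_ordLeq_infinite)
  have X: "infinite X" by (rule infinite_cexp[OF infinite])
  show "infinite X" by (rule X)
  have "P \<subseteq> Fpow I" by (auto simp: Fpow_def)
  then show "|P| \<le>o |X|"
    by (intro ordLeq_transitive[OF card_of_mono1 Fpow_card_le[OF X index_le_cexp]])
  show "\<forall>S\<in>P. |stage S ` carrier (F S)| \<le>o |X|"
  proof
    fix S assume S: "S \<in> P"
    have "|\<Pi>\<^sub>E i\<in>S. carrier (A i)| \<le>o |X|"
      using S matrix_iso.carrier_card_le[OF matrix X field_le_X] by (intro PiE_card_le[OF X]) auto
    then have "|carrier (F S)| \<le>o |X|"
      by (intro monoid_algebra_card_le[OF X _ field_le_X]) simp
    then show "|stage S ` carrier (F S)| \<le>o |X|"
      by (rule ordLeq_transitive[OF card_of_image])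
  qed
qed

text \<open>A derivation is determined by its values on the matrix units of all factors, which are
indexed by \<open>I \<times> \<nat> \<times> \<nat>\<close>, a set of size \<open>|I|\<close>.\<close>

lemma Der_le_cexp: "|carrier (Der \<A>)| \<le>o |UNIV :: 'k set| ^c |I|"
proof -
  let ?J = "I \<times> (UNIV :: nat set) \<times> (UNIV :: nat set)"
  let ?m = "\<lambda>(i, p, q). factor_emb i (munit i p q)"
  let ?r = "\<lambda>d. \<lambda>j. if j \<in> ?J then d (?m j) else undefined"
  have m: "?m j \<in> carrier \<A>" if "j \<in> ?J" for j
    using that factor_emb_closed munit_closed by auto
  have "inj_on ?r (carrier (Der \<A>))"
  proof (rule inj_onI)
    fix d d' assume d: "d \<in> carrier (Der \<A>)" "d' \<in> carrier (Der \<A>)" and eq: "?r d = ?r d'"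
    show "d = d'"
    proof (rule Q.Der_eqI[OF d, of "?m ` ?J"])
      show "?m ` ?J \<subseteq> carrier \<A>" using m by blast
      show "d x = d' x" if x: "x \<in> ?m ` ?J" for x
      proof -
        obtain j where j: "x = ?m j" "j \<in> ?J" by (rule imageE[OF x])
        show ?thesis using fun_cong[OF eq, of j] unfolding j(1) if_P[OF j(2)] .
      qed
      fix W assume W: "subspace_of \<A> W" "\<one>\<^bsub>\<A>\<^esub> \<in> W" "\<And>x y. x \<in> W \<Longrightarrow> y \<in> W \<Longrightarrow> x \<otimes>\<^bsub>\<A>\<^esub> y \<in> W"
        and sub: "?m ` ?J \<subseteq> W"
      show "carrier \<A> \<subseteq> W"
      proof (rule generated_by_factors[OF W])
        fix i a assume i: "i \<in> I" and a: "a \<in> carrier (A i)"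
        interpret Ai: matrix_iso "A i" "n i" "h i" by (rule matrix[OF i])
        have "carrier (A i) \<subseteq> {a \<in> carrier (A i). factor_emb i a \<in> W}"
        proof (rule Ai.units_span)
          show "subspace_of (A i) {a \<in> carrier (A i). factor_emb i a \<in> W}"
            by (rule subspace_of_preimage[OF Ai.vectorspace_axioms algebra_mapsD(1)[OF
              factor_emb_algebra_map[OF i]] W(1)])
          fix p q
          have "?m (i, p, q) \<in> W" by (rule subsetD[OF sub], rule imageI) (simp add: i)
          then show "Ai.unit p q \<in> {a \<in> carrier (A i). factor_emb i a \<in> W}" using Ai.unit(1) by simp
        qed
        then show "factor_emb i a \<in> W" using a by blast
      qed
    qed
  qed
  moreover have "?r ` carrier (Der \<A>) \<subseteq> Func ?J (carrier \<A>)"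
    using m Q.Der_D(1) by (auto simp: Func_def)
  ultimately have "|carrier (Der \<A>)| \<le>o |Func ?J (carrier \<A>)|"
    using card_of_ordLeq by blast
  also have "|Func ?J (carrier \<A>)| = |carrier \<A>| ^c |?J|" by (simp add: cexp_def Field_card_of)
  also have "|carrier \<A>| ^c |?J| \<le>o |X| ^c |?J|" by (rule cexp_mono1[OF carrier_le_X
    card_of_Card_order])
  also have "|X| = |UNIV :: 'k set| ^c |I|" by (simp add: cexp_def Field_card_of)
  also have "( |UNIV :: 'k set| ^c |I| ) ^c |?J| =o |UNIV :: 'k set| ^c |I|"
  proof (rule cexp_cprod_ordLeq)
    show "Cinfinite |I|" using infinite by (simp add: cinfinite_def Field_card_of)
    have "?J \<noteq> {}" using infinite by auto
    then show "Cnotzero |?J|" by (simp add: card_of_ordIso_czero_iff_empty)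
    have nat: "|UNIV :: nat set| \<le>o |I|" using infinite by (simp add: infinite_iff_card_of_nat)
    show "|?J| \<le>o |I|"
      by (intro card_of_Times_ordLeq_infinite[OF infinite] nat) simp
  qed simp
  finally show ?thesis .
qed

theorem vdim_Der: "vdim (Der \<A>) =o |UNIV :: 'k set| ^c |I|"
  by (rule iffD2[OF ordIso_iff_ordLeq conjI[OF
        ordLeq_transitive[OF vdim_le_card[OF Q.Der_vectorspace] Der_le_cexp] cexp_le_vdim_Der]])

theorem vdim_Outder: "vdim (Outder \<A>) =o |UNIV :: 'k set| ^c |I|"
proof -
  have "|carrier (Outder \<A>)| \<le>o |carrier (Der \<A>)|"
    unfolding Outder_def outer.carrier_quotient by (rule card_of_image)
  moreover have "vdim (Outder \<A>) \<le>o |carrier (Outder \<A>)|"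
    unfolding Outder_def by (rule vdim_le_card[OF outer.quotient_vectorspace])
  ultimately show ?thesis
    using Der_le_cexp cexp_le_vdim_Outder by (meson ordIso_iff_ordLeq ordLeq_transitive)
qed

end

theorem theorem6:
  fixes A :: "'i \<Rightarrow> ('k::field, 'b) module" and I :: "'i set"
  assumes "infinite I"
    and "\<And>i. i \<in> I \<Longrightarrow> matrix_algebra (A i)"
    and "\<And>i. i \<in> I \<Longrightarrow> cone <o vdim (A i)"
  shows "vdim (Der (infinite_tensor A I)) =o |UNIV :: 'k set| ^c |I| \<and>
         vdim (Outder (infinite_tensor A I)) =o |UNIV :: 'k set| ^c |I|"
proof -
  have "\<exists>n h. matrix_iso (A i) n h \<and> 2 \<le> n" if i: "i \<in> I" for i
  proof -
    obtain n h where n: "1 \<le> n" "h \<in> alg_iso (A i) (module_mat TYPE('k) n n)"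
      and A: "unital_algebra (A i)"
      using assms(2)[OF i] by (auto simp: matrix_algebra_def)
    then have "matrix_iso (A i) n h" by (intro matrix_iso.intro matrix_iso_axioms.intro)
    then show ?thesis using matrix_iso.size_ge_2[OF _ assms(3)[OF i] n(1)] by blast
  qed
  then obtain n h where nh: "\<And>i. i \<in> I \<Longrightarrow> matrix_iso (A i) (n i) (h i)" "\<And>i. i \<in> I \<Longrightarrow> 2 \<le> n i"
    by metis
  interpret matrix_tensor_factors A I n h
  proof (intro matrix_tensor_factors.intro matrix_tensor_factors_axioms.intro tensor_factors.intro)
    show "unital_algebra (A i)" if "i \<in> I" for i
      using assms(2)[OF that] by (simp add: matrix_algebra_def)
  qed (fact assms(1) nh)+
  show ?thesis using vdim_Der vdim_Outder by blast
qed

end
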